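(* Let $\mathbf{X}=(X_t)_{t\ge0}$ be a spectrally positive Lévy process of unbounded variation with Laplace exponent $\varphi$. Suppose that $\sigma=0$ and $\varphi''\in\mathrm{WLSC}(\alpha-2,c,x_0)$ for some $c\in(0,1]$, $x_0\ge0$ and $\alpha\ge1$. Then there is $M_0>1$ such that for each $M\ge M_0$ and $\rho_1,\rho_2>0$ there exists $C>0$ so that for all $t\in(0,1/\Phi(x_0))$ and any $x\in\mathbb{R}$ satisfying $$-\frac{\rho_1}{\Phi^{-1}(1/t)}\le x+t\varphi'\big(\Phi^{-1}(M/t)\big)\le\frac{\rho_2}{\Phi^{-1}(1/t)}$$ we have $$p(t,x)\ge C\,\Phi^{-1}(1/t).$$
   Context: A spectrally positive Lévy process is a Lévy process on $\mathbb{R}$ with only positive jumps. There are $\sigma\ge 0$, $b\in\mathbb{R}$ and a $\sigma$-finite measure $\nu$ on $(0,\infty)$ with $\int_{(0,\infty)}(1\wedge x^2)\,\nu(dx)<\infty$ such that the Laplace exponent $\varphi$, defined by $\mathbb{E}e^{-\lambda X_t}=e^{t\varphi(\lambda)}$ for $\lambda\ge0$, equals $$\varphi(\lambda)=\sigma^2\lambda^2-b\lambda+\int_{(0,\infty)}\big(e^{-\lambda x}-1+\lambda x\mathbf{1}_{x<1}\big)\,\nu(dx).$$ Unbounded (infinite) variation means that $\sigma>0$ or $\int_{(0,1)}x\,\nu(dx)=\infty$. Scaling: a nonnegative function $f$ belongs to $\mathrm{WLSC}(\alpha,c,x_1)$ if $f(\lambda x)\ge c\lambda^{\alpha}f(x)$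 for all $\lambda\ge1$ and $x>x_1$. $\Phi(x)=x^2\varphi''(x)$ for $x>0$, $\Phi^*(r)=\sup_{0<s\le r}\Phi(s)$, $\Phi^{-1}(s)=\sup\{r>0:\Phi^*(r)=s\}$. Conventions: $\Phi(0)=\Phi(0^+)=0$, and $1/0=\infty$. Under the scaling assumption the law of $X_t$ is absolutely continuous for every $t>0$; $p(t,\cdot)$ denotes the continuous version of its density. *)

theory Defs
  imports "HOL-Probability.Probability"
begin

text \<open>The process is indexed by \<open>real\<close>; only the values \<open>X t\<close> with \<open>t \<ge> 0\<close> are constrained.
  Stochastic continuity is not listed separately: it follows from right-continuous paths and
  stationary increments.\<close>

locale levy_process = prob_space M for M :: "'a measure" +
  fixes X :: "real \<Rightarrow> 'a \<Rightarrow> real"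
  assumes random_variable_X: "0 \<le> t \<Longrightarrow> random_variable borel (X t)"
    and start_zero: "AE \<omega> in M. X 0 \<omega> = 0"
    and indep_increments:
      "0 \<le> \<tau> 0 \<Longrightarrow> (\<And>k. k < n \<Longrightarrow> \<tau> k \<le> \<tau> (Suc k)) \<Longrightarrow>
        indep_vars (\<lambda>_. borel) (\<lambda>k \<omega>. X (\<tau> (Suc k)) \<omega> - X (\<tau> k) \<omega>) {..<n::nat}"
    and stationary_increments:
      "0 \<le> s \<Longrightarrow> 0 \<le> h \<Longrightarrow>
        distr M borel (\<lambda>\<omega>. X (s + h) \<omega> - X s \<omega>) = distr M borel (X h)"
    and right_continuous_paths:
      "AE \<omega> in M. \<forall>t\<ge>0. ((\<lambda>s. X s \<omega>) \<longlongrightarrow> X t \<omega>) (at_right t)"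
    and left_limits:
      "AE \<omega> in M. \<forall>t>0. \<exists>l. ((\<lambda>s. X s \<omega>) \<longlongrightarrow> l) (at_left t)"

locale spectrally_positive_levy_process = levy_process +
  assumes only_positive_jumps:
    "AE \<omega> in M. \<forall>t>0. \<forall>l. ((\<lambda>s. X s \<omega>) \<longlongrightarrow> l) (at_left t) \<longrightarrow> l \<le> X t \<omega>"

definition is_laplace_exponent ::
  "'a measure \<Rightarrow> (real \<Rightarrow> 'a \<Rightarrow> real) \<Rightarrow> (real \<Rightarrow> real) \<Rightarrow> bool" where
  "is_laplace_exponent M X \<phi> \<longleftrightarrow>
    (\<forall>t\<ge>0. \<forall>u\<ge>0. has_bochner_integral M (\<lambda>\<omega>. exp (- u * X t \<omega>)) (exp (t * \<phi> u)))"

text \<open>A measure on the open half-line is encoded as a Borel measure on \<open>real\<close> that does not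
  charge \<open>{..0}\<close>.\<close>

definition levy_measure :: "real measure \<Rightarrow> bool" where
  "levy_measure \<nu> \<longleftrightarrow> sets \<nu> = sets borel \<and> emeasure \<nu> {..0} = 0 \<and> sigma_finite_measure \<nu> \<and>
    (\<integral>\<^sup>+x. ennreal (min 1 (x\<^sup>2)) \<partial>\<nu>) < \<infinity>"

text \<open>The Gaussian part is \<open>\<sigma>\<^sup>2 u\<^sup>2\<close>, without the factor \<open>1/2\<close>.\<close>

definition levy_khintchine :: "real \<Rightarrow> real \<Rightarrow> real measure \<Rightarrow> real \<Rightarrow> real" where
  "levy_khintchine \<sigma> b \<nu> u = \<sigma>\<^sup>2 * u\<^sup>2 - b * u +
    (LINT x:{0<..}|\<nu>. exp (- u * x) - 1 + u * x * indicator {x. x < 1} x)"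

definition unbounded_variation :: "real \<Rightarrow> real measure \<Rightarrow> bool" where
  "unbounded_variation \<sigma> \<nu> \<longleftrightarrow>
    \<sigma> > 0 \<or> (\<integral>\<^sup>+x\<in>{0<..<1}. ennreal x \<partial>\<nu>) = \<infinity>"

definition WLSC :: "real \<Rightarrow> real \<Rightarrow> real \<Rightarrow> (real \<Rightarrow> real) set" where
  "WLSC \<alpha> c x\<^sub>1 = {f. (\<forall>x>0. 0 \<le> f x) \<and>
    (\<forall>u\<ge>1. \<forall>x>x\<^sub>1. f (u * x) \<ge> c * u powr \<alpha> * f x)}"

definition Phi :: "(real \<Rightarrow> real) \<Rightarrow> real \<Rightarrow> real" where
  "Phi \<phi> x = (if x > 0 then x\<^sup>2 * deriv (deriv \<phi>) x else 0)"

definition Phi_star :: "(real \<Rightarrow> real) \<Rightarrow> real \<Rightarrow> real" where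
  "Phi_star \<phi> r = (SUP s\<in>{0<..r}. Phi \<phi> s)"

definition Phi_inv :: "(real \<Rightarrow> real) \<Rightarrow> real \<Rightarrow> real" where
  "Phi_inv \<phi> s = Sup {r. r > 0 \<and> Phi_star \<phi> r = s}"

text \<open>Nonnegativity has to be required, because \<open>ennreal\<close> truncates negative values to \<open>0\<close>.\<close>

definition is_continuous_density ::
  "'a measure \<Rightarrow> ('a \<Rightarrow> real) \<Rightarrow> (real \<Rightarrow> real) \<Rightarrow> bool" where
  "is_continuous_density M Y f \<longleftrightarrow>
    continuous_on UNIV f \<and> (\<forall>x. 0 \<le> f x) \<and> distributed M lborel Y (\<lambda>x. ennreal (f x))"

end

theory Submission
  imports Defs "HOL-Complex_Analysis.Conformal_Mappings"
begin

text \<open>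
  Write \<open>\<phi>\<close> for the Laplace exponent, \<open>\<Phi>(w) = w\<^sup>2 \<phi>''(w)\<close>, and \<open>L(w) = w \<phi>'(w) - \<phi>(w)\<close>. The
  proof tilts the law of \<open>X\<^sub>t\<close> by \<open>exp (- w x)\<close>. The tilted law is infinitely divisible with Levy
  measure \<open>t exp (- w y) \<nu>(dy)\<close>, mean \<open>- t \<phi>'(w)\<close> and variance \<open>t \<phi>''(w)\<close>; measured in units of
  \<open>1 / w\<close> its variance is \<open>t \<Phi>(w)\<close>.

  \<^bold>\<open>At the mean.\<close> The scaling condition makes the second moment of \<open>\<nu>\<close> over \<open>(0, r)\<close> comparable to
  \<open>\<phi>''(1 / r)\<close>. Hence the characteristic function of the tilted law decays like a Gaussian up to
  frequency \<open>w\<close> and exponentially beyond it, while its third cumulant is at most a multiple of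
  the variance divided by \<open>w\<close>. Once \<open>t \<Phi>(w)\<close> exceeds a fixed level, comparing with the Gaussian of the
  same variance through Levy's inversion formula bounds the tilted density at its mean from below
  (\<open>saddle_point_lower_bound\<close>). Undoing the tilt at this point costs the factor \<open>exp (- t L(w))\<close>,
  which is bounded below because \<open>L(w) \<le> L(x\<^sub>0) + \<Phi>(w) / c\<close>.

  \<^bold>\<open>To the left of the mean.\<close> Take \<open>w = \<Phi>\<inverse>(M / t)\<close>. A point at distance at most \<open>B / w\<close> to the left of
  \<open>- t \<phi>'(w)\<close> is the mean \<open>- t \<phi>'(v)\<close> for another \<open>v \<ge> w\<close>. For \<open>\<alpha> \<ge> 1\<close> the scaling condition forces \<open>\<phi>'\<close>
  to grow at least logarithmically, so \<open>v / w\<close> is bounded in terms of \<open>B\<close> and the bound at the mean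
  applies to \<open>v\<close> (\<open>lower_bound_left\<close>).

  \<^bold>\<open>To the right of the mean.\<close> Here the parameter \<open>v\<close> would have to decrease and could leave the range
  where the local limit bound holds. Instead the time is halved. The density at time \<open>t / 2\<close> is
  already known to be large on an arbitrarily long interval to the left of its mean, so it suffices
  that the other half carries the process to the right by a bounded multiple of \<open>1 / w\<close> with
  probability bounded below. Split that half into \<open>n\<close> pieces, each of which has to move by
  \<open>A / (n w)\<close>. Under the tilted law a piece is centred, its variance is of order \<open>1 / n\<close> and thus exceeds
  \<open>(A / n)\<^sup>2\<close> for large \<open>n\<close> (in units of \<open>1 / w\<close>), and its third moment is nonnegative because all jumps
  are positive. These three facts force mass beyond \<open>A / n\<close> (\<open>upper_tail_lower_bound\<close>), and
  Chebyshev's inequality keeps that mass in a bounded window (\<open>centred_window\<close>).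

  \<^bold>\<open>Back to the inverse.\<close> The scaling condition finally makes \<open>\<Phi>\<inverse>(M / t)\<close> and \<open>\<Phi>\<inverse>(1 / t)\<close> comparable, uniformly in
  the admissible \<open>t\<close> (\<open>Phi_inv_comparable\<close>).
\<close>

section \<open>Differentiation under the integral sign\<close>

lemma has_field_derivative_integral_dominated:
  fixes f f' :: "complex \<Rightarrow> 'a \<Rightarrow> complex"
  assumes S: "open S" "convex S" "z\<^sub>0 \<in> S"
    and int: "\<And>z. z \<in> S \<Longrightarrow> integrable M (f z)"
    and meas: "f' z\<^sub>0 \<in> borel_measurable M"
    and der: "AE x in M. \<forall>z\<in>S. ((\<lambda>z. f z x) has_field_derivative f' z x) (at z) \<and> norm (f' z x) \<le> h x"
    and h: "integrable M h"
  shows "((\<lambda>z. \<integral>x. f z x \<partial>M) has_field_derivative (\<integral>x. f' z\<^sub>0 x \<partial>M)) (at z\<^sub>0)"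
proof -
  have "((\<lambda>y. ((\<integral>x. f y x \<partial>M) - (\<integral>x. f z\<^sub>0 x \<partial>M)) / (y - z\<^sub>0)) \<longlongrightarrow> (\<integral>x. f' z\<^sub>0 x \<partial>M)) (at z\<^sub>0 within S)"
    unfolding tendsto_at_iff_sequentially
  proof (intro allI impI)
    fix X :: "nat \<Rightarrow> complex"
    assume XS: "\<forall>i. X i \<in> S - {z\<^sub>0}" and X: "X \<longlonglongrightarrow> z\<^sub>0"
    let ?q = "\<lambda>i x. (f (X i) x - f z\<^sub>0 x) / (X i - z\<^sub>0)"
    have "(\<lambda>i. \<integral>x. ?q i x \<partial>M) \<longlonglongrightarrow> (\<integral>x. f' z\<^sub>0 x \<partial>M)"
    proof (rule integral_dominated_convergence[where w = h])
      show "?q i \<in> borel_measurable M" for i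
        using int[of "X i"] int[of z\<^sub>0] XS S by (intro borel_measurable_divide borel_measurable_diff) auto
      show "AE x in M. (\<lambda>i. ?q i x) \<longlonglongrightarrow> f' z\<^sub>0 x"
        using der
      proof eventually_elim
        case (elim x)
        then have "((\<lambda>z. f z x) has_field_derivative f' z\<^sub>0 x) (at z\<^sub>0)" using S by auto
        then have "((\<lambda>y. (f y x - f z\<^sub>0 x) / (y - z\<^sub>0)) \<longlongrightarrow> f' z\<^sub>0 x) (at z\<^sub>0)"
          by (simp add: has_field_derivative_iff)
        then show ?case using X XS unfolding tendsto_at_iff_sequentially by (auto simp: comp_def)
      qed
      show "AE x in M. norm (?q i x) \<le> h x" for i
        using der
      proof eventually_elim
        case (elim x)
        have "norm (f (X i) x - f z\<^sub>0 x) \<le> h x * norm (X i - z\<^sub>0)"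
        proof (rule field_differentiable_bound[OF S(2), where f' = "\<lambda>z. f' z x"])
          show "((\<lambda>z. f z x) has_field_derivative f' z x) (at z within S)" if "z \<in> S" for z
            using elim that by (auto intro: has_field_derivative_at_within)
        qed (use elim XS S in auto)
        then show ?case using XS by (simp add: norm_divide divide_le_eq)
      qed
    qed (use h meas in auto)
    moreover have "(\<integral>x. ?q i x \<partial>M) = ((\<integral>x. f (X i) x \<partial>M) - (\<integral>x. f z\<^sub>0 x \<partial>M)) / (X i - z\<^sub>0)"
      for i
    proof -
      have "X i \<in> S" using XS by auto
      then show ?thesis using int[of "X i"] int[of z\<^sub>0] S by simp
    qed
    ultimately show "((\<lambda>y. ((\<integral>x. f y x \<partial>M) - (\<integral>x. f z\<^sub>0 x \<partial>M)) / (y - z\<^sub>0)) \<circ> X) \<longlonglongrightarrow> (\<integral>x. f' z\<^sub>0 x \<partial>M)"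
      by (simp only: comp_def)
  qed
  then show "((\<lambda>z. \<integral>x. f z x \<partial>M) has_field_derivative (\<integral>x. f' z\<^sub>0 x \<partial>M)) (at z\<^sub>0)"
    unfolding has_field_derivative_iff at_within_open[OF S(3) S(1)] .
qed

lemma power_mult_exp_bound:
  fixes x \<epsilon> :: real
  assumes "0 \<le> x" "0 < \<epsilon>"
  shows "x ^ k * exp (- \<epsilon> * x) \<le> fact k / \<epsilon> ^ k"
proof -
  have "(\<epsilon> * x) ^ k /\<^sub>R fact k \<le> (\<Sum>n. (\<epsilon> * x) ^ n /\<^sub>R fact n)"
    using sum_le_suminf[OF summable_exp_generic[of "\<epsilon> * x"], of "{k}"] assms by simp
  then have "(\<epsilon> * x) ^ k / fact k \<le> exp (\<epsilon> * x)"
    by (simp add: exp_def divide_inverse mult.commute)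
  then have "\<epsilon> ^ k * x ^ k \<le> fact k * exp (\<epsilon> * x)"
    by (simp add: power_mult_distrib divide_le_eq mult.commute)
  then show ?thesis
    using assms by (simp add: exp_minus divide_simps mult.commute)
qed

lemma norm_one_minus_exp_le:
  fixes z :: complex
  assumes "0 \<le> Re z"
  shows "norm (1 - exp (- z)) \<le> norm z"
proof -
  have "norm ((1 - exp (- z)) - (1 - exp (- 0))) \<le> 1 * norm (z - 0)"
    by (rule field_differentiable_bound[of "{w. 0 \<le> Re w}" _ "\<lambda>w. exp (- w)"])
      (use assms in \<open>auto intro!: derivative_eq_intros convex_halfspace_Re_ge simp: norm_exp_eq_Re\<close>)
  then show ?thesis by simp
qed

lemma norm_exp_remainder_le:
  fixes z :: complex
  assumes "0 \<le> Re z"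
  shows "norm (exp (- z) - 1 + z) \<le> (norm z)\<^sup>2"
proof -
  have "norm ((exp (- z) - 1 + z) - (exp (- 0) - 1 + 0)) \<le> norm z * norm (z - 0)"
    by (rule field_differentiable_bound[of "{w. 0 \<le> Re w} \<inter> cball 0 (norm z)" _ "\<lambda>w. 1 - exp (- w)"])
      (use assms in \<open>auto intro!: derivative_eq_intros convex_Int convex_halfspace_Re_ge
         intro: order_trans[OF norm_one_minus_exp_le]\<close>)
  then show ?thesis by (simp add: power2_eq_square)
qed

lemma has_real_derivative_of_complex:
  fixes f :: "real \<Rightarrow> real"
  assumes "(F has_field_derivative of_real d) (at (of_real u))"
    and "open S" "u \<in> S" "\<And>v. v \<in> S \<Longrightarrow> F (of_real v) = complex_of_real (f v)"
  shows "(f has_real_derivative d) (at u)"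
proof -
  have "((\<lambda>x. F (of_real x)) has_vector_derivative complex_of_real d) (at u)"
    by (rule has_vector_derivative_real_field) (use assms in simp)
  then have "((\<lambda>x. complex_of_real (f x)) has_vector_derivative complex_of_real d) (at u)"
    by (rule has_vector_derivative_transform_within_open[OF _ assms(2,3)]) (use assms in auto)
  then have "((\<lambda>x. Re (complex_of_real (f x))) has_vector_derivative Re (complex_of_real d)) (at u)"
    by (rule bounded_linear.has_vector_derivative[OF bounded_linear_Re])
  then show ?thesis by (simp add: has_real_derivative_iff_has_vector_derivative)
qed

text \<open>The integrand and all its derivatives are dominated near \<open>z\<close> because \<open>\<bar>x\<bar> ^ k\<close> is absorbed by
  an arbitrarily small change of the exponent, on either side of \<open>0\<close>.\<close>

lemma laplace_transform_derivative:
  fixes \<mu> :: "real measure"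
  assumes sets: "sets \<mu> = sets borel"
    and int: "\<And>u. 0 < u \<Longrightarrow> integrable \<mu> (\<lambda>x. exp (- u * x))"
    and z: "0 < Re z"
  shows "integrable \<mu> (\<lambda>x. (- of_real x) ^ k * exp (- z * of_real x) :: complex)" (is ?I)
    and "((\<lambda>z. \<integral>x. (- of_real x) ^ k * exp (- z * of_real x) \<partial>\<mu>) has_field_derivative
      (\<integral>x. (- of_real x) ^ Suc k * exp (- z * of_real x) \<partial>\<mu> :: complex)) (at z)"
proof -
  note [measurable_cong] = sets
  have dom: "\<exists>h. integrable \<mu> h \<and> (\<forall>w\<in>{w. Re z / 2 < Re w} \<inter> {w. Re w < 2 * Re z}. \<forall>x.
      norm ((- of_real x) ^ k * exp (- w * of_real x) :: complex) \<le> h x)" for k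
  proof -
    \<comment> \<open>\<open>Re w\<close> stays between \<open>2 * \<delta>\<close> and \<open>8 * \<delta>\<close>; a further \<open>\<delta>\<close> on each side pays for the power of \<open>x\<close>.\<close>
    define \<delta> where "\<delta> = Re z / 4"
    have \<delta>: "0 < \<delta>" using z by (simp add: \<delta>_def)
    define h where "h x = fact k / \<delta> ^ k * (exp (- (2 * \<delta> - \<delta>) * x) + exp (- (2 * \<delta> + \<delta>) * x)
       + exp (- (8 * \<delta> - \<delta>) * x) + exp (- (8 * \<delta> + \<delta>) * x))" for x
    have "integrable \<mu> h"
      unfolding h_def using \<delta>
      by (intro integrable_mult_right Bochner_Integration.integrable_add int) auto
    moreover have "norm ((- of_real x) ^ k * exp (- w * of_real x) :: complex) \<le> h x"
      if w: "Re z / 2 < Re w" "Re w < 2 * Re z" for w x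
    proof -
      have "exp (- Re w * x) \<le> exp (- (2 * \<delta>) * x) + exp (- (8 * \<delta>) * x)"
      proof (cases "0 \<le> x")
        case True
        then have "(2 * \<delta>) * x \<le> Re w * x" using w
          by (intro mult_right_mono) (auto simp: \<delta>_def)
        then have "exp (- Re w * x) \<le> exp (- (2 * \<delta>) * x)" by simp
        then show ?thesis by (smt (verit) exp_gt_zero)
      next
        case False
        then have "(8 * \<delta>) * x \<le> Re w * x" using w
          by (intro mult_right_mono_neg) (auto simp: \<delta>_def)
        then have "exp (- Re w * x) \<le> exp (- (8 * \<delta>) * x)" by simp
        then show ?thesis by (smt (verit) exp_gt_zero)
      qed
      moreover have "\<bar>x\<bar> ^ k \<le> fact k / \<delta> ^ k * (exp (\<delta> * x) + exp (- \<delta> * x))"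
      proof -
        have "\<bar>x\<bar> ^ k \<le> fact k / \<delta> ^ k * exp (\<delta> * \<bar>x\<bar>)"
          using power_mult_exp_bound[of "\<bar>x\<bar>" \<delta> k] \<delta> by (simp add: exp_minus divide_simps mult.commute)
        also have "\<dots> \<le> fact k / \<delta> ^ k * (exp (\<delta> * x) + exp (- \<delta> * x))"
          using \<delta> by (intro mult_left_mono) (auto simp: abs_if)
        finally show ?thesis .
      qed
      ultimately have "\<bar>x\<bar> ^ k * exp (- Re w * x) \<le> (fact k / \<delta> ^ k * (exp (\<delta> * x) + exp (- \<delta> * x)))
         * (exp (- (2 * \<delta>) * x) + exp (- (8 * \<delta>) * x))"
        using \<delta> by (intro mult_mono) auto
      also have "\<dots> = fact k / \<delta> ^ k * ((exp (\<delta> * x) + exp (- \<delta> * x))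
         * (exp (- (2 * \<delta>) * x) + exp (- (8 * \<delta>) * x)))" by (simp only: mult.assoc)
      also have "\<dots> = h x"
      proof -
        have e: "exp (\<delta> * x) * exp (- (2 * \<delta>) * x) = exp (- (2 * \<delta> - \<delta>) * x)"
          "exp (- \<delta> * x) * exp (- (2 * \<delta>) * x) = exp (- (2 * \<delta> + \<delta>) * x)"
          "exp (\<delta> * x) * exp (- (8 * \<delta>) * x) = exp (- (8 * \<delta> - \<delta>) * x)"
          "exp (- \<delta> * x) * exp (- (8 * \<delta>) * x) = exp (- (8 * \<delta> + \<delta>) * x)"
          unfolding exp_add[symmetric] by (rule arg_cong[of _ _ exp], simp add: algebra_simps)+
        show ?thesis unfolding h_def e[symmetric] by (simp only: ring_distribs add_ac)
      qed
      finally show ?thesis by (simp add: norm_mult norm_power norm_exp_eq_Re)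
    qed
    ultimately show ?thesis by (intro exI[of _ h]) auto
  qed
  let ?S = "{w. Re z / 2 < Re w} \<inter> {w. Re w < 2 * Re z}"
  have I: "integrable \<mu> (\<lambda>x. (- of_real x) ^ k * exp (- w * of_real x) :: complex)" if "w \<in> ?S" for w k
  proof -
    obtain h where h: "integrable \<mu> h" "\<And>x. norm ((- of_real x) ^ k * exp (- w * of_real x) :: complex) \<le> h x"
      using dom[of k] \<open>w \<in> ?S\<close> by blast
    have le: "norm ((- of_real x) ^ k * exp (- w * of_real x) :: complex) \<le> norm (h x)" for x
      unfolding real_norm_def by (rule order_trans[OF h(2) abs_ge_self])
    show ?thesis
      by (rule Bochner_Integration.integrable_bound[OF h(1) _ AE_I2[OF le]]) measurable
  qed
  have zS: "z \<in> ?S" using z by auto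
  show ?I by (rule I[OF zS])
  obtain h where h: "integrable \<mu> h"
      "\<And>w x. w \<in> ?S \<Longrightarrow> norm ((- of_real x) ^ Suc k * exp (- w * of_real x) :: complex) \<le> h x"
    using dom[of "Suc k"] by blast
  show "((\<lambda>z. \<integral>x. (- of_real x) ^ k * exp (- z * of_real x) \<partial>\<mu>) has_field_derivative
      (\<integral>x. (- of_real x) ^ Suc k * exp (- z * of_real x) \<partial>\<mu> :: complex)) (at z)"
  proof (rule has_field_derivative_integral_dominated[where S = ?S and h = h
        and f = "\<lambda>w x. (- of_real x) ^ k * exp (- w * of_real x)"
        and f' = "\<lambda>w x. (- of_real x) ^ Suc k * exp (- w * of_real x)"])
    show "open ?S" by (intro open_Int open_halfspace_Re_gt open_halfspace_Re_lt)
    show "convex ?S" by (intro convex_Int convex_halfspace_Re_gt convex_halfspace_Re_lt)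
    show "AE x in \<mu>. \<forall>w\<in>?S. ((\<lambda>w. (- of_real x) ^ k * exp (- w * of_real x)) has_field_derivative
       ((- of_real x) ^ Suc k * exp (- w * of_real x) :: complex)) (at w) \<and>
       norm ((- of_real x) ^ Suc k * exp (- w * of_real x) :: complex) \<le> h x"
    proof (intro AE_I2 ballI conjI)
      fix x w assume "w \<in> ?S"
      show "((\<lambda>w. (- of_real x) ^ k * exp (- w * of_real x)) has_field_derivative
       ((- of_real x) ^ Suc k * exp (- w * of_real x) :: complex)) (at w)"
        by (auto intro!: derivative_eq_intros)
      show "norm ((- of_real x) ^ Suc k * exp (- w * of_real x) :: complex) \<le> h x"
        by (rule h(2)[OF \<open>w \<in> ?S\<close>])
    qed
    show "integrable \<mu> (\<lambda>x. (- of_real x) ^ k * exp (- w * of_real x) :: complex)" if "w \<in> ?S" for w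
      by (rule I[OF that])
    show "(\<lambda>x. (- of_real x) ^ Suc k * exp (- z * of_real x) :: complex) \<in> borel_measurable \<mu>"
      by measurable
    show "z \<in> ?S" by (rule zS)
    show "integrable \<mu> h" by (rule h(1))
  qed
qed

lemma min_one_square:
  fixes y :: real
  shows "0 < y \<Longrightarrow> y < 1 \<Longrightarrow> min 1 (y\<^sup>2) = y\<^sup>2" "1 \<le> y \<Longrightarrow> min 1 (y\<^sup>2) = 1"
  by (simp_all add: min.absorb2 min.absorb1 power_le_one one_le_power)

section \<open>The Laplace exponent on the right half-plane\<close>

text \<open>The integrand of the Levy--Khintchine formula and its first three derivatives in \<open>z\<close>.\<close>

definition kern0 :: "complex \<Rightarrow> real \<Rightarrow> complex" where
  "kern0 z y = exp (- z * of_real y) - 1 + z * of_real y * indicator {y. y < 1} y"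

definition kern1 :: "complex \<Rightarrow> real \<Rightarrow> complex" where
  "kern1 z y = of_real y * indicator {y. y < 1} y - of_real y * exp (- z * of_real y)"

definition kern2 :: "complex \<Rightarrow> real \<Rightarrow> complex" where
  "kern2 z y = (of_real y)\<^sup>2 * exp (- z * of_real y)"

definition kern3 :: "complex \<Rightarrow> real \<Rightarrow> complex" where
  "kern3 z y = - ((of_real y) ^ 3 * exp (- z * of_real y))"

lemma kern_measurable [measurable]:
  "kern0 z \<in> borel_measurable borel" "kern1 z \<in> borel_measurable borel"
  "kern2 z \<in> borel_measurable borel" "kern3 z \<in> borel_measurable borel"
  unfolding kern0_def kern1_def kern2_def kern3_def by measurable

lemma kern_derivs:
  "((\<lambda>z. kern0 z y) has_field_derivative kern1 z y) (at z)"
  "((\<lambda>z. kern1 z y) has_field_derivative kern2 z y) (at z)"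
  "((\<lambda>z. kern2 z y) has_field_derivative kern3 z y) (at z)"
  unfolding kern0_def kern1_def kern2_def kern3_def
  by (auto intro!: derivative_eq_intros simp: power2_eq_square power3_eq_cube algebra_simps)

lemma kern0_bound:
  assumes "0 < y" "0 \<le> Re z"
  shows "norm (kern0 z y) \<le> ((norm z)\<^sup>2 + 2) * min 1 (y\<^sup>2)"
proof (cases "y < 1")
  case True
  have "norm (kern0 z y) \<le> (norm (z * of_real y))\<^sup>2"
    using norm_exp_remainder_le[of "z * of_real y"] assms True by (simp add: kern0_def)
  also have "\<dots> \<le> ((norm z)\<^sup>2 + 2) * min 1 (y\<^sup>2)"
    using assms True by (simp add: norm_mult power_mult_distrib min_one_square mult_right_mono)
  finally show ?thesis .
next
  case False
  have "norm (kern0 z y) \<le> norm (exp (- z * of_real y)) + 1"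
    using False norm_triangle_ineq4[of "exp (- z * of_real y)" 1] by (simp add: kern0_def)
  also have "\<dots> \<le> 2" using assms by (simp add: norm_exp_eq_Re)
  also have "\<dots> \<le> ((norm z)\<^sup>2 + 2) * min 1 (y\<^sup>2)" using False by (simp add: min_one_square)
  finally show ?thesis .
qed

lemma power_exp_min_bound:
  fixes y u :: real
  assumes "0 < y" "\<epsilon> \<le> u" "0 < \<epsilon>" "2 \<le> k"
  shows "y ^ k * exp (- u * y) \<le> (1 + fact k / \<epsilon> ^ k) * min 1 (y\<^sup>2)"
proof -
  have e: "exp (- u * y) \<le> exp (- \<epsilon> * y)" using assms by simp
  show ?thesis
  proof (cases "y < 1")
    case True
    have "y ^ k * exp (- u * y) \<le> y\<^sup>2 * 1"
      using assms True by (intro mult_mono power_decreasing) auto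
    also have "\<dots> \<le> (1 + fact k / \<epsilon> ^ k) * y\<^sup>2"
      using assms by (simp add: algebra_simps)
    finally show ?thesis using True assms by (simp add: min_one_square)
  next
    case False
    have "y ^ k * exp (- u * y) \<le> y ^ k * exp (- \<epsilon> * y)"
      using e assms by (intro mult_left_mono) auto
    also have "\<dots> \<le> fact k / \<epsilon> ^ k" using assms power_mult_exp_bound[of y \<epsilon> k] by simp
    finally show ?thesis using False by (simp add: min_one_square)
  qed
qed

lemma kern1_bound:
  assumes "0 < y" "\<epsilon> \<le> Re z" "0 < \<epsilon>"
  shows "norm (kern1 z y) \<le> (norm z + 1 / \<epsilon>) * min 1 (y\<^sup>2)"
proof (cases "y < 1")
  case True
  have "norm (kern1 z y) = y * norm (1 - exp (- (z * of_real y)))"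
    using True assms by (simp add: kern1_def norm_mult flip: right_diff_distrib' norm_of_real)
      (metis norm_mult mult.right_neutral right_diff_distrib' norm_of_real abs_of_pos assms(1))
  also have "\<dots> \<le> y * norm (z * of_real y)"
    using assms by (intro mult_left_mono norm_one_minus_exp_le) auto
  also have "\<dots> \<le> (norm z + 1 / \<epsilon>) * min 1 (y\<^sup>2)"
    using assms True by (simp add: norm_mult power2_eq_square min_one_square[unfolded power2_eq_square] algebra_simps)
  finally show ?thesis .
next
  case False
  have "norm (kern1 z y) = y * exp (- Re z * y)"
    using False assms by (simp add: kern1_def norm_mult norm_exp_eq_Re)
  also have "\<dots> \<le> y ^ 1 * exp (- \<epsilon> * y)" using assms by simp
  also have "\<dots> \<le> 1 / \<epsilon>" using power_mult_exp_bound[of y \<epsilon> 1] assms by simp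
  also have "\<dots> \<le> norm z + 1 / \<epsilon>" by simp
  finally show ?thesis using False by (simp add: min_one_square)
qed

lemma exp_of_real_mult: "exp (- (complex_of_real u * of_real y)) = of_real (exp (- (u * y)))"
  by (simp flip: exp_of_real)

locale levy_exponent =
  fixes \<nu> :: "real measure" and drift :: real
  assumes levy: "levy_measure \<nu>"
begin

lemma sets_nu [measurable_cong, simp]: "sets \<nu> = sets borel"
  using levy by (simp add: levy_measure_def)

lemma AE_pos: "AE y in \<nu>. 0 < y"
proof (rule AE_I)
  show "{y \<in> space \<nu>. \<not> 0 < y} \<subseteq> {..0}" by auto
qed (use levy in \<open>auto simp: levy_measure_def\<close>)

lemma integrable_min: "integrable \<nu> (\<lambda>y. min 1 (y\<^sup>2))"
  using levy by (intro integrableI_nonneg) (auto simp: levy_measure_def)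

lemma integrable_kernI:
  fixes f :: "real \<Rightarrow> 'b::{banach, second_countable_topology}"
  assumes "f \<in> borel_measurable borel" "\<And>y. 0 < y \<Longrightarrow> norm (f y) \<le> C * min 1 (y\<^sup>2)"
  shows "integrable \<nu> f"
  by (rule Bochner_Integration.integrable_bound[OF integrable_mult_right[OF integrable_min, of C]])
    (use assms AE_pos in \<open>auto elim!: eventually_mono intro!: order_trans[OF assms(2) abs_ge_self]\<close>)

lemma deriv_kern_integral:
  fixes f f' :: "complex \<Rightarrow> real \<Rightarrow> complex"
  assumes z: "0 < Re z"
    and meas: "\<And>z. f z \<in> borel_measurable borel" "\<And>z. f' z \<in> borel_measurable borel"
    and der: "\<And>z y. ((\<lambda>z. f z y) has_field_derivative f' z y) (at z)"
    and bd: "\<And>y w. 0 < y \<Longrightarrow> Re z / 2 \<le> Re w \<Longrightarrow> norm w \<le> norm z + 1 \<Longrightarrow>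
      norm (f w y) \<le> C * min 1 (y\<^sup>2) \<and> norm (f' w y) \<le> C * min 1 (y\<^sup>2)"
  shows "((\<lambda>z. \<integral>y. f z y \<partial>\<nu>) has_field_derivative (\<integral>y. f' z y \<partial>\<nu>)) (at z)"
proof (rule has_field_derivative_integral_dominated[where h = "\<lambda>y. C * min 1 (y\<^sup>2)"
      and S = "{w. Re z / 2 < Re w} \<inter> ball 0 (norm z + 1)" and f = f and f' = f'])
  show "open ({w. Re z / 2 < Re w} \<inter> ball 0 (norm z + 1))"
    by (intro open_Int open_halfspace_Re_gt open_ball)
  show "convex ({w. Re z / 2 < Re w} \<inter> ball 0 (norm z + 1))"
    by (intro convex_Int convex_halfspace_Re_gt convex_ball)
  show "integrable \<nu> (f w)" if "w \<in> {w. Re z / 2 < Re w} \<inter> ball 0 (norm z + 1)" for w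
    by (rule integrable_kernI[where C = C]) (use that bd meas in auto)
  show "AE y in \<nu>. \<forall>w\<in>{w. Re z / 2 < Re w} \<inter> ball 0 (norm z + 1).
      ((\<lambda>z. f z y) has_field_derivative f' w y) (at w) \<and> norm (f' w y) \<le> C * min 1 (y\<^sup>2)"
    using AE_pos by eventually_elim (use der bd in auto)
  show "f' z \<in> borel_measurable \<nu>" using meas(2)[of z] by measurable
qed (use z integrable_min in auto)

text \<open>The exponent and its derivatives are needed at complex arguments: the tilted characteristic
  function is the Laplace transform on a vertical line.\<close>

definition phiC :: "complex \<Rightarrow> complex" where
  "phiC z = - of_real drift * z + (\<integral>y. kern0 z y \<partial>\<nu>)"

definition phi1C :: "complex \<Rightarrow> complex" where
  "phi1C z = - of_real drift + (\<integral>y. kern1 z y \<partial>\<nu>)"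

definition phi2C :: "complex \<Rightarrow> complex" where
  "phi2C z = (\<integral>y. kern2 z y \<partial>\<nu>)"

definition phi3C :: "complex \<Rightarrow> complex" where
  "phi3C z = (\<integral>y. kern3 z y \<partial>\<nu>)"

lemma norm_kern23:
  assumes "0 < y"
  shows "norm (kern2 z y) = y ^ 2 * exp (- Re z * y)" "norm (kern3 z y) = y ^ 3 * exp (- Re z * y)"
  using assms by (simp_all add: kern2_def kern3_def norm_mult norm_power norm_exp_eq_Re)

lemma phiC_derivs:
  assumes z: "0 < Re z"
  shows "(phiC has_field_derivative phi1C z) (at z)"
    and "(phi1C has_field_derivative phi2C z) (at z)"
    and "(phi2C has_field_derivative phi3C z) (at z)"
proof -
  define \<epsilon> where "\<epsilon> = Re z / 2"
  define N where "N = norm z + 1"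
  have \<epsilon>: "0 < \<epsilon>" and N: "0 < N" using z by (auto simp: \<epsilon>_def N_def add_nonneg_pos)
  define C where "C = N\<^sup>2 + 2 + N + 1 / \<epsilon> + (1 + fact 2 / \<epsilon> ^ 2) + (1 + fact 3 / \<epsilon> ^ 3)"
  have bds: "norm (kern0 w y) \<le> C * min 1 (y\<^sup>2)" "norm (kern1 w y) \<le> C * min 1 (y\<^sup>2)"
      "norm (kern2 w y) \<le> C * min 1 (y\<^sup>2)" "norm (kern3 w y) \<le> C * min 1 (y\<^sup>2)"
    if w: "0 < y" "Re z / 2 \<le> Re w" "norm w \<le> norm z + 1" for w y
  proof -
    have mono: "X \<le> C * min 1 (y\<^sup>2)" if "X \<le> c * min 1 (y\<^sup>2)" "c \<le> C" for X c :: real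
      using that by (meson mult_right_mono order_trans min.boundedI zero_le_one zero_le_power2)
    have n2: "(norm w)\<^sup>2 \<le> N\<^sup>2" using w by (intro power_mono) (auto simp: N_def)
    have pos: "0 \<le> 1 / \<epsilon>" "0 \<le> fact 2 / \<epsilon> ^ 2" "0 \<le> fact 3 / \<epsilon> ^ 3" using \<epsilon> by auto
    have "0 \<le> N\<^sup>2" by simp
    then have C: "N\<^sup>2 + 2 \<le> C" "N + 1 / \<epsilon> \<le> C" "1 + fact 2 / \<epsilon> ^ 2 \<le> C" "1 + fact 3 / \<epsilon> ^ 3 \<le> C"
      unfolding C_def using pos N by linarith+
    have w': "0 \<le> Re w" "\<epsilon> \<le> Re w" "norm w \<le> N" using w z by (auto simp: \<epsilon>_def N_def)
    show "norm (kern0 w y) \<le> C * min 1 (y\<^sup>2)"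
      by (rule mono[OF kern0_bound]) (use w' w(1) n2 C in linarith)+
    show "norm (kern1 w y) \<le> C * min 1 (y\<^sup>2)"
      by (rule mono[OF kern1_bound[of _ \<epsilon>]]) (use w' w(1) C \<epsilon> in linarith)+
    show "norm (kern2 w y) \<le> C * min 1 (y\<^sup>2)" unfolding norm_kern23[OF w(1)]
      by (rule mono[OF power_exp_min_bound[of _ \<epsilon>]]) (use w' w(1) C \<epsilon> in auto)
    show "norm (kern3 w y) \<le> C * min 1 (y\<^sup>2)" unfolding norm_kern23[OF w(1)]
      by (rule mono[OF power_exp_min_bound[of _ \<epsilon>]]) (use w' w(1) C \<epsilon> in auto)
  qed
  have "((\<lambda>z. \<integral>y. kern0 z y \<partial>\<nu>) has_field_derivative (\<integral>y. kern1 z y \<partial>\<nu>)) (at z)"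
    by (rule deriv_kern_integral[where C = C]) (use z bds kern_derivs in auto)
  then show "(phiC has_field_derivative phi1C z) (at z)"
    unfolding phiC_def [abs_def] phi1C_def by (auto intro!: derivative_eq_intros)
  have "((\<lambda>z. \<integral>y. kern1 z y \<partial>\<nu>) has_field_derivative (\<integral>y. kern2 z y \<partial>\<nu>)) (at z)"
    by (rule deriv_kern_integral[where C = C]) (use z bds kern_derivs in auto)
  then show "(phi1C has_field_derivative phi2C z) (at z)"
    unfolding phi1C_def [abs_def] phi2C_def by (auto intro!: derivative_eq_intros)
  show "(phi2C has_field_derivative phi3C z) (at z)"
    unfolding phi2C_def [abs_def] phi3C_def
    by (rule deriv_kern_integral[where C = C]) (use z bds kern_derivs in auto)
qed

lemma integrable_kern0: "0 \<le> Re z \<Longrightarrow> integrable \<nu> (kern0 z)"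
  by (rule integrable_kernI[OF _ kern0_bound]) auto

lemma integrable_kern1: "0 < Re z \<Longrightarrow> integrable \<nu> (kern1 z)"
  by (rule integrable_kernI[OF _ kern1_bound[of _ "Re z"]]) auto

lemma integrable_power_exp:
  assumes "0 < u" "2 \<le> k"
  shows "integrable \<nu> (\<lambda>y. y ^ k * exp (- u * y))"
  by (rule integrable_kernI[where C = "1 + fact k / u ^ k"])
    (use power_exp_min_bound[of _ u u k] assms in auto)

definition phi :: "real \<Rightarrow> real" where "phi u = levy_khintchine 0 drift \<nu> u"
definition phi1 :: "real \<Rightarrow> real" where
  "phi1 u = - drift + (\<integral>y. y * indicator {y. y < 1} y - y * exp (- u * y) \<partial>\<nu>)"
definition phi2 :: "real \<Rightarrow> real" where "phi2 u = (\<integral>y. y\<^sup>2 * exp (- u * y) \<partial>\<nu>)"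
definition phi3 :: "real \<Rightarrow> real" where "phi3 u = (\<integral>y. y ^ 3 * exp (- u * y) \<partial>\<nu>)"

lemma phiC_of_real:
  shows "phiC (of_real u) = of_real (phi u)"
    and "phi1C (of_real u) = of_real (phi1 u)"
    and "phi2C (of_real u) = of_real (phi2 u)"
    and "phi3C (of_real u) = of_real (- phi3 u)"
proof -
  let ?k = "\<lambda>y. exp (- u * y) - 1 + u * y * indicator {y. y < 1} y"
  have "(LINT y:{0<..}|\<nu>. ?k y) = (\<integral>y. ?k y \<partial>\<nu>)"
    unfolding set_lebesgue_integral_def
    by (rule integral_cong_AE) (use AE_pos in \<open>auto elim!: eventually_mono\<close>)
  moreover have "(\<integral>y. kern0 (of_real u) y \<partial>\<nu>) = of_real (\<integral>y. ?k y \<partial>\<nu>)"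
    unfolding integral_complex_of_real[symmetric]
    by (rule Bochner_Integration.integral_cong) (auto simp: kern0_def exp_of_real_mult indicator_def)
  ultimately show "phiC (of_real u) = of_real (phi u)"
    by (simp add: phiC_def phi_def levy_khintchine_def)
  show "phi1C (of_real u) = of_real (phi1 u)"
    unfolding phi1C_def phi1_def of_real_add integral_complex_of_real[symmetric]
    by (auto intro!: Bochner_Integration.integral_cong simp: kern1_def exp_of_real_mult indicator_def)
  show "phi2C (of_real u) = of_real (phi2 u)"
    unfolding phi2C_def phi2_def integral_complex_of_real[symmetric]
    by (auto intro!: Bochner_Integration.integral_cong simp: kern2_def exp_of_real_mult)
  show "phi3C (of_real u) = of_real (- phi3 u)"
    unfolding phi3C_def phi3_def of_real_minus integral_complex_of_real[symmetric]
    by (subst Bochner_Integration.integral_minus[symmetric], rule Bochner_Integration.integral_cong)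
      (auto simp: kern3_def exp_of_real_mult)
qed

lemma phi_derivs:
  assumes "0 < u"
  shows "(phi has_real_derivative phi1 u) (at u)"
    and "(phi1 has_real_derivative phi2 u) (at u)"
    and "(phi2 has_real_derivative - phi3 u) (at u)"
proof -
  note d = phiC_derivs[of "of_real u", unfolded phiC_of_real]
  show "(phi has_real_derivative phi1 u) (at u)"
    by (rule has_real_derivative_of_complex[OF d(1) open_UNIV UNIV_I]) (use assms phiC_of_real in simp_all)
  show "(phi1 has_real_derivative phi2 u) (at u)"
    by (rule has_real_derivative_of_complex[OF d(2) open_UNIV UNIV_I]) (use assms phiC_of_real in simp_all)
  show "(phi2 has_real_derivative - phi3 u) (at u)"
    by (rule has_real_derivative_of_complex[OF d(3) open_UNIV UNIV_I]) (use assms phiC_of_real in simp_all)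
qed

lemma phi_zero: "phi 0 = 0"
  by (simp add: phi_def levy_khintchine_def set_lebesgue_integral_def)

lemma phi2_nonneg: "0 \<le> phi2 u" and phi3_nonneg: "0 \<le> phi3 u"
  unfolding phi2_def phi3_def
  by (rule integral_nonneg_AE, rule eventually_mono[OF AE_pos], simp)+

lemma phi2_antimono:
  assumes "0 < u" "u \<le> v"
  shows "phi2 v \<le> phi2 u"
  unfolding phi2_def
proof (rule integral_mono_AE)
  show "AE y in \<nu>. y\<^sup>2 * exp (- v * y) \<le> y\<^sup>2 * exp (- u * y)"
    using AE_pos by eventually_elim (use assms in \<open>simp add: mult_left_mono\<close>)
qed (use assms integrable_power_exp[of _ 2] in auto)

text \<open>This is the characteristic exponent, per unit of time, of the law tilted by \<open>exp (- w x)\<close> and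
  centred at its mean.\<close>

definition kappa :: "real \<Rightarrow> real \<Rightarrow> complex" where
  "kappa w \<xi> = (\<integral>y. (iexp (\<xi> * y) - 1 - \<i> * of_real (\<xi> * y)) * of_real (exp (- w * y)) \<partial>\<nu>)"

lemma kappa_eq:
  assumes "0 < w"
  shows "kappa w \<xi> = phiC (of_real w - \<i> * of_real \<xi>) - of_real (phi w) + \<i> * of_real (\<xi> * phi1 w)"
    and "integrable \<nu> (\<lambda>y. (iexp (\<xi> * y) - 1 - \<i> * of_real (\<xi> * y)) * of_real (exp (- w * y)))"
proof -
  have eq: "(iexp (\<xi> * y) - 1 - \<i> * of_real (\<xi> * y)) * of_real (exp (- w * y)) =
     kern0 (of_real w - \<i> * of_real \<xi>) y - kern0 (of_real w) y + \<i> * of_real \<xi> * kern1 (of_real w) y" for y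
    by (simp add: kern0_def kern1_def exp_of_real[symmetric] algebra_simps flip: exp_add)
  have I: "integrable \<nu> (kern0 (of_real w - \<i> * of_real \<xi>))" "integrable \<nu> (kern0 (of_real w))"
    "integrable \<nu> (\<lambda>y. \<i> * of_real \<xi> * kern1 (of_real w) y)"
    using assms by (auto intro!: integrable_kern0 integrable_kern1 integrable_mult_right)
  show "integrable \<nu> (\<lambda>y. (iexp (\<xi> * y) - 1 - \<i> * of_real (\<xi> * y)) * of_real (exp (- w * y)))"
    unfolding eq using I by auto
  have "kappa w \<xi> = (\<integral>y. kern0 (of_real w - \<i> * of_real \<xi>) y \<partial>\<nu>) - (\<integral>y. kern0 (of_real w) y \<partial>\<nu>)
      + \<i> * of_real \<xi> * (\<integral>y. kern1 (of_real w) y \<partial>\<nu>)"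
    unfolding kappa_def eq using I by simp
  also have "\<dots> = phiC (of_real w - \<i> * of_real \<xi>) - phiC (of_real w) + \<i> * of_real \<xi> * phi1C (of_real w)"
    by (simp add: phiC_def phi1C_def algebra_simps)
  finally show "kappa w \<xi> = phiC (of_real w - \<i> * of_real \<xi>) - of_real (phi w) + \<i> * of_real (\<xi> * phi1 w)"
    by (simp add: phiC_of_real)
qed

end

section \<open>Bounds for the exponent\<close>

lemma cos_quadratic_bound:
  fixes u :: real
  assumes "\<bar>u\<bar> \<le> 1"
  shows "u\<^sup>2 / 4 \<le> 1 - cos u"
proof -
  have "\<bar>Re (iexp u - (\<Sum>k\<le>2. (\<i> * u) ^ k / fact k))\<bar> \<le> \<bar>u\<bar> ^ Suc 2 / fact (Suc 2)"
    by (rule order_trans[OF abs_Re_le_cmod iexp_approx1])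
  moreover have "Re (iexp u - (\<Sum>k\<le>2. (\<i> * u) ^ k / fact k)) = cos u - (1 - u\<^sup>2 / 2)"
    by (simp add: numeral_2_eq_2 Re_exp power_mult_distrib cos_of_real[symmetric])
  moreover have "\<bar>u\<bar> ^ Suc 2 / fact (Suc 2) \<le> u\<^sup>2 / 6"
    using assms mult_right_mono[of "\<bar>u\<bar>" 1 "u\<^sup>2"] by (simp add: numeral_2_eq_2 power2_eq_square fact_reduce)
  ultimately show ?thesis using zero_le_power2[of u] by linarith
qed

lemma iexp_cubic_remainder:
  "norm (iexp u - 1 - \<i> * of_real u + of_real (u\<^sup>2) / 2) \<le> \<bar>u\<bar> ^ 3 / 6"
proof -
  have "norm (iexp u - (\<Sum>k\<le>2. (\<i> * u) ^ k / fact k)) \<le> \<bar>u\<bar> ^ Suc 2 / fact (Suc 2)"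
    by (rule iexp_approx1)
  moreover have "iexp u - (\<Sum>k\<le>2. (\<i> * u) ^ k / fact k) = iexp u - 1 - \<i> * of_real u + of_real (u\<^sup>2) / 2"
    by (simp add: numeral_2_eq_2 power_mult_distrib algebra_simps)
  moreover have "\<bar>u\<bar> ^ Suc 2 / fact (Suc 2) = \<bar>u\<bar> ^ 3 / 6" by (simp add: eval_nat_numeral fact_reduce)
  ultimately show ?thesis by (simp only:)
qed

lemma real_exp_remainder:
  fixes u :: real
  assumes "0 \<le> u"
  shows "0 \<le> 1 - exp (- u) - u * exp (- u)" "1 - exp (- u) - u * exp (- u) \<le> u\<^sup>2"
    "1 - exp (- u) - u * exp (- u) \<le> 1"
proof -
  have "(1 + u) * exp (- u) \<le> exp u * exp (- u)" by (intro mult_right_mono) auto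
  then show "0 \<le> 1 - exp (- u) - u * exp (- u)" by (simp add: algebra_simps flip: exp_add)
  have "(1 + u) * (1 - u) \<le> (1 + u) * exp (- u)"
    using assms exp_ge_add_one_self[of "- u"] by (intro mult_left_mono) auto
  then show "1 - exp (- u) - u * exp (- u) \<le> u\<^sup>2" by (simp add: algebra_simps power2_eq_square)
  have "0 \<le> exp (- u)" "0 \<le> u * exp (- u)" using assms by auto
  then show "1 - exp (- u) - u * exp (- u) \<le> 1" by linarith
qed

context levy_exponent begin

text \<open>The Legendre transform of the exponent at the slope \<open>phi1 u\<close>. It is the price, per unit of time,
  of undoing the tilt at the mean of the tilted law.\<close>

definition legendre :: "real \<Rightarrow> real" where "legendre u = u * phi1 u - phi u"

lemma legendre_zero: "legendre 0 = 0"
  by (simp add: legendre_def phi_zero)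

lemma legendre_deriv: "0 < u \<Longrightarrow> (legendre has_real_derivative u * phi2 u) (at u)"
  unfolding legendre_def [abs_def] by (auto intro!: derivative_eq_intros phi_derivs)

lemma legendre_integral:
  assumes "0 < u"
  shows "legendre u = (\<integral>y. 1 - exp (- (u * y)) - u * y * exp (- (u * y)) \<partial>\<nu>)"
proof -
  have "complex_of_real (legendre u) = of_real u * phi1C (of_real u) - phiC (of_real u)"
    by (simp add: legendre_def phiC_of_real)
  also have "\<dots> = (\<integral>y. of_real u * kern1 (of_real u) y \<partial>\<nu>) - (\<integral>y. kern0 (of_real u) y \<partial>\<nu>)"
    by (simp add: phi1C_def phiC_def algebra_simps)
  also have "\<dots> = (\<integral>y. of_real u * kern1 (of_real u) y - kern0 (of_real u) y \<partial>\<nu>)"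
    using assms by (intro Bochner_Integration.integral_diff[symmetric] integrable_mult_right
        integrable_kern0 integrable_kern1) auto
  also have "\<dots> = (\<integral>y. complex_of_real (1 - exp (- (u * y)) - u * y * exp (- (u * y))) \<partial>\<nu>)"
    by (intro Bochner_Integration.integral_cong) (auto simp: kern0_def kern1_def exp_of_real_mult algebra_simps)
  finally show ?thesis by (simp only: integral_complex_of_real of_real_eq_iff)
qed

lemma legendre_nonneg: "0 \<le> u \<Longrightarrow> 0 \<le> legendre u"
proof (cases "u = 0")
  case False
  assume "0 \<le> u"
  then have u: "0 < u" using False by simp
  show ?thesis unfolding legendre_integral[OF u]
  proof (rule integral_nonneg_AE, rule eventually_mono[OF AE_pos])
    fix y :: real assume "0 < y"
    then have "0 \<le> u * y" using u by simp
    then show "0 \<le> 1 - exp (- (u * y)) - u * y * exp (- (u * y))" by (rule real_exp_remainder(1))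
  qed
qed (simp add: legendre_zero)

lemma tendsto_integral_at_right_0:
  fixes F :: "real \<Rightarrow> real \<Rightarrow> real"
  assumes meas: "\<And>u. F u \<in> borel_measurable borel"
    and lim: "\<And>y. 0 < y \<Longrightarrow> ((\<lambda>u. F u y) \<longlongrightarrow> 0) (at_right 0)"
    and bd: "\<And>u y. 0 < u \<Longrightarrow> u < 1 \<Longrightarrow> 0 < y \<Longrightarrow> \<bar>F u y\<bar> \<le> C * min 1 (y\<^sup>2)"
  shows "((\<lambda>u. \<integral>y. F u y \<partial>\<nu>) \<longlongrightarrow> 0) (at_right 0)"
proof -
  have at: "at_right (0::real) = at 0 within {0<..<1}"
    by (rule at_within_nhd[of _ "{-1<..<1}"]) auto
  have "((\<lambda>u. \<integral>y. F u y \<partial>\<nu>) \<longlongrightarrow> (\<integral>y. 0 \<partial>\<nu>)) (at 0 within {0<..<1})"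
    unfolding tendsto_at_iff_sequentially comp_def
  proof (intro allI impI)
    fix X :: "nat \<Rightarrow> real" assume X: "\<forall>i. X i \<in> {0<..<1} - {0}" "X \<longlonglongrightarrow> 0"
    show "(\<lambda>i. \<integral>y. F (X i) y \<partial>\<nu>) \<longlonglongrightarrow> (\<integral>y. 0 \<partial>\<nu>)"
    proof (rule integral_dominated_convergence[where w = "\<lambda>y. C * min 1 (y\<^sup>2)"])
      show "AE y in \<nu>. (\<lambda>i. F (X i) y) \<longlonglongrightarrow> 0"
        using AE_pos
      proof eventually_elim
        case (elim y)
        show ?case using lim[OF elim] X unfolding at tendsto_at_iff_sequentially comp_def by blast
      qed
      show "AE y in \<nu>. norm (F (X i) y) \<le> C * min 1 (y\<^sup>2)" for i
        using AE_pos by eventually_elim (use bd X in auto)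
      show "F (X i) \<in> borel_measurable \<nu>" for i using meas[of "X i"] by simp
    qed (use integrable_min in auto)
  qed
  then show ?thesis unfolding at by simp
qed

lemma legendre_tendsto_0: "(legendre \<longlongrightarrow> 0) (at_right 0)"
proof -
  have "((\<lambda>u. \<integral>y. 1 - exp (- (u * y)) - u * y * exp (- (u * y)) \<partial>\<nu>) \<longlongrightarrow> 0) (at_right 0)"
  proof (rule tendsto_integral_at_right_0[where C = 1])
    fix y :: real
    have "((\<lambda>u. 1 - exp (- (u * y)) - u * y * exp (- (u * y))) \<longlongrightarrow>
       1 - exp (- (0 * y)) - 0 * y * exp (- (0 * y))) (at_right 0)"
      by (intro tendsto_intros)
    then show "((\<lambda>u. 1 - exp (- (u * y)) - u * y * exp (- (u * y))) \<longlongrightarrow> 0) (at_right 0)" by simp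
    fix u :: real assume u: "0 < u" "u < 1" "0 < y"
    have "(u * y)\<^sup>2 \<le> y\<^sup>2" using u by (simp add: power_mult_distrib mult_left_le_one_le power_le_one)
    then show "\<bar>1 - exp (- (u * y)) - u * y * exp (- (u * y))\<bar> \<le> 1 * min 1 (y\<^sup>2)"
      using real_exp_remainder[of "u * y"] mult_pos_pos[OF u(1,3)] by (simp add: abs_of_nonneg)
  qed simp
  moreover have "eventually (\<lambda>u. (\<integral>y. 1 - exp (- (u * y)) - u * y * exp (- (u * y)) \<partial>\<nu>) = legendre u) (at_right 0)"
    using legendre_integral by (auto simp: eventually_at_right_field intro: exI[of _ 1])
  ultimately show ?thesis by (rule Lim_transform_eventually)
qed

lemma square_phi2: "u\<^sup>2 * phi2 u = (\<integral>y. (u * y)\<^sup>2 * exp (- (u * y)) \<partial>\<nu>)"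
  unfolding phi2_def by (subst integral_mult_right_zero[symmetric]) (simp add: power_mult_distrib mult_ac)

lemma square_phi2_integrand:
  fixes u y :: real
  assumes "0 < u" "0 < y"
  shows "(u * y)\<^sup>2 * exp (- (u * y)) \<le> (2 + u\<^sup>2) * min 1 (y\<^sup>2)"
proof -
  have "(u * y)\<^sup>2 * exp (- (u * y)) \<le> 2"
    using power_mult_exp_bound[of "u * y" 1 2] assms by simp
  moreover have "(u * y)\<^sup>2 * exp (- (u * y)) \<le> u\<^sup>2 * y\<^sup>2"
    using assms by (simp add: power_mult_distrib mult_left_le)
  moreover have "u\<^sup>2 * y\<^sup>2 \<le> (2 + u\<^sup>2) * y\<^sup>2" "2 \<le> (2 + u\<^sup>2) * 1" by (auto intro: mult_right_mono)
  ultimately have "(u * y)\<^sup>2 * exp (- (u * y)) \<le> (2 + u\<^sup>2) * y\<^sup>2"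
    "(u * y)\<^sup>2 * exp (- (u * y)) \<le> (2 + u\<^sup>2) * 1" by linarith+
  then show ?thesis unfolding min_def by (simp only: split: if_split) blast
qed

lemma square_phi2_tendsto_0: "((\<lambda>u. u\<^sup>2 * phi2 u) \<longlongrightarrow> 0) (at_right 0)"
  unfolding square_phi2
proof (rule tendsto_integral_at_right_0[where C = 3])
  fix y :: real
  have "((\<lambda>u. (u * y)\<^sup>2 * exp (- (u * y))) \<longlongrightarrow> (0 * y)\<^sup>2 * exp (- (0 * y))) (at_right 0)"
    by (intro tendsto_intros)
  then show "((\<lambda>u. (u * y)\<^sup>2 * exp (- (u * y))) \<longlongrightarrow> 0) (at_right 0)" by simp
  fix u :: real assume u: "0 < u" "u < 1" "0 < y"
  have "u\<^sup>2 \<le> 1" using u by (simp add: power_le_one)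
  then have "(2 + u\<^sup>2) * min 1 (y\<^sup>2) \<le> 3 * min 1 (y\<^sup>2)" by (intro mult_right_mono) auto
  from order_trans[OF square_phi2_integrand this] u
  show "\<bar>(u * y)\<^sup>2 * exp (- (u * y))\<bar> \<le> 3 * min 1 (y\<^sup>2)"
    by simp
qed simp

lemma square_phi2_le: 
  assumes "0 < u"
  shows "u\<^sup>2 * phi2 u \<le> (2 + u\<^sup>2) * (\<integral>y. min 1 (y\<^sup>2) \<partial>\<nu>)"
  unfolding square_phi2 integral_mult_right_zero[symmetric]
proof (rule integral_mono_AE)
  show "integrable \<nu> (\<lambda>y. (u * y)\<^sup>2 * exp (- (u * y)))"
    by (rule integrable_kernI[where C = "2 + u\<^sup>2"]) (use square_phi2_integrand assms in auto)
  show "AE y in \<nu>. (u * y)\<^sup>2 * exp (- (u * y)) \<le> (2 + u\<^sup>2) * min 1 (y\<^sup>2)"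
    using AE_pos by eventually_elim (use square_phi2_integrand assms in auto)
qed (use integrable_min in auto)

lemma continuous_phi2: "continuous_on {0<..} phi2"
  using phi_derivs(3) by (intro continuous_at_imp_continuous_on) (auto intro: DERIV_isCont)

definition truncated_moment :: "real \<Rightarrow> real" where "truncated_moment r = (\<integral>y. y\<^sup>2 * indicator {y. y < r} y \<partial>\<nu>)"

lemma integrable_truncated_moment: "integrable \<nu> (\<lambda>y. y\<^sup>2 * indicator {y. y < r} y)"
proof (rule integrable_kernI[where C = "1 + r\<^sup>2"])
  fix y :: real assume y: "0 < y"
  show "norm (y\<^sup>2 * indicator {y. y < r} y) \<le> (1 + r\<^sup>2) * min 1 (y\<^sup>2)"
  proof (cases "y < r")
    case True
    then have "y\<^sup>2 \<le> r\<^sup>2" using y by (intro power_mono) auto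
    then have "y\<^sup>2 \<le> (1 + r\<^sup>2) * y\<^sup>2" "y\<^sup>2 \<le> (1 + r\<^sup>2) * 1" by (auto simp: distrib_right)
    then have "y\<^sup>2 \<le> (1 + r\<^sup>2) * min 1 (y\<^sup>2)"
      unfolding min_def by (simp only: split: if_split) blast
    then show ?thesis using y True by simp
  qed simp
qed simp

end

text \<open>Since \<open>u powr (\<alpha> - 2) \<ge> 1 / u\<close> for \<open>\<alpha> \<ge> 1\<close> and \<open>u \<ge> 1\<close>, weak lower scaling of the second derivative
  with exponent \<open>\<alpha> - 2\<close> says that \<open>u * phi2 u\<close> is almost increasing beyond \<open>x\<^sub>0\<close>.\<close>

locale scaled_levy_exponent = levy_exponent +
  fixes c x\<^sub>0 :: real
  assumes c: "0 < c" "c \<le> 1" and x0: "0 \<le> x\<^sub>0"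
    and scaling: "x\<^sub>0 < x \<Longrightarrow> x \<le> s \<Longrightarrow> c * (x * phi2 x) \<le> s * phi2 s"
    and phi2_pos: "0 < u \<Longrightarrow> 0 < phi2 u"
begin

lemma phi2_half:
  assumes "2 * x\<^sub>0 < w"
  shows "phi2 (w / 2) \<le> 2 / c * phi2 w"
proof -
  have "0 < w" using assms x0 by linarith
  then have "c * (w / 2 * phi2 (w / 2)) \<le> w * phi2 w" using scaling[of "w / 2" w] assms by simp
  then have "w * (c * phi2 (w / 2)) \<le> w * (2 * phi2 w)" by (simp add: algebra_simps)
  then have "c * phi2 (w / 2) \<le> 2 * phi2 w" using \<open>0 < w\<close> by simp
  then show ?thesis using c by (simp add: field_simps)
qed

text \<open>Chosen such that \<open>exp (- cutoff / 2) = c / 4\<close>: jumps larger than \<open>cutoff / l\<close> then contribute at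
  most half of \<open>phi2 l\<close>.\<close>

definition cutoff :: real where "cutoff = 2 * ln (4 / c)"

lemma cutoff_gt_1: "1 < cutoff"
proof -
  have "ln 4 \<le> ln (4 / c)" using c by (simp add: field_simps)
  moreover have "1 < 2 * ln (4::real)"
  proof -
    have "exp (1/2::real) \<le> 1 + 1/2 + (1/2)\<^sup>2" by (rule exp_bound) auto
    also have "\<dots> < 4" by (simp add: power2_eq_square)
    finally have "ln (exp (1/2)) < ln (4::real)" by (subst ln_less_cancel_iff) auto
    then show ?thesis by simp
  qed
  ultimately show ?thesis by (simp add: cutoff_def)
qed

text \<open>The part of \<open>phi2 l\<close> due to jumps \<open>y \<ge> cutoff / l\<close> is at most \<open>c / 4 * phi2 (l / 2)\<close>, and halving the
  argument increases \<open>phi2\<close> by a factor of at most \<open>2 / c\<close>.\<close>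

lemma phi2_le_truncated_moment:
  assumes l: "2 * x\<^sub>0 < l"
  shows "phi2 l \<le> 2 * truncated_moment (cutoff / l)"
proof -
  have l0: "0 < l" using l x0 by linarith
  have ec: "exp (- (cutoff / 2)) = c / 4" using c by (simp add: cutoff_def exp_minus)
  have int: "integrable \<nu> (\<lambda>y. y\<^sup>2 * exp (- (l / 2) * y))" using integrable_power_exp[of "l / 2" 2] l0 by simp
  have "phi2 l \<le> (\<integral>y. y\<^sup>2 * indicator {y. y < cutoff / l} y + c / 4 * (y\<^sup>2 * exp (- (l / 2) * y)) \<partial>\<nu>)"
    unfolding phi2_def
  proof (rule integral_mono_AE)
    show "integrable \<nu> (\<lambda>y. y\<^sup>2 * exp (- l * y))" using integrable_power_exp[of l 2] l0 by simp
    show "integrable \<nu> (\<lambda>y. y\<^sup>2 * indicator {y. y < cutoff / l} y + c / 4 * (y\<^sup>2 * exp (- (l / 2) * y)))"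
      by (intro Bochner_Integration.integrable_add integrable_truncated_moment integrable_mult_right int)
    show "AE y in \<nu>. y\<^sup>2 * exp (- l * y) \<le> y\<^sup>2 * indicator {y. y < cutoff / l} y + c / 4 * (y\<^sup>2 * exp (- (l / 2) * y))"
      using AE_pos
    proof eventually_elim
      case (elim y)
      show ?case
      proof (cases "y < cutoff / l")
        case True
        have "y\<^sup>2 * exp (- l * y) \<le> y\<^sup>2" using l0 elim by (simp add: mult_left_le)
        moreover have "0 \<le> c / 4 * (y\<^sup>2 * exp (- (l / 2) * y))" using c by simp
        moreover have "y\<^sup>2 * indicator {y. y < cutoff / l} y = y\<^sup>2" using True by simp
        ultimately show ?thesis by linarith
      next
        case False
        have "exp (- l * y) = exp (- (l * y / 2)) * exp (- (l / 2) * y)" by (simp flip: exp_add)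
        also have "\<dots> \<le> exp (- (cutoff / 2)) * exp (- (l / 2) * y)"
          using False l0 by (intro mult_right_mono) (auto simp: field_simps)
        finally have "y\<^sup>2 * exp (- l * y) \<le> y\<^sup>2 * (c / 4 * exp (- (l / 2) * y))"
          unfolding ec by (intro mult_left_mono) auto
        then show ?thesis using False by (simp add: mult_ac)
      qed
    qed
  qed
  also have "\<dots> = truncated_moment (cutoff / l) + c / 4 * phi2 (l / 2)"
    unfolding truncated_moment_def phi2_def using integrable_truncated_moment int by simp
  also have "c / 4 * phi2 (l / 2) \<le> c / 4 * (2 / c * phi2 l)"
    using phi2_half[OF l] c by (intro mult_left_mono) auto
  also have "c / 4 * (2 / c * phi2 l) = phi2 l / 2" using c by (simp add: field_simps)
  finally show ?thesis by linarith
qed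

definition decay :: real where "decay = c / (8 * exp 1 * cutoff)"

lemma decay_pos: "0 < decay" and decay_le: "decay \<le> 1 / 2"
proof -
  show "0 < decay" using c cutoff_gt_1 by (simp add: decay_def)
  have "1 \<le> exp (1::real)" by simp
  then have "1 * 1 \<le> exp 1 * cutoff" using cutoff_gt_1 by (intro mult_mono) auto
  then have "c \<le> 1 / 2 * (8 * exp 1 * cutoff)" using c by linarith
  then show "decay \<le> 1 / 2" using cutoff_gt_1 unfolding decay_def by (subst pos_divide_le_eq) auto
qed

text \<open>Only jumps \<open>y < 1 / m\<close> with \<open>m = max \<bar>\<xi>\<bar> w\<close> are used: for them the tilt is harmless and the cosine is
  quadratic. Their second moment is bounded below by \<open>phi2\<close> at a multiple of \<open>m\<close>, and scaling
  brings the argument back to \<open>w\<close>. The bound is quadratic in \<open>\<xi>\<close> up to \<open>\<bar>\<xi>\<bar> = w\<close> and linear beyond.\<close>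

lemma Re_kappa_le:
  assumes w: "2 * x\<^sub>0 < w"
  shows "Re (kappa w \<xi>) \<le> - (decay * phi2 w * \<xi>\<^sup>2 * (w / max \<bar>\<xi>\<bar> w))"
proof -
  define m where "m = max \<bar>\<xi>\<bar> w"
  have w0: "0 < w" using w x0 by linarith
  have m: "0 < m" "w \<le> m" "\<bar>\<xi>\<bar> \<le> m" using w0 by (auto simp: m_def)
  have int: "integrable \<nu> (\<lambda>y. (1 - cos (\<xi> * y)) * exp (- w * y))"
    and Re: "- Re (kappa w \<xi>) = (\<integral>y. (1 - cos (\<xi> * y)) * exp (- w * y) \<partial>\<nu>)"
  proof -
    have eq: "(1 - cos (\<xi> * y)) * exp (- w * y) =
       - Re ((iexp (\<xi> * y) - 1 - \<i> * of_real (\<xi> * y)) * of_real (exp (- w * y)))" for y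
      by (simp add: Re_exp algebra_simps)
    show "integrable \<nu> (\<lambda>y. (1 - cos (\<xi> * y)) * exp (- w * y))"
      unfolding eq by (intro Bochner_Integration.integrable_minus integrable_Re kappa_eq(2) w0)
    show "- Re (kappa w \<xi>) = (\<integral>y. (1 - cos (\<xi> * y)) * exp (- w * y) \<partial>\<nu>)"
      unfolding eq kappa_def by (subst Bochner_Integration.integral_minus, subst integral_Re[OF kappa_eq(2)[OF w0]]) simp
  qed
  have "\<xi>\<^sup>2 / (4 * exp 1) * truncated_moment (1 / m) =
      (\<integral>y. \<xi>\<^sup>2 / (4 * exp 1) * (y\<^sup>2 * indicator {y. y < 1 / m} y) \<partial>\<nu>)"
    by (simp add: truncated_moment_def)
  also have "\<dots> \<le> - Re (kappa w \<xi>)"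
    unfolding Re
  proof (rule integral_mono_AE[OF integrable_mult_right[OF integrable_truncated_moment] int])
    show "AE y in \<nu>. \<xi>\<^sup>2 / (4 * exp 1) * (y\<^sup>2 * indicator {y. y < 1 / m} y) \<le> (1 - cos (\<xi> * y)) * exp (- w * y)"
      using AE_pos
    proof eventually_elim
      case (elim y)
      show ?case
      proof (cases "y < 1 / m")
        case True
        then have my: "m * y \<le> 1" using m by (simp add: field_simps)
        have "\<bar>\<xi>\<bar> * y \<le> m * y" using m elim by (intro mult_right_mono) auto
        then have "\<bar>\<xi>\<bar> * y \<le> 1" using my by linarith
        then have "\<bar>\<xi> * y\<bar> \<le> 1" using elim by (simp only: abs_mult abs_of_pos)
        then have "(\<xi> * y)\<^sup>2 / 4 \<le> 1 - cos (\<xi> * y)" by (rule cos_quadratic_bound)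
        moreover have "exp (- 1) \<le> exp (- w * y)"
        proof -
          have "w * y \<le> m * y" using m elim by (intro mult_right_mono) auto
          then have "w * y \<le> 1" using my by linarith
          then show ?thesis by simp
        qed
        ultimately have "(\<xi> * y)\<^sup>2 / 4 * exp (- 1) \<le> (1 - cos (\<xi> * y)) * exp (- w * y)"
          by (intro mult_mono) auto
        then show ?thesis using True by (simp add: power_mult_distrib exp_minus field_simps)
      qed simp
    qed
  qed
  finally have 1: "\<xi>\<^sup>2 / (4 * exp 1) * truncated_moment (1 / m) \<le> - Re (kappa w \<xi>)" .
  have cm: "w \<le> cutoff * m" using mult_mono[of 1 cutoff w m] cutoff_gt_1 m w0 by simp
  have "c * (w * phi2 w) \<le> cutoff * m * phi2 (cutoff * m)"
    by (rule scaling) (use w x0 cm in auto)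
  also have "\<dots> \<le> cutoff * m * (2 * truncated_moment (cutoff / (cutoff * m)))"
    using phi2_le_truncated_moment[of "cutoff * m"] w cm cutoff_gt_1 m by (intro mult_left_mono) auto
  also have "cutoff / (cutoff * m) = 1 / m" using cutoff_gt_1 by simp
  finally have 2: "c * w * phi2 w / (2 * cutoff * m) \<le> truncated_moment (1 / m)"
    using cutoff_gt_1 m by (simp add: field_simps)
  have "decay * phi2 w * \<xi>\<^sup>2 * (w / m) = \<xi>\<^sup>2 / (4 * exp 1) * (c * w * phi2 w / (2 * cutoff * m))"
    by (simp add: decay_def field_simps)
  also have "\<dots> \<le> \<xi>\<^sup>2 / (4 * exp 1) * truncated_moment (1 / m)"
    by (rule mult_left_mono[OF 2]) simp
  finally show ?thesis using 1 by (simp add: m_def)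
qed

text \<open>The third moment of the tilted jump measure is controlled by its second moment, since one factor
  \<open>y\<close> is absorbed by half of the tilt.\<close>

lemma kappa_cubic_remainder:
  assumes w: "2 * x\<^sub>0 < w"
  shows "norm (kappa w \<xi> + of_real (phi2 w * \<xi>\<^sup>2 / 2)) \<le> \<bar>\<xi>\<bar> ^ 3 * phi2 w / (c * w)"
proof -
  have w0: "0 < w" using w x0 by linarith
  let ?f = "\<lambda>y. (iexp (\<xi> * y) - 1 - \<i> * of_real (\<xi> * y)) * of_real (exp (- w * y))"
  let ?g = "\<lambda>y. complex_of_real (\<xi>\<^sup>2 / 2 * (y\<^sup>2 * exp (- w * y)))"
  have intg: "integrable \<nu> (\<lambda>y. \<xi>\<^sup>2 / 2 * (y\<^sup>2 * exp (- w * y)))"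
    using integrable_power_exp[of w 2] w0 by (intro integrable_mult_right) auto
  have "complex_of_real (phi2 w * \<xi>\<^sup>2 / 2) = of_real (\<integral>y. \<xi>\<^sup>2 / 2 * (y\<^sup>2 * exp (- w * y)) \<partial>\<nu>)"
    by (simp add: phi2_def)
  also have "\<dots> = (\<integral>y. ?g y \<partial>\<nu>)" by (simp only: integral_complex_of_real)
  finally have eq: "kappa w \<xi> + of_real (phi2 w * \<xi>\<^sup>2 / 2) = (\<integral>y. ?f y + ?g y \<partial>\<nu>)"
    unfolding kappa_def
    by (simp only:) (intro Bochner_Integration.integral_add[symmetric] kappa_eq(2)[OF w0] integrable_of_real intg)
  have int: "integrable \<nu> (\<lambda>y. ?f y + ?g y)"
    by (intro Bochner_Integration.integrable_add kappa_eq(2)[OF w0] integrable_of_real intg)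
  have "norm (kappa w \<xi> + of_real (phi2 w * \<xi>\<^sup>2 / 2)) \<le> (\<integral>y. norm (?f y + ?g y) \<partial>\<nu>)"
    unfolding eq by (rule integral_norm_bound)
  also have "\<dots> \<le> (\<integral>y. \<bar>\<xi>\<bar> ^ 3 / (3 * w) * (y\<^sup>2 * exp (- (w / 2) * y)) \<partial>\<nu>)"
  proof (rule integral_mono_AE)
    show "integrable \<nu> (\<lambda>y. norm (?f y + ?g y))" by (rule integrable_norm[OF int])
    show "integrable \<nu> (\<lambda>y. \<bar>\<xi>\<bar> ^ 3 / (3 * w) * (y\<^sup>2 * exp (- (w / 2) * y)))"
      using integrable_power_exp[of "w / 2" 2] w0 by (intro integrable_mult_right) auto
    show "AE y in \<nu>. norm (?f y + ?g y) \<le> \<bar>\<xi>\<bar> ^ 3 / (3 * w) * (y\<^sup>2 * exp (- (w / 2) * y))"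
      using AE_pos
    proof eventually_elim
      case (elim y)
      have "?f y + ?g y = (iexp (\<xi> * y) - 1 - \<i> * of_real (\<xi> * y) + of_real ((\<xi> * y)\<^sup>2) / 2) * of_real (exp (- w * y))"
        by (simp add: algebra_simps power_mult_distrib)
      then have "norm (?f y + ?g y) = norm (iexp (\<xi> * y) - 1 - \<i> * of_real (\<xi> * y) + of_real ((\<xi> * y)\<^sup>2) / 2) * exp (- w * y)"
        by (simp only: norm_mult norm_of_real abs_exp_cancel)
      also have "\<dots> \<le> \<bar>\<xi> * y\<bar> ^ 3 / 6 * exp (- w * y)"
        by (intro mult_right_mono iexp_cubic_remainder) simp
      also have "\<dots> = \<bar>\<xi>\<bar> ^ 3 / 6 * (y\<^sup>2 * exp (- (w / 2) * y)) * (y ^ 1 * exp (- (w / 2) * y))"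
      proof -
        have "exp (- w * y) = exp (- (w / 2) * y) * exp (- (w / 2) * y)" by (simp flip: exp_add)
        then show ?thesis using elim by (simp add: abs_mult power_mult_distrib power2_eq_square power3_eq_cube mult_ac)
      qed
      also have "\<dots> \<le> \<bar>\<xi>\<bar> ^ 3 / 6 * (y\<^sup>2 * exp (- (w / 2) * y)) * (fact 1 / (w / 2) ^ 1)"
        using elim w0 by (intro mult_left_mono power_mult_exp_bound) auto
      also have "\<dots> = \<bar>\<xi>\<bar> ^ 3 / (3 * w) * (y\<^sup>2 * exp (- (w / 2) * y))"
        by simp
      finally show ?case .
    qed
  qed
  also have "\<dots> = \<bar>\<xi>\<bar> ^ 3 / (3 * w) * phi2 (w / 2)" by (simp add: phi2_def)
  also have "\<dots> \<le> \<bar>\<xi>\<bar> ^ 3 / (3 * w) * (2 / c * phi2 w)"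
    using w0 by (intro mult_left_mono phi2_half[OF w]) auto
  also have "\<dots> = 2 / 3 * (\<bar>\<xi>\<bar> ^ 3 * phi2 w / (c * w))" by (simp add: mult_ac)
  also have "\<dots> \<le> \<bar>\<xi>\<bar> ^ 3 * phi2 w / (c * w)"
    using w0 c phi2_nonneg[of w] by (intro mult_left_le_one_le) auto
  finally show ?thesis .
qed

text \<open>The derivative \<open>u * phi2 u\<close> is almost increasing, so that the mean value theorem suffices. For
  \<open>x\<^sub>0 = 0\<close> the left end point is covered by the limit of the Legendre transform at \<open>0\<close>.\<close>

lemma legendre_le:
  assumes w: "x\<^sub>0 < w"
  shows "legendre w \<le> legendre x\<^sub>0 + w\<^sup>2 * phi2 w / c"
proof -
  have "continuous_on {x\<^sub>0..w} legendre"
    unfolding continuous_on_eq_continuous_within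
  proof
    fix u assume u: "u \<in> {x\<^sub>0..w}"
    show "continuous (at u within {x\<^sub>0..w}) legendre"
    proof (cases "u = 0")
      case True
      then have "x\<^sub>0 = 0" using u x0 by auto
      then show ?thesis using legendre_tendsto_0 w True legendre_zero
        by (simp add: continuous_within at_within_Icc_at_right)
    next
      case False
      then have "0 < u" using u x0 by auto
      then show ?thesis by (rule continuous_at_imp_continuous_at_within[OF DERIV_isCont[OF legendre_deriv]])
    qed
  qed
  moreover have "legendre differentiable (at u)" if "x\<^sub>0 < u" "u < w" for u
  proof -
    have "0 < u" using that x0 by linarith
    from legendre_deriv[OF this] show ?thesis unfolding real_differentiable_def by blast
  qed
  ultimately obtain l z where z: "x\<^sub>0 < z" "z < w" "DERIV legendre z :> l" "legendre w - legendre x\<^sub>0 = (w - x\<^sub>0) * l"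
    using MVT[OF w] by blast
  have l: "l = z * phi2 z" by (rule DERIV_unique[OF z(3) legendre_deriv]) (use z x0 in linarith)
  have l0: "0 \<le> l" unfolding l by (rule mult_nonneg_nonneg[OF _ phi2_nonneg]) (use z x0 in linarith)
  have "c * l \<le> w * phi2 w" unfolding l by (rule scaling) (use z in linarith)+
  then have "l \<le> w * phi2 w / c" using c by (simp add: pos_le_divide_eq mult.commute)
  then have "(w - x\<^sub>0) * l \<le> w * (w * phi2 w / c)"
    by (rule mult_mono[rotated]) (use w x0 l0 in linarith)+
  then show ?thesis using z(4) by (simp add: power2_eq_square)
qed

lemma phi1_growth:
  assumes w: "x\<^sub>0 < w" "w \<le> s"
  shows "c * (w * phi2 w) * ln (s / w) \<le> phi1 s - phi1 w"
proof -
  have w0: "0 < w" using w x0 by linarith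
  let ?h = "\<lambda>u. phi1 u - c * (w * phi2 w) * ln u"
  have "?h w \<le> ?h s"
  proof (rule DERIV_nonneg_imp_nondecreasing[OF w(2)])
    fix u assume u: "w \<le> u" "u \<le> s"
    have "(?h has_real_derivative phi2 u - c * (w * phi2 w) * (1 / u)) (at u)"
      using u w0 by (auto intro!: derivative_eq_intros phi_derivs)
    moreover have "0 \<le> phi2 u - c * (w * phi2 w) * (1 / u)"
      using scaling[of w u] w u w0 by (simp add: field_simps)
    ultimately show "\<exists>y. (?h has_real_derivative y) (at u) \<and> 0 \<le> y" by blast
  qed
  then show ?thesis using w w0 by (simp add: ln_div algebra_simps)
qed

end

section \<open>Comparing densities through characteristic functions\<close>

lemma interval_measure_tendsto_density:
  fixes f :: "real \<Rightarrow> real"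
  assumes fin: "finite_measure \<mu>" and dens: "\<mu> = density lborel (\<lambda>y. ennreal (f y))"
    and meas: "f \<in> borel_measurable borel" and cont: "isCont f x"
  shows "((\<lambda>h. measure \<mu> {x - h<..x + h} / (2 * h)) \<longlongrightarrow> max 0 (f x)) (at_right 0)"
proof -
  interpret finite_measure \<mu> by (rule fin)
  note [measurable] = meas
  have approx: "\<exists>\<delta>>0. \<forall>h. 0 < h \<longrightarrow> h < \<delta> \<longrightarrow>
      measure \<mu> {x - h<..x + h} \<le> max 0 (f x + \<epsilon>) * (2 * h) \<and>
      (f x - \<epsilon>) * (2 * h) \<le> measure \<mu> {x - h<..x + h}" if \<epsilon>: "0 < \<epsilon>" for \<epsilon>
  proof -
    obtain \<delta> where \<delta>: "0 < \<delta>" "\<And>y. dist y x < \<delta> \<Longrightarrow> dist (f y) (f x) < \<epsilon>"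
      using cont \<epsilon> unfolding continuous_at_eps_delta dist_real_def by metis
    have "measure \<mu> {x - h<..x + h} \<le> max 0 (f x + \<epsilon>) * (2 * h) \<and>
      (f x - \<epsilon>) * (2 * h) \<le> measure \<mu> {x - h<..x + h}" if h: "0 < h" "h < \<delta>" for h
    proof -
      have near: "f x - \<epsilon> \<le> f y \<and> f y \<le> max 0 (f x + \<epsilon>)" if "y \<in> {x - h<..x + h}" for y
      proof -
        have "dist y x < \<delta>" using that h by (auto simp: dist_real_def)
        then show ?thesis using \<delta>(2)[of y] by (simp add: dist_real_def abs_less_iff max_def)
      qed
      have em: "emeasure \<mu> {x - h<..x + h} = (\<integral>\<^sup>+y. ennreal (f y) * indicator {x - h<..x + h} y \<partial>lborel)"
        unfolding dens by (rule emeasure_density) auto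
      have "ennreal (measure \<mu> {x - h<..x + h}) \<le> (\<integral>\<^sup>+y. ennreal (max 0 (f x + \<epsilon>)) * indicator {x - h<..x + h} y \<partial>lborel)"
        unfolding emeasure_eq_measure[symmetric] em
      proof (rule nn_integral_mono)
        fix y :: real
        show "ennreal (f y) * indicator {x - h<..x + h} y \<le> ennreal (max 0 (f x + \<epsilon>)) * indicator {x - h<..x + h} y"
        proof (cases "y \<in> {x - h<..x + h}")
          case True
          have "ennreal (f y) \<le> ennreal (max 0 (f x + \<epsilon>))"
            by (rule ennreal_leI) (use near[OF True] in blast)
          then show ?thesis using True by simp
        qed simp
      qed
      also have "\<dots> = ennreal (max 0 (f x + \<epsilon>) * (2 * h))"
        using h by (simp add: nn_integral_cmult_indicator ennreal_mult)
      finally have 1: "measure \<mu> {x - h<..x + h} \<le> max 0 (f x + \<epsilon>) * (2 * h)"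
        using h by (subst (asm) ennreal_le_iff) auto
      have "ennreal ((f x - \<epsilon>) * (2 * h)) = (\<integral>\<^sup>+y. ennreal (f x - \<epsilon>) * indicator {x - h<..x + h} y \<partial>lborel)"
        using h by (simp add: nn_integral_cmult_indicator ennreal_mult'')
      also have "\<dots> \<le> ennreal (measure \<mu> {x - h<..x + h})"
        unfolding emeasure_eq_measure[symmetric] em
        by (rule nn_integral_mono) (use near in \<open>auto simp: indicator_def intro!: ennreal_leI\<close>)
      finally have 2: "(f x - \<epsilon>) * (2 * h) \<le> measure \<mu> {x - h<..x + h}"
        by (subst (asm) ennreal_le_iff) auto
      from 1 2 show ?thesis by blast
    qed
    with \<delta>(1) show ?thesis by blast
  qed
  show ?thesis
  proof (rule tendstoI)
    fix e :: real assume e: "0 < e"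
    obtain \<delta> where \<delta>: "0 < \<delta>" "\<And>h. 0 < h \<Longrightarrow> h < \<delta> \<Longrightarrow>
      measure \<mu> {x - h<..x + h} \<le> max 0 (f x + e / 2) * (2 * h) \<and>
      (f x - e / 2) * (2 * h) \<le> measure \<mu> {x - h<..x + h}"
      using approx[of "e / 2"] e by auto
    have "dist (measure \<mu> {x - h<..x + h} / (2 * h)) (max 0 (f x)) < e" if h: "0 < h" "h < \<delta>" for h
    proof -
      have "measure \<mu> {x - h<..x + h} / (2 * h) \<le> max 0 (f x + e / 2)"
        using \<delta>(2)[OF h] h by (simp add: pos_divide_le_eq)
      moreover have "f x - e / 2 \<le> measure \<mu> {x - h<..x + h} / (2 * h)"
        using \<delta>(2)[OF h] h by (simp add: pos_le_divide_eq)
      moreover have "0 \<le> measure \<mu> {x - h<..x + h} / (2 * h)" using h by simp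
      ultimately show ?thesis using e by (auto simp: dist_real_def abs_less_iff max_def split: if_splits)
    qed
    then show "\<forall>\<^sub>F h in at_right 0. dist (measure \<mu> {x - h<..x + h} / (2 * h)) (max 0 (f x)) < e"
      using \<delta>(1) unfolding eventually_at_right_field by blast
  qed
qed

text \<open>Subtract the two inversion formulas. The kernel is bounded by the length of the interval, which
  makes the bound proportional to that length.\<close>

lemma interval_measure_char_comparison:
  fixes M1 M2 :: "real measure"
  assumes M: "real_distribution M1" "real_distribution M2"
    and ab: "a \<le> b"
    and null: "measure M1 {a} = 0" "measure M1 {b} = 0" "measure M2 {a} = 0" "measure M2 {b} = 0"
    and B: "\<And>t. norm (char M1 t - char M2 t) \<le> B t" "integrable lborel B"
  shows "\<bar>measure M1 {a<..b} - measure M2 {a<..b}\<bar> \<le> (b - a) / (2 * pi) * (\<integral>t. B t \<partial>lborel)"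
proof -
  let ?F = "\<lambda>t::real. (iexp (-(t * a)) - iexp (-(t * b))) / (\<i> * t)"
  let ?J = "\<lambda>M T. 1 / (2 * pi) * (CLBINT t=-T..T. ?F t * char M t)"
  have F_le: "norm (?F t) \<le> b - a" for t
    using Levy_Inversion_aux2[of "- b" "- a" t] ab by (cases "t = 0") (auto simp: mult_ac)
  have B_nonneg: "0 \<le> B t" for t using B(1)[of t] norm_ge_zero order_trans by blast
  have chM: "char M' \<in> borel_measurable borel" if "real_distribution M'" for M'
    using real_distribution.isCont_char[OF that]
    by (intro borel_measurable_continuous_onI continuous_at_imp_continuous_on) auto
  have Fm: "?F \<in> borel_measurable borel" by measurable
  have integrable: "set_integrable lborel {- T<..<T} (\<lambda>t. ?F t * char M' t)"
    if M': "real_distribution M'" for M' and T :: real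
    unfolding set_integrable_def
  proof (rule integrableI_bounded_set_indicator[where B = "b - a"])
    show "(\<lambda>t. ?F t * char M' t) \<in> borel_measurable lborel"
      using borel_measurable_times[OF Fm chM[OF M']] by simp
    have "norm (?F t * char M' t) \<le> b - a" for t
    proof -
      have "norm (?F t) * norm (char M' t) \<le> (b - a) * 1"
        using ab by (intro mult_mono F_le real_distribution.cmod_char_le_1[OF M']) auto
      then show ?thesis by (simp only: norm_mult mult_1_right)
    qed
    then show "AE t in lborel. t \<in> {- T<..<T} \<longrightarrow> norm (?F t * char M' t) \<le> b - a" by blast
    show "emeasure lborel {- T<..<T} < \<infinity>" by (cases "0 \<le> T") auto
  qed auto
  have bound: "norm (?J M1 (real n) - ?J M2 (real n)) \<le> (b - a) / (2 * pi) * (\<integral>t. B t \<partial>lborel)" for n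
  proof -
    let ?S = "{- real n<..<real n}"
    have eq: "(CLBINT t=- ereal (real n)..ereal (real n). ?F t * char M' t) = (CLBINT t:?S. ?F t * char M' t)" for M'
      by (subst interval_lebesgue_integral_le_eq) auto
    have "?J M1 (real n) - ?J M2 (real n) =
       1 / (2 * pi) * ((CLBINT t:?S. ?F t * char M1 t) - (CLBINT t:?S. ?F t * char M2 t))"
      unfolding eq by (simp only: right_diff_distrib)
    also have "(CLBINT t:?S. ?F t * char M1 t) - (CLBINT t:?S. ?F t * char M2 t) =
        (CLBINT t:?S. ?F t * char M1 t - ?F t * char M2 t)"
      by (rule set_integral_diff(2)[symmetric]; rule integrable[OF M(1)] integrable[OF M(2)])
    finally have e1: "?J M1 (real n) - ?J M2 (real n) = 1 / (2 * pi) * (CLBINT t:?S. ?F t * char M1 t - ?F t * char M2 t)" .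
    have "norm (CLBINT t:?S. ?F t * char M1 t - ?F t * char M2 t) \<le> (\<integral>t. (b - a) * B t \<partial>lborel)"
      unfolding set_lebesgue_integral_def
    proof (rule order_trans[OF integral_norm_bound integral_mono])
      show "integrable lborel (\<lambda>t. norm (indicator ?S t *\<^sub>R (?F t * char M1 t - ?F t * char M2 t)))"
        using set_integral_diff(1)[OF integrable[OF M(1)] integrable[OF M(2)]]
        unfolding set_integrable_def by (rule integrable_norm)
      show "integrable lborel (\<lambda>t. (b - a) * B t)" using B(2) by simp
      fix t
      have "norm (?F t * char M1 t - ?F t * char M2 t) = norm (?F t) * norm (char M1 t - char M2 t)"
        by (simp only: right_diff_distrib[symmetric] norm_mult)
      also have "\<dots> \<le> (b - a) * B t" using ab by (intro mult_mono F_le B(1)) auto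
      finally show "norm (indicator ?S t *\<^sub>R (?F t * char M1 t - ?F t * char M2 t)) \<le> (b - a) * B t"
        using ab B_nonneg[of t] by (cases "t \<in> ?S") auto
    qed
    then have "norm (1 / (2 * pi) :: complex) * norm (CLBINT t:?S. ?F t * char M1 t - ?F t * char M2 t) \<le>
       1 / (2 * pi) * ((b - a) * (\<integral>t. B t \<partial>lborel))"
      by (intro mult_mono) (auto simp: norm_divide norm_mult)
    then show ?thesis unfolding e1 by (simp only: norm_mult times_divide_eq_left mult_1_left)
  qed
  have "(\<lambda>n. ?J M1 (real n)) \<longlonglongrightarrow> of_real (measure M1 {a<..b})"
    using real_distribution.Levy_Inversion[OF M(1) ab null(1,2)] by simp
  moreover have "(\<lambda>n. ?J M2 (real n)) \<longlonglongrightarrow> of_real (measure M2 {a<..b})"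
    using real_distribution.Levy_Inversion[OF M(2) ab null(3,4)] by simp
  ultimately have "(\<lambda>n. ?J M1 (real n) - ?J M2 (real n)) \<longlonglongrightarrow>
     of_real (measure M1 {a<..b}) - of_real (measure M2 {a<..b})"
    by (rule tendsto_diff)
  then have "(\<lambda>n. norm (?J M1 (real n) - ?J M2 (real n))) \<longlonglongrightarrow>
     norm (complex_of_real (measure M1 {a<..b}) - of_real (measure M2 {a<..b}))"
    by (rule tendsto_norm)
  then have "norm (complex_of_real (measure M1 {a<..b}) - of_real (measure M2 {a<..b})) \<le>
    (b - a) / (2 * pi) * (\<integral>t. B t \<partial>lborel)"
    by (rule LIMSEQ_le_const2) (use bound in blast)
  then show ?thesis by (simp only: of_real_diff[symmetric] norm_of_real)
qed

text \<open>Shrinking the interval turns the comparison of measures into one of densities.\<close>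

lemma density_char_comparison:
  fixes f g :: "real \<Rightarrow> real"
  assumes M: "real_distribution M1" "real_distribution M2"
    and f: "M1 = density lborel (\<lambda>y. ennreal (f y))" "f \<in> borel_measurable borel" "isCont f x" "0 \<le> f x"
    and g: "M2 = density lborel (\<lambda>y. ennreal (g y))" "g \<in> borel_measurable borel" "isCont g x" "0 \<le> g x"
    and B: "\<And>t. norm (char M1 t - char M2 t) \<le> B t" "integrable lborel B"
  shows "\<bar>f x - g x\<bar> \<le> (\<integral>t. B t \<partial>lborel) / (2 * pi)"
proof -
  have fin: "finite_measure M1" "finite_measure M2"
    using M by (auto simp: real_distribution_def prob_space_def)
  have null: "measure (density lborel (\<lambda>y. ennreal (k y))) {z} = 0" if [measurable]: "k \<in> borel_measurable borel"
    for k :: "real \<Rightarrow> real" and z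
  proof -
    have "emeasure (density lborel (\<lambda>y. ennreal (k y))) {z} = (\<integral>\<^sup>+y. ennreal (k y) * indicator {z} y \<partial>lborel)"
      by (rule emeasure_density) auto
    also have "\<dots> = 0" by (simp add: nn_integral_indicator_singleton)
    finally show ?thesis by (simp add: measure_def)
  qed
  have "((\<lambda>h. \<bar>measure M1 {x - h<..x + h} / (2 * h) - measure M2 {x - h<..x + h} / (2 * h)\<bar>) \<longlongrightarrow>
     \<bar>max 0 (f x) - max 0 (g x)\<bar>) (at_right 0)"
    by (intro tendsto_intros interval_measure_tendsto_density[OF fin(1) f(1,2,3)]
        interval_measure_tendsto_density[OF fin(2) g(1,2,3)])
  moreover have "\<forall>\<^sub>F h in at_right 0. \<bar>measure M1 {x - h<..x + h} / (2 * h) - measure M2 {x - h<..x + h} / (2 * h)\<bar>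
     \<le> (\<integral>t. B t \<partial>lborel) / (2 * pi)"
    unfolding eventually_at_right_field
  proof (intro exI[of _ 1] conjI allI impI)
    fix h :: real assume h: "0 < h" "h < 1"
    have "\<bar>measure M1 {x - h<..x + h} - measure M2 {x - h<..x + h}\<bar> \<le> (x + h - (x - h)) / (2 * pi) * (\<integral>t. B t \<partial>lborel)"
      using h by (intro interval_measure_char_comparison[OF M _ _ _ _ _ B])
        (auto simp: f(1) g(1) null[OF f(2)] null[OF g(2)])
    then have "\<bar>measure M1 {x - h<..x + h} - measure M2 {x - h<..x + h}\<bar> / (2 * h) \<le> (\<integral>t. B t \<partial>lborel) / (2 * pi)"
      using h by (simp add: divide_simps mult_ac)
    moreover have "\<bar>measure M1 {x - h<..x + h} / (2 * h) - measure M2 {x - h<..x + h} / (2 * h)\<bar> =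
       \<bar>measure M1 {x - h<..x + h} - measure M2 {x - h<..x + h}\<bar> / (2 * h)"
      using h by (simp add: diff_divide_distrib[symmetric])
    ultimately show "\<bar>measure M1 {x - h<..x + h} / (2 * h) - measure M2 {x - h<..x + h} / (2 * h)\<bar>
     \<le> (\<integral>t. B t \<partial>lborel) / (2 * pi)" by simp
  qed simp
  ultimately have "\<bar>max 0 (f x) - max 0 (g x)\<bar> \<le> (\<integral>t. B t \<partial>lborel) / (2 * pi)"
    by (rule tendsto_upperbound) simp
  then show ?thesis using f(4) g(4) by simp
qed

lemma char_normal_density:
  assumes s: "0 < s"
  shows "real_distribution (density lborel (\<lambda>x. ennreal (normal_density 0 s x)))"
    and "char (density lborel (\<lambda>x. ennreal (normal_density 0 s x))) t = of_real (exp (- (s\<^sup>2 * t\<^sup>2) / 2))"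
proof -
  interpret N: real_distribution std_normal_distribution by (rule real_dist_normal_dist)
  have "distributed std_normal_distribution lborel (\<lambda>x. x) (\<lambda>x. ennreal (std_normal_density x))"
    by (simp add: distributed_def distr_id2)
  then have "distributed std_normal_distribution lborel (\<lambda>x. 0 + s * x) (\<lambda>x. ennreal (normal_density (0 + s * 0) (\<bar>s\<bar> * 1) x))"
    by (rule N.normal_density_affine) (use s in auto)
  then have eq: "density lborel (\<lambda>x. ennreal (normal_density 0 s x)) = distr std_normal_distribution lborel (\<lambda>x. s * x)"
    using s by (simp add: distributed_def)
  also have "\<dots> = distr std_normal_distribution borel (\<lambda>x. s * x)"
    by (rule distr_cong) auto
  finally have eq: "density lborel (\<lambda>x. ennreal (normal_density 0 s x)) = distr std_normal_distribution borel (\<lambda>x. s * x)" .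
  show "real_distribution (density lborel (\<lambda>x. ennreal (normal_density 0 s x)))"
    unfolding eq by (rule N.real_distribution_distr) simp
  have "char (distr std_normal_distribution borel (\<lambda>x. s * x)) t = char std_normal_distribution (t * s)"
    unfolding char_def by (subst integral_distr) (auto simp: mult_ac)
  also have "\<dots> = of_real (exp (- (s\<^sup>2 * t\<^sup>2) / 2))"
    unfolding char_std_normal_distribution by (simp add: power_mult_distrib mult_ac)
  finally show "char (density lborel (\<lambda>x. ennreal (normal_density 0 s x))) t = of_real (exp (- (s\<^sup>2 * t\<^sup>2) / 2))"
    unfolding eq .
qed

lemma gaussian_cubic_integral:
  fixes a :: real
  assumes "0 < a"
  shows "has_bochner_integral lborel (\<lambda>x. \<bar>x\<bar> ^ 3 * exp (- a * x\<^sup>2)) (1 / a\<^sup>2)"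
proof -
  define s where "s = sqrt (1 / (2 * a))"
  have s: "0 < s" "s\<^sup>2 = 1 / (2 * a)" using assms by (auto simp: s_def)
  have "has_bochner_integral lborel (\<lambda>x. sqrt (2 * pi * s\<^sup>2) * (normal_density 0 s x * \<bar>x - 0\<bar> ^ (2 * 1 + 1)))
      (sqrt (2 * pi * s\<^sup>2) * (2 ^ 1 * s ^ (2 * 1 + 1) * fact 1 * sqrt (2 / pi)))"
    by (rule has_bochner_integral_mult_right[OF normal_moment_abs_odd]) (use s in auto)
  moreover have "(\<lambda>x. sqrt (2 * pi * s\<^sup>2) * (normal_density 0 s x * \<bar>x - 0\<bar> ^ (2 * 1 + 1))) = (\<lambda>x. \<bar>x\<bar> ^ 3 * exp (- a * x\<^sup>2))"
  proof
    fix x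
    have "normal_density 0 s x = 1 / sqrt (2 * pi * s\<^sup>2) * exp (- a * x\<^sup>2)"
      unfolding normal_density_def using assms by (simp add: s(2) mult_ac)
    moreover have "sqrt (2 * pi * s\<^sup>2) \<noteq> 0" using s(1) by simp
    ultimately show "sqrt (2 * pi * s\<^sup>2) * (normal_density 0 s x * \<bar>x - 0\<bar> ^ (2 * 1 + 1)) = \<bar>x\<bar> ^ 3 * exp (- a * x\<^sup>2)"
      by simp
  qed
  moreover have "sqrt (2 * pi * s\<^sup>2) * (2 ^ 1 * s ^ (2 * 1 + 1) * fact 1 * sqrt (2 / pi)) = 1 / a\<^sup>2"
  proof -
    have "sqrt (2 * pi * s\<^sup>2) * sqrt (2 / pi) = sqrt ((2 * s)\<^sup>2)"
      unfolding real_sqrt_mult[symmetric] by (simp add: power_mult_distrib)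
    also have "\<dots> = \<bar>2 * s\<bar>" by (rule real_sqrt_abs)
    also have "\<dots> = 2 * s" using s(1) by simp
    finally have "sqrt (2 * pi * s\<^sup>2) * (2 ^ 1 * s ^ (2 * 1 + 1) * fact 1 * sqrt (2 / pi)) = 4 * (s\<^sup>2)\<^sup>2"
      by (simp add: eval_nat_numeral mult_ac)
    also have "\<dots> = 1 / a\<^sup>2" unfolding s(2) by (simp add: power_divide power_mult_distrib)
    finally show ?thesis .
  qed
  ultimately show ?thesis by (simp only:)
qed

lemma two_sided_exponential_integral:
  fixes a :: real
  assumes "0 < a"
  shows "has_bochner_integral lborel (\<lambda>x. exp (- a * \<bar>x\<bar>)) (2 / a)"
proof -
  have "has_bochner_integral lborel (\<lambda>x::real. indicator {0..} x *\<^sub>R exp (- a * \<bar>x\<bar>)) (1 / a)"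
  proof (rule has_bochner_integral_nn_integral)
    show "0 \<le> 1 / a" using assms by simp
    have "(\<integral>\<^sup>+x. ennreal (exp (- a * x)) * indicator {0..} x \<partial>lborel) = ennreal (0 - (- exp (- a * 0) / a))"
    proof (rule nn_integral_FTC_atLeast)
      show "((\<lambda>x. - exp (- a * x) / a) has_real_derivative exp (- a * x)) (at x)" for x
        using assms by (auto intro!: derivative_eq_intros)
      have "((\<lambda>x. - exp (- a * x) / a) \<longlongrightarrow> - 0 / a) at_top"
        using assms by (intro tendsto_intros filterlim_compose[OF exp_at_bot]
            filterlim_tendsto_neg_mult_at_bot[OF tendsto_const] filterlim_ident) auto
      then show "((\<lambda>x. - exp (- a * x) / a) \<longlongrightarrow> 0) at_top" by simp
    qed auto
    moreover have "(\<integral>\<^sup>+x. ennreal (indicator {0..} x *\<^sub>R exp (- a * \<bar>x\<bar>)) \<partial>lborel) =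
       (\<integral>\<^sup>+x. ennreal (exp (- a * x)) * indicator {0..} x \<partial>lborel)"
      by (rule nn_integral_cong) (auto simp: indicator_def)
    ultimately show "(\<integral>\<^sup>+x. ennreal (indicator {0..} x *\<^sub>R exp (- a * \<bar>x\<bar>)) \<partial>lborel) = ennreal (1 / a)"
      by simp
  qed (use assms in auto)
  from has_bochner_integral_even_function[OF this] show ?thesis by simp
qed

section \<open>Exponentially tilted marginals\<close>

lemma norm_exp_diff_le:
  fixes x y :: complex
  assumes "Re x \<le> m" "Re y \<le> m"
  shows "norm (exp x - exp y) \<le> exp m * norm (x - y)"
  by (rule field_differentiable_bound[of "{z. Re z \<le> m}" exp exp])
    (use assms in \<open>auto intro!: derivative_eq_intros convex_halfspace_Re_le simp: norm_exp_eq_Re\<close>)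

text \<open>The density at time \<open>t\<close> depends on the process through its one-dimensional laws, which form a
  convolution semigroup.\<close>

locale levy_semigroup = scaled_levy_exponent +
  fixes \<mu> :: "real \<Rightarrow> real measure" and p :: "real \<Rightarrow> real \<Rightarrow> real"
  assumes distribution: "0 < t \<Longrightarrow> real_distribution (\<mu> t)"
    and laplace: "0 < t \<Longrightarrow> 0 < u \<Longrightarrow> has_bochner_integral (\<mu> t) (\<lambda>x. exp (- u * x)) (exp (t * phi u))"
    and density: "0 < t \<Longrightarrow> \<mu> t = density lborel (\<lambda>x. ennreal (p t x))"
    and p_cont: "0 < t \<Longrightarrow> continuous_on UNIV (p t)"
    and p_nonneg: "0 < t \<Longrightarrow> 0 \<le> p t x"
    and convolution: "0 < s \<Longrightarrow> 0 < r \<Longrightarrow> \<mu> (s + r) = (\<mu> s \<star> \<mu> r)"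
begin

lemma sets_mu [measurable_cong]: "0 < t \<Longrightarrow> sets (\<mu> t) = sets borel"
  using real_distribution.events_eq_borel[OF distribution] by simp

lemma measurable_mu: "0 < t \<Longrightarrow> measurable (\<mu> t) N = measurable borel N"
  by (rule measurable_cong_sets[OF sets_mu refl])

lemma p_measurable: "0 < t \<Longrightarrow> p t \<in> borel_measurable borel"
  using p_cont by (rule borel_measurable_continuous_onI)

text \<open>Both sides are holomorphic on the right half-plane and agree on the positive half-line.\<close>

lemma complex_laplace:
  assumes t: "0 < t" and z: "0 < Re z"
  shows "(\<integral>x. exp (- z * of_real x) \<partial>\<mu> t) = exp (of_real t * phiC z)"
proof -
  let ?F = "\<lambda>z. (\<integral>x. (- of_real x) ^ 0 * exp (- z * of_real x) \<partial>\<mu> t) - exp (of_real t * phiC z)"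
  have int: "integrable (\<mu> t) (\<lambda>x. exp (- u * x))" if "0 < u" for u
    using laplace[OF t that] by (simp add: has_bochner_integral_iff)
  have "?F z = 0"
  proof (rule analytic_continuation[of ?F "{z. 0 < Re z}" "of_real ` {0<..}" 1])
    show "?F holomorphic_on {z. 0 < Re z}"
    proof (rule holomorphic_on_diff)
      show "(\<lambda>z. \<integral>x. (- of_real x) ^ 0 * exp (- z * of_real x) \<partial>\<mu> t) holomorphic_on {z. 0 < Re z}"
        using laplace_transform_derivative(2)[OF sets_mu[OF t] int, of _ 0]
        by (intro holomorphic_onI) (auto simp: field_differentiable_def intro: has_field_derivative_at_within)
      have "phiC holomorphic_on {z. 0 < Re z}"
        using phiC_derivs(1)
        by (intro holomorphic_onI) (auto simp: field_differentiable_def intro: has_field_derivative_at_within)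
      then show "(\<lambda>z. exp (of_real t * phiC z)) holomorphic_on {z. 0 < Re z}"
        by (intro holomorphic_intros)
    qed
    show "(1::complex) islimpt of_real ` {0::real<..}"
      unfolding islimpt_approachable
    proof (intro allI impI)
      fix e :: real assume "0 < e"
      then show "\<exists>x'\<in>of_real ` {0::real<..}. x' \<noteq> (1::complex) \<and> dist x' 1 < e"
        by (intro bexI[OF _ imageI[of "1 + e / 2"]]) (auto simp: dist_norm)
    qed
    show "?F w = 0" if w: "w \<in> of_real ` {0<..}" for w
    proof -
      obtain u where u: "0 < u" "w = of_real u" using w by auto
      have "(\<integral>x. exp (- w * of_real x) \<partial>\<mu> t) = (\<integral>x. complex_of_real (exp (- u * x)) \<partial>\<mu> t)"
        unfolding u(2) by (rule Bochner_Integration.integral_cong) (auto simp: exp_of_real_mult)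
      also have "\<dots> = of_real (exp (t * phi u))"
        unfolding integral_complex_of_real using laplace[OF t u(1)] by (simp add: has_bochner_integral_iff)
      also have "\<dots> = exp (of_real t * phiC w)"
        unfolding u(2) phiC_of_real by (simp flip: exp_of_real)
      finally show ?thesis by simp
    qed
    show "open {z. 0 < Re z}" by (rule open_halfspace_Re_gt)
    show "connected {z. 0 < Re z}" by (intro convex_connected convex_halfspace_Re_gt)
  qed (use z in auto)
  then show ?thesis by simp
qed

text \<open>The shift moves the mean of the law tilted by \<open>w\<close> to the origin, and \<open>t * legendre w\<close> normalises the
  tilt.\<close>

definition centred :: "real \<Rightarrow> real \<Rightarrow> real measure" where
  "centred t w = distr (\<mu> t) borel (\<lambda>x. x + t * phi1 w)"

definition tilted :: "real \<Rightarrow> real \<Rightarrow> real measure" where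
  "tilted t w = density (centred t w) (\<lambda>y. ennreal (exp (- w * y + t * legendre w)))"

lemma sets_centred [measurable_cong, simp]: "sets (centred t w) = sets borel"
  by (simp add: centred_def)

lemma sets_tilted [measurable_cong, simp]: "sets (tilted t w) = sets borel"
  by (simp add: tilted_def)

lemma centred_laplace:
  assumes t: "0 < t" and z: "0 < Re z"
  shows "(\<integral>y. exp (- z * of_real y) \<partial>centred t w) = exp (of_real t * phiC z - z * of_real (t * phi1 w))"
proof -
  have "(\<integral>y. exp (- z * of_real y) \<partial>centred t w) = (\<integral>x. exp (- z * of_real (x + t * phi1 w)) \<partial>\<mu> t)"
    unfolding centred_def by (subst integral_distr) (auto simp: measurable_mu[OF t])
  also have "\<dots> = (\<integral>x. exp (- z * of_real (t * phi1 w)) * exp (- z * of_real x) \<partial>\<mu> t)"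
    by (rule Bochner_Integration.integral_cong) (auto simp: algebra_simps exp_add[symmetric])
  also have "\<dots> = exp (- z * of_real (t * phi1 w)) * exp (of_real t * phiC z)"
    using complex_laplace[OF t z] by simp
  finally show ?thesis by (simp add: exp_add[symmetric] algebra_simps)
qed

lemma centred_real_laplace:
  assumes t: "0 < t" and u: "0 < u"
  shows "has_bochner_integral (centred t w) (\<lambda>y. exp (- u * y)) (exp (t * phi u - u * (t * phi1 w)))"
proof -
  have "has_bochner_integral (\<mu> t) (\<lambda>x. exp (- u * (t * phi1 w)) * exp (- u * x))
     (exp (- u * (t * phi1 w)) * exp (t * phi u))"
    by (rule has_bochner_integral_mult_right[OF laplace[OF t u]])
  then have "has_bochner_integral (\<mu> t) (\<lambda>x. exp (- u * (x + t * phi1 w))) (exp (t * phi u - u * (t * phi1 w)))"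
    by (simp add: exp_add[symmetric] algebra_simps)
  then show ?thesis
    unfolding centred_def has_bochner_integral_iff
    by (subst integrable_distr_eq, simp_all add: measurable_mu[OF t] integral_distr)
qed

lemma tilted_real_distribution:
  assumes t: "0 < t" and w: "0 < w"
  shows "real_distribution (tilted t w)"
proof -
  have hb: "has_bochner_integral (centred t w) (\<lambda>y. exp (t * legendre w) * exp (- w * y))
     (exp (t * legendre w) * exp (t * phi w - w * (t * phi1 w)))"
    by (rule has_bochner_integral_mult_right[OF centred_real_laplace[OF t w]])
  have one: "exp (t * legendre w) * exp (t * phi w - w * (t * phi1 w)) = 1"
    by (simp add: exp_add[symmetric] legendre_def algebra_simps)
  have eq: "exp (t * legendre w) * exp (- w * y) = exp (- w * y + t * legendre w)" for y
    by (simp add: exp_add[symmetric] algebra_simps)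
  have "(\<integral>\<^sup>+y. ennreal (exp (- w * y + t * legendre w)) \<partial>centred t w) = ennreal 1"
    using hb unfolding eq one by (subst nn_integral_eq_integral) (auto simp: has_bochner_integral_iff)
  moreover have "emeasure (tilted t w) UNIV = (\<integral>\<^sup>+y. ennreal (exp (- w * y + t * legendre w)) * indicator UNIV y \<partial>centred t w)"
    unfolding tilted_def by (rule emeasure_density) auto
  moreover have "space (tilted t w) = UNIV" by (simp add: tilted_def centred_def)
  ultimately have "emeasure (tilted t w) (space (tilted t w)) = 1" by simp
  then show ?thesis
    by (simp add: real_distribution_def real_distribution_axioms_def prob_spaceI)
qed

lemma integral_tilted:
  fixes h :: "real \<Rightarrow> 'b::{banach, second_countable_topology}"
  assumes "h \<in> borel_measurable borel"
  shows "(\<integral>y. h y \<partial>tilted t w) = (\<integral>y. exp (- w * y + t * legendre w) *\<^sub>R h y \<partial>centred t w)"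
    and "integrable (tilted t w) h \<longleftrightarrow> integrable (centred t w) (\<lambda>y. exp (- w * y + t * legendre w) *\<^sub>R h y)"
  unfolding tilted_def using assms by (intro integral_density integrable_density; simp)+

lemma char_tilted:
  assumes t: "0 < t" and w: "0 < w"
  shows "char (tilted t w) \<xi> = exp (of_real t * kappa w \<xi>)"
proof -
  let ?z = "of_real w - \<i> * of_real \<xi> :: complex"
  have "char (tilted t w) \<xi> = (\<integral>y. exp (- w * y + t * legendre w) *\<^sub>R iexp (\<xi> * y) \<partial>centred t w)"
    unfolding char_def by (rule integral_tilted) simp
  also have "\<dots> = (\<integral>y. exp (of_real (t * legendre w)) * exp (- ?z * of_real y) \<partial>centred t w)"
    by (rule Bochner_Integration.integral_cong)
      (auto simp: scaleR_conv_of_real exp_of_real[symmetric] exp_add[symmetric] algebra_simps)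
  also have "\<dots> = exp (of_real (t * legendre w)) * exp (of_real t * phiC ?z - ?z * of_real (t * phi1 w))"
    using centred_laplace[OF t, of ?z w] w by simp
  also have "\<dots> = exp (of_real t * kappa w \<xi>)"
    unfolding exp_add[symmetric] kappa_eq(1)[OF w] by (simp add: legendre_def algebra_simps)
  finally show ?thesis .
qed

lemma tilted_density:
  assumes t: "0 < t"
  shows "tilted t w = density lborel (\<lambda>y. ennreal (exp (- w * y + t * legendre w) * p t (y - t * phi1 w)))"
proof (rule measure_eqI)
  fix A assume "A \<in> sets (tilted t w)"
  then have [measurable]: "A \<in> sets borel" by simp
  note [measurable] = p_measurable[OF t]
  define m where "m = t * phi1 w"
  let ?e = "\<lambda>y. ennreal (exp (- w * y + t * legendre w))"
  have "emeasure (tilted t w) A = (\<integral>\<^sup>+y. ?e y * indicator A y \<partial>centred t w)"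
    unfolding tilted_def by (rule emeasure_density) auto
  also have "\<dots> = (\<integral>\<^sup>+x. ?e (x + m) * indicator A (x + m) \<partial>\<mu> t)"
    unfolding centred_def m_def[symmetric] by (subst nn_integral_distr) (auto simp: measurable_mu[OF t])
  also have "\<dots> = (\<integral>\<^sup>+x. ennreal (p t x) * (?e (x + m) * indicator A (x + m)) \<partial>lborel)"
    unfolding density[OF t] by (rule nn_integral_density) auto
  also have "\<dots> = (\<integral>\<^sup>+x. ennreal (exp (- w * (x + m) + t * legendre w) * p t ((x + m) - m)) * indicator A (x + m) \<partial>lborel)"
    by (rule nn_integral_cong) (simp add: ennreal_mult p_nonneg[OF t] mult_ac)
  also have "\<dots> = (\<integral>\<^sup>+y. ennreal (exp (- w * y + t * legendre w) * p t (y - m)) * indicator A y \<partial>lborel)"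
    by (subst (2) nn_integral_real_affine[where c = 1 and t = m]) (simp_all add: add.commute)
  also have "\<dots> = emeasure (density lborel (\<lambda>y. ennreal (exp (- w * y + t * legendre w) * p t (y - m)))) A"
    by (rule emeasure_density[symmetric]) auto
  finally show "emeasure (tilted t w) A =
    emeasure (density lborel (\<lambda>y. ennreal (exp (- w * y + t * legendre w) * p t (y - t * phi1 w)))) A"
    by (simp add: m_def)
qed simp

text \<open>The square of this number is the value of \<open>t * (w\<^sup>2 * phi2 w)\<close> from which on the Gaussian term
  dominates the error in the local limit bound; the two summands bound the error from frequencies
  below and above \<open>w\<close>.\<close>

definition saddle_level :: real where "saddle_level = 1 / (c * decay\<^sup>2) + 4 / decay"

text \<open>The tilted density at its mean differs from the Gaussian density \<open>1 / sqrt (2 * pi * V)\<close> by at most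
  a multiple of \<open>1 / (V * w)\<close>, which is of smaller order when \<open>V * w\<^sup>2\<close> is large.\<close>

lemma saddle_point_lower_bound:
  assumes t: "0 < t" and w: "2 * x\<^sub>0 < w" and large: "saddle_level\<^sup>2 \<le> t * (w\<^sup>2 * phi2 w)"
  shows "exp (- t * legendre w) / (6 * sqrt (t * phi2 w)) \<le> p t (- t * phi1 w)"
proof -
  have w0: "0 < w" using w x0 by linarith
  define V where "V = t * phi2 w"
  define a where "a = decay * V"
  have V: "0 < V" using t phi2_pos[OF w0] by (simp add: V_def)
  have a: "0 < a" "a \<le> V / 2" using V decay_pos decay_le by (auto simp: a_def)
  define B where "B \<xi> = V / (c * w) * (\<bar>\<xi>\<bar> ^ 3 * exp (- a * \<xi>\<^sup>2)) + 2 * exp (- (a * w) * \<bar>\<xi>\<bar>)" for \<xi> :: real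
  define f where "f y = exp (- w * y + t * legendre w) * p t (y - t * phi1 w)" for y
  have hB: "has_bochner_integral lborel B (V / (c * w) * (1 / a\<^sup>2) + 2 * (2 / (a * w)))"
    unfolding B_def using a w0
    by (intro has_bochner_integral_add has_bochner_integral_mult_right gaussian_cubic_integral
        two_sided_exponential_integral) auto
  also have "V / (c * w) * (1 / a\<^sup>2) + 2 * (2 / (a * w)) = saddle_level / (V * w)"
    unfolding a_def saddle_level_def using V w0 c decay_pos by (simp add: field_simps power2_eq_square)
  finally have hB: "has_bochner_integral lborel B (saddle_level / (V * w))" .
  have sq: "(sqrt V)\<^sup>2 = V" using V by simp
  have diff: "norm (char (tilted t w) \<xi> - char (density lborel (\<lambda>x. ennreal (normal_density 0 (sqrt V) x))) \<xi>) \<le> B \<xi>" for \<xi>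
  proof -
    let ?g = "of_real (- (V * \<xi>\<^sup>2) / 2) :: complex"
    let ?k = "of_real t * kappa w \<xi>"
    have eq: "char (tilted t w) \<xi> - char (density lborel (\<lambda>x. ennreal (normal_density 0 (sqrt V) x))) \<xi> = exp ?k - exp ?g"
      using char_normal_density(2)[of "sqrt V" \<xi>] V char_tilted[OF t w0, of \<xi>] by (simp add: exp_of_real[symmetric])
    have "t * Re (kappa w \<xi>) \<le> t * (- (decay * phi2 w * \<xi>\<^sup>2 * (w / max \<bar>\<xi>\<bar> w)))"
      using t by (intro mult_left_mono Re_kappa_le[OF w]) auto
    then have Rek: "Re ?k \<le> - (a * \<xi>\<^sup>2 * (w / max \<bar>\<xi>\<bar> w))"
      by (simp add: a_def V_def algebra_simps)
    have "a * \<xi>\<^sup>2 \<le> V / 2 * \<xi>\<^sup>2" using a by (intro mult_right_mono) auto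
    then have Reg: "Re ?g \<le> - (a * \<xi>\<^sup>2)" by simp
    \<comment> \<open>Below frequency \<open>w\<close> the exponents are compared, beyond it both characteristic functions are small.\<close>
    show ?thesis
    proof (cases "\<bar>\<xi>\<bar> \<le> w")
      case True
      then have "w / max \<bar>\<xi>\<bar> w = 1" using w0 by (simp add: max_def)
      then have "norm (exp ?k - exp ?g) \<le> exp (- (a * \<xi>\<^sup>2)) * norm (?k - ?g)"
        using Rek Reg by (intro norm_exp_diff_le) simp_all
      also have "?k - ?g = of_real t * (kappa w \<xi> + of_real (phi2 w * \<xi>\<^sup>2 / 2))"
        by (simp add: V_def algebra_simps)
      also have "norm \<dots> = t * norm (kappa w \<xi> + of_real (phi2 w * \<xi>\<^sup>2 / 2))"
        using t by (simp only: norm_mult norm_of_real abs_of_pos)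
      also have "exp (- (a * \<xi>\<^sup>2)) * (t * norm (kappa w \<xi> + of_real (phi2 w * \<xi>\<^sup>2 / 2))) \<le>
          exp (- (a * \<xi>\<^sup>2)) * (t * (\<bar>\<xi>\<bar> ^ 3 * phi2 w / (c * w)))"
        using t by (intro mult_left_mono kappa_cubic_remainder[OF w]) auto
      also have "\<dots> = V / (c * w) * (\<bar>\<xi>\<bar> ^ 3 * exp (- a * \<xi>\<^sup>2))" by (simp add: V_def)
      also have "\<dots> \<le> B \<xi>" by (simp add: B_def)
      finally show ?thesis unfolding eq .
    next
      case False
      then have m: "max \<bar>\<xi>\<bar> w = \<bar>\<xi>\<bar>" "0 < \<bar>\<xi>\<bar>" using w0 by auto
      have e: "\<xi>\<^sup>2 * (w / \<bar>\<xi>\<bar>) = w * \<bar>\<xi>\<bar>" using m(2) by (simp add: power2_eq_square field_simps abs_mult_self_eq)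
      have k: "Re ?k \<le> - (a * w) * \<bar>\<xi>\<bar>" using Rek unfolding m(1) mult.assoc e by simp
      have "w * \<bar>\<xi>\<bar> \<le> \<bar>\<xi>\<bar> * \<bar>\<xi>\<bar>" using False by (intro mult_right_mono) auto
      then have "a * (w * \<bar>\<xi>\<bar>) \<le> a * \<xi>\<^sup>2" using a by (intro mult_left_mono) (auto simp: power2_eq_square)
      then have g: "Re ?g \<le> - (a * w) * \<bar>\<xi>\<bar>" using Reg by (simp add: mult.assoc)
      have "norm (exp ?k - exp ?g) \<le> norm (exp ?k) + norm (exp ?g)" by (rule norm_triangle_ineq4)
      also have "\<dots> = exp (Re ?k) + exp (Re ?g)" by (simp only: norm_exp_eq_Re)
      also have "\<dots> \<le> exp (- (a * w) * \<bar>\<xi>\<bar>) + exp (- (a * w) * \<bar>\<xi>\<bar>)"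
        using k g by (intro add_mono) (simp_all only: exp_le_cancel_iff)
      also have "\<dots> \<le> B \<xi>" using V c w0 by (simp add: B_def)
      finally show ?thesis unfolding eq .
    qed
  qed
  have contf: "isCont f 0" 
    using p_cont[OF t] unfolding f_def
    by (intro continuous_intros) (auto simp: continuous_on_eq_continuous_at intro!: isCont_o2[of _ "\<lambda>y. y - t * phi1 w" "p t"])
  have measf: "f \<in> borel_measurable borel"
    unfolding f_def [abs_def] using p_measurable[OF t] by measurable
  have contn: "isCont (normal_density 0 (sqrt V)) 0"
    unfolding normal_density_def using V by (intro continuous_intros) auto
  have "\<bar>f 0 - normal_density 0 (sqrt V) 0\<bar> \<le> (\<integral>\<xi>. B \<xi> \<partial>lborel) / (2 * pi)"
    by (rule density_char_comparison[OF tilted_real_distribution[OF t w0] char_normal_density(1)[of "sqrt V"]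
         tilted_density[OF t, of w, folded f_def] measf contf _ refl _ contn _ diff])
      (use V t p_nonneg hB in \<open>auto simp: f_def has_bochner_integral_iff\<close>)
  also have "(\<integral>\<xi>. B \<xi> \<partial>lborel) = saddle_level / (V * w)"
    using hB by (simp add: has_bochner_integral_iff)
  finally have f0: "normal_density 0 (sqrt V) 0 - saddle_level / (V * w) / (2 * pi) \<le> f 0" by linarith
  have sw: "saddle_level \<le> sqrt V * w"
  proof (rule power2_le_imp_le)
    show "saddle_level\<^sup>2 \<le> (sqrt V * w)\<^sup>2" using large V by (simp add: power_mult_distrib V_def mult_ac)
  qed (use V w0 in auto)
  have "saddle_level / (V * w) \<le> sqrt V * w / (V * w)"
    using sw V w0 by (intro divide_right_mono) auto
  also have "\<dots> = 1 / sqrt V"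
    using w0 V sq by (simp add: field_simps power2_eq_square)
  finally have e1: "saddle_level / (V * w) / (2 * pi) \<le> 1 / sqrt V / (2 * pi)"
    by (intro divide_right_mono) auto
  have e2: "normal_density 0 (sqrt V) 0 = 1 / sqrt V / sqrt (2 * pi)"
    using V by (simp add: normal_density_def real_sqrt_mult)
  have s2pi: "2 \<le> sqrt (2 * pi)" "sqrt (2 * pi) \<le> 3"
    using pi_gt3 pi_less_4 by (auto intro!: real_le_rsqrt real_le_lsqrt simp: power2_eq_square)
  have "1 / 6 \<le> 1 / sqrt (2 * pi) - 1 / (2 * pi)"
  proof -
    define r where "r = 1 / sqrt (2 * pi)"
    have r: "1 / 3 \<le> r" "r \<le> 1 / 2" using s2pi by (auto simp: r_def field_simps)
    have "1 / (2 * pi) = r * r" by (simp add: r_def)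
    moreover have "r * r \<le> r * (1 / 2)" using r by (intro mult_left_mono) auto
    ultimately show ?thesis using r unfolding r_def[symmetric] by linarith
  qed
  then have "1 / sqrt V * (1 / 6) \<le> 1 / sqrt V * (1 / sqrt (2 * pi) - 1 / (2 * pi))"
    using V by (intro mult_left_mono) auto
  also have "\<dots> = 1 / sqrt V / sqrt (2 * pi) - 1 / sqrt V / (2 * pi)"
    by (simp add: right_diff_distrib)
  finally have "1 / (6 * sqrt V) \<le> f 0" using f0 e1 e2 by simp
  then have "exp (- t * legendre w) * (1 / (6 * sqrt V)) \<le> exp (- t * legendre w) * f 0" by (intro mult_left_mono) auto
  also have "\<dots> = p t (- t * phi1 w)" by (simp add: f_def mult.assoc[symmetric] exp_add[symmetric])
  finally show ?thesis by (simp add: V_def)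
qed

end

section \<open>Mass to the right of the mean\<close>

text \<open>The point of this bound is its uniformity: it is positive and depends on the law through the
  variance \<open>m\<close> and a bound \<open>E\<close> for an exponential moment only.\<close>

definition upper_tail_bound :: "real \<Rightarrow> real \<Rightarrow> real \<Rightarrow> real" where
  "upper_tail_bound a m E = (let d = a * (m - a\<^sup>2) in d / (8 * (3072 * E / d) ^ 3))"

lemma upper_tail_bound_pos: "0 < a \<Longrightarrow> a\<^sup>2 < m \<Longrightarrow> 0 < E \<Longrightarrow> 0 < upper_tail_bound a m E"
  by (simp add: upper_tail_bound_def Let_def)

text \<open>The cubic \<open>(u - a) * (u + a)\<^sup>2\<close> is nonpositive for \<open>u \<le> a\<close>. For a centred variable with nonnegative
  third moment its expectation is at least \<open>a * (m - a\<^sup>2) > 0\<close>, so the event \<open>u > a\<close> must carry that much of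
  it; the exponential moment prevents this from being due to large values on a small event.\<close>

lemma upper_tail_lower_bound:
  fixes Y :: "'a \<Rightarrow> real"
  assumes "prob_space Q" and Y[measurable]: "Y \<in> borel_measurable Q"
    and int: "integrable Q Y" "integrable Q (\<lambda>\<omega>. (Y \<omega>)\<^sup>2)" "integrable Q (\<lambda>\<omega>. (Y \<omega>) ^ 3)"
      "integrable Q (\<lambda>\<omega>. exp (Y \<omega> / 2))"
    and mean: "(\<integral>\<omega>. Y \<omega> \<partial>Q) = 0" and var: "(\<integral>\<omega>. (Y \<omega>)\<^sup>2 \<partial>Q) = m"
    and skew: "0 \<le> (\<integral>\<omega>. (Y \<omega>) ^ 3 \<partial>Q)"
    and expo: "(\<integral>\<omega>. exp (Y \<omega> / 2) \<partial>Q) \<le> E"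
    and a: "0 < a" "a\<^sup>2 < m"
  shows "upper_tail_bound a m E \<le> measure Q {\<omega> \<in> space Q. a < Y \<omega>}"
proof -
  interpret prob_space Q by (rule assms)
  define d where "d = a * (m - a\<^sup>2)"
  have d: "0 < d" using a by (simp add: d_def)
  have E: "0 < E"
  proof -
    have "(\<integral>\<omega>. 0 \<partial>Q) < (\<integral>\<omega>. exp (Y \<omega> / 2) \<partial>Q)"
      by (rule integral_less_AE_space) (use int emeasure_space_1 in auto)
    then show ?thesis using expo by simp
  qed
  \<comment> \<open>Values above \<open>R\<close> contribute at most \<open>d / 2\<close>: \<open>u ^ 4 \<le> 384 * exp (u / 2)\<close>, and \<open>4 * 384 * E / R = d / 2\<close>.\<close>
  define R where "R = 3072 * E / d"
  have R: "0 < R" using d E by (simp add: R_def)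
  let ?A = "{\<omega> \<in> space Q. a < Y \<omega>}"
  have A[measurable]: "?A \<in> sets Q" by measurable
  have intA: "integrable Q (\<lambda>\<omega>. indicator ?A \<omega> :: real)" by (rule integrable_real_indicator) (auto simp: emeasure_eq_measure)
  have le: "(Y \<omega>) ^ 3 + a * (Y \<omega>)\<^sup>2 - a\<^sup>2 * Y \<omega> - a ^ 3 \<le>
      4 * R ^ 3 * indicator ?A \<omega> + 1536 / R * exp (Y \<omega> / 2)" if \<omega>: "\<omega> \<in> space Q" for \<omega>
  proof -
    define y where "y = Y \<omega>"
    have q: "y ^ 3 + a * y\<^sup>2 - a\<^sup>2 * y - a ^ 3 = (y - a) * (y + a)\<^sup>2"
      by (simp add: power2_eq_square power3_eq_cube algebra_simps)
    have pos: "0 \<le> 1536 / R * exp (y / 2)" using R by simp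
    show ?thesis
    proof (cases "a < y")
      case False
      then have "(y - a) * (y + a)\<^sup>2 \<le> 0" by (intro mult_nonpos_nonneg) auto
      moreover have "0 \<le> 4 * R ^ 3 * indicator ?A \<omega>" using R by simp
      ultimately show ?thesis using pos q unfolding y_def by linarith
    next
      case True
      then have ind: "indicator ?A \<omega> = (1::real)" using \<omega> by (simp add: y_def)
      have y0: "0 < y" using True a by linarith
      have "(y - a) * (y + a)\<^sup>2 \<le> y * (2 * y)\<^sup>2"
        using True a by (intro mult_mono power_mono) auto
      also have "\<dots> = 4 * y ^ 3" by (simp add: power2_eq_square power3_eq_cube)
      also have "4 * y ^ 3 \<le> 4 * R ^ 3 + 1536 / R * exp (y / 2)"
      proof (cases "y \<le> R")
        case True
        then have "y ^ 3 \<le> R ^ 3" using y0 by (intro power_mono) auto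
        then show ?thesis using pos by linarith
      next
        case False
        have "y ^ 3 * R \<le> y ^ 3 * y" using False y0 by (intro mult_left_mono) auto
        also have "\<dots> = y ^ 4" by (simp add: eval_nat_numeral)
        also have "y ^ 4 \<le> 384 * exp (y / 2)"
          using power_mult_exp_bound[of y "1/2" 4] y0
          by (simp add: exp_minus divide_simps fact_numeral)
        finally have "4 * y ^ 3 \<le> 1536 / R * exp (y / 2)" using R by (simp add: field_simps)
        moreover have "0 \<le> 4 * R ^ 3" using R by simp
        ultimately show ?thesis by linarith
      qed
      finally show ?thesis using q ind by (simp add: y_def)
    qed
  qed
  have "d \<le> (\<integral>\<omega>. (Y \<omega>) ^ 3 + a * (Y \<omega>)\<^sup>2 - a\<^sup>2 * Y \<omega> - a ^ 3 \<partial>Q)"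
    using int mean var skew by (simp add: prob_space d_def algebra_simps power2_eq_square power3_eq_cube)
  also have "\<dots> \<le> (\<integral>\<omega>. 4 * R ^ 3 * indicator ?A \<omega> + 1536 / R * exp (Y \<omega> / 2) \<partial>Q)"
    by (rule integral_mono) (use int intA le in auto)
  also have "\<dots> = 4 * R ^ 3 * measure Q ?A + 1536 / R * (\<integral>\<omega>. exp (Y \<omega> / 2) \<partial>Q)"
    using int intA by simp
  also have "\<dots> \<le> 4 * R ^ 3 * measure Q ?A + 1536 / R * E"
    using R expo by (intro add_left_mono mult_left_mono) auto
  also have "1536 / R * E = d / 2" using d E by (simp add: R_def)
  finally have "d / 2 \<le> 4 * R ^ 3 * measure Q ?A" by linarith
  then have "d / (8 * R ^ 3) \<le> measure Q ?A" using R by (simp add: field_simps)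
  then show ?thesis by (simp add: upper_tail_bound_def Let_def R_def d_def)
qed

context levy_semigroup begin

lemma centred_exp_integrable:
  assumes t: "0 < t" and u: "0 < u"
  shows "integrable (centred t w) (\<lambda>y. exp (- u * y))"
  using centred_real_laplace[OF t u] by (simp add: has_bochner_integral_iff)

text \<open>The Laplace transform of the centred law is \<open>G\<close> with \<open>G' = (t * phi1C - m) * G\<close>, and the bracket vanishes at
  \<open>w\<close>. Hence the third derivative at \<open>w\<close> reduces to the third derivative of the exponent, whose sign is
  fixed by the positivity of the jumps.\<close>

lemma centred_moments:
  assumes t: "0 < t" and w: "0 < w"
  shows "integrable (centred t w) (\<lambda>y. y ^ k * exp (- w * y))"
    and "(\<integral>y. y * exp (- w * y) \<partial>centred t w) = 0"
    and "(\<integral>y. y\<^sup>2 * exp (- w * y) \<partial>centred t w) = t * phi2 w * exp (- t * legendre w)"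
    and "(\<integral>y. y ^ 3 * exp (- w * y) \<partial>centred t w) = t * phi3 w * exp (- t * legendre w)"
proof -
  let ?H = "{z. 0 < Re z}"
  define I where "I k z = (\<integral>y. (- of_real y) ^ k * exp (- z * of_real y) \<partial>centred t w :: complex)" for k z
  define m where "m = complex_of_real (t * phi1 w)"
  define G where "G z = exp (of_real t * phiC z - z * m)" for z
  have dI: "(I k has_field_derivative I (Suc k) z) (at z)" if "0 < Re z" for k z
    unfolding I_def [abs_def]
    by (rule laplace_transform_derivative(2)[OF sets_centred _ that]) (rule centred_exp_integrable[OF t])
  have openH: "open ?H" by (rule open_halfspace_Re_gt)
  have I0: "I 0 z = G z" if "0 < Re z" for z
    using centred_laplace[OF t that, of w] by (simp add: I_def G_def m_def)
  have dG: "(G has_field_derivative (of_real t * phi1C z - m) * G z) (at z)" if "0 < Re z" for z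
    unfolding G_def [abs_def] using phiC_derivs(1)[OF that] by (auto intro!: derivative_eq_intros)
  have eqI: "I (Suc k) z = g'" if z: "0 < Re z" and eq: "\<And>v. 0 < Re v \<Longrightarrow> I k v = g v"
    and g: "(g has_field_derivative g') (at z)" for k z g g'
  proof -
    have "(g has_field_derivative I (Suc k) z) (at z)"
      by (rule has_field_derivative_transform_within_open[OF dI[OF z] openH]) (use z eq in auto)
    from DERIV_unique[OF this g] show ?thesis .
  qed
  have I1: "I 1 z = (of_real t * phi1C z - m) * G z" if "0 < Re z" for z
    using eqI[OF that I0 dG[OF that]] by simp
  have I2: "I 2 z = of_real t * phi2C z * G z + (of_real t * phi1C z - m)\<^sup>2 * G z" if z: "0 < Re z" for z
  proof -
    have "((\<lambda>z. (of_real t * phi1C z - m) * G z) has_field_derivative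
        of_real t * phi2C z * G z + (of_real t * phi1C z - m)\<^sup>2 * G z) (at z)"
      using phiC_derivs(2)[OF z] dG[OF z] by (auto intro!: derivative_eq_intros simp: power2_eq_square algebra_simps)
    from eqI[OF z I1 this] show ?thesis by (simp add: numeral_2_eq_2)
  qed
  have m0: "of_real t * phi1C (of_real w) - m = 0" by (simp add: m_def phiC_of_real)
  have wH: "0 < Re (complex_of_real w)" using w by simp
  have I3: "I 3 (of_real w) = of_real t * phi3C (of_real w) * G (of_real w)"
  proof -
    have "((\<lambda>z. of_real t * phi2C z * G z + (of_real t * phi1C z - m)\<^sup>2 * G z) has_field_derivative
        of_real t * phi3C (of_real w) * G (of_real w)) (at (of_real w))"
      using phiC_derivs(2,3)[OF wH] dG[OF wH] m0 by (auto intro!: derivative_eq_intros)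
    from eqI[OF wH I2 this] show ?thesis by (simp add: numeral_3_eq_3)
  qed
  have Gw: "G (of_real w) = of_real (exp (- t * legendre w))"
    by (simp add: G_def m_def phiC_of_real exp_of_real[symmetric] legendre_def algebra_simps)
  have Ireal: "I k (of_real w) = of_real ((- 1) ^ k * (\<integral>y. y ^ k * exp (- w * y) \<partial>centred t w))" for k
  proof -
    have "I k (of_real w) = (\<integral>y. complex_of_real ((- 1) ^ k * (y ^ k * exp (- w * y))) \<partial>centred t w)"
      unfolding I_def by (rule Bochner_Integration.integral_cong)
        (auto simp: exp_of_real_mult power_minus[of "complex_of_real _"])
    also have "\<dots> = of_real (\<integral>y. (- 1) ^ k * (y ^ k * exp (- w * y)) \<partial>centred t w)"
      by (simp only: integral_complex_of_real)
    finally show ?thesis by simp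
  qed
  show "integrable (centred t w) (\<lambda>y. y ^ k * exp (- w * y))"
  proof -
    have "integrable (centred t w) (\<lambda>y. norm ((- of_real y) ^ k * exp (- of_real w * of_real y) :: complex))"
      by (rule integrable_norm, rule laplace_transform_derivative(1)[OF sets_centred _ wH])
        (rule centred_exp_integrable[OF t])
    then show ?thesis
      by (rule Bochner_Integration.integrable_bound) (auto simp: norm_mult norm_power norm_exp_eq_Re abs_mult power_abs)
  qed
  show "(\<integral>y. y * exp (- w * y) \<partial>centred t w) = 0"
    using Ireal[of 1] I1[OF wH] m0 by simp
  have "complex_of_real (\<integral>y. y\<^sup>2 * exp (- w * y) \<partial>centred t w) = of_real (t * phi2 w * exp (- t * legendre w))"
    using Ireal[of 2] I2[OF wH, unfolded m0] unfolding Gw phiC_of_real by simp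
  then show "(\<integral>y. y\<^sup>2 * exp (- w * y) \<partial>centred t w) = t * phi2 w * exp (- t * legendre w)"
    by (simp only: of_real_eq_iff)
  have "complex_of_real (\<integral>y. y ^ 3 * exp (- w * y) \<partial>centred t w) = of_real (t * phi3 w * exp (- t * legendre w))"
    using Ireal[of 3] I3 unfolding Gw phiC_of_real by simp
  then show "(\<integral>y. y ^ 3 * exp (- w * y) \<partial>centred t w) = t * phi3 w * exp (- t * legendre w)"
    by (simp only: of_real_eq_iff)
qed

lemma exponent_half:
  assumes w: "2 * x\<^sub>0 < w"
  shows "phi (w / 2) - phi w + w / 2 * phi1 w \<le> w\<^sup>2 * phi2 w / (2 * c)"
proof -
  have w0: "0 < w" using w x0 by linarith
  have d: "(phi has_real_derivative phi1 u) (at u)" "(phi1 has_real_derivative phi2 u) (at u)" if "w / 2 \<le> u" for u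
    using that w0 by (auto intro!: phi_derivs)
  obtain z where z: "w / 2 < z" "z < w" "phi w - phi (w / 2) = (w - w / 2) * phi1 z"
    using MVT2[of "w / 2" w phi phi1] d w0 by auto
  obtain z' where z': "z < z'" "z' < w" "phi1 w - phi1 z = (w - z) * phi2 z'"
    using MVT2[of z w phi1 phi2] d z by (meson less_imp_le order_trans)
  have "phi2 z' \<le> 2 / c * phi2 w"
    using phi2_antimono[of "w / 2" z'] phi2_half[OF w] z z' w0 by simp
  then have "(w - z) * phi2 z' \<le> w / 2 * (2 / c * phi2 w)"
    using z w0 phi2_nonneg[of z'] by (intro mult_mono) auto
  then have "w / 2 * (phi1 w - phi1 z) \<le> w / 2 * (w / 2 * (2 / c * phi2 w))"
    unfolding z'(3) using w0 by (intro mult_left_mono) auto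
  also have "\<dots> = w\<^sup>2 * phi2 w / (2 * c)" using c by (simp add: power2_eq_square field_simps)
  finally show ?thesis using z(3) by (simp add: algebra_simps)
qed

text \<open>The tilted law, seen at scale \<open>1 / w\<close>, puts mass between \<open>a\<close> and \<open>b\<close>. Undoing the tilt costs at most
  the factor \<open>exp (- t * legendre w)\<close>, because the tilt penalises the right half-line.\<close>

lemma centred_window:
  assumes t: "0 < t" and w: "2 * x\<^sub>0 < w" and m: "m = t * (w\<^sup>2 * phi2 w)"
    and a: "0 < a" "a\<^sup>2 < m" and b: "a < b"
  shows "exp (- t * legendre w) * (upper_tail_bound a m (exp (m / (2 * c))) - m / b\<^sup>2)
    \<le> measure (centred t w) {a / w..b / w}"
proof -
  have w0: "0 < w" using w x0 by linarith
  interpret T: real_distribution "tilted t w" by (rule tilted_real_distribution[OF t w0])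
  have ce: "exp (- w * y + t * legendre w) *\<^sub>R (y ^ k :: real) = exp (t * legendre w) * (y ^ k * exp (- w * y))" for y k
    by (simp add: exp_add exp_diff exp_minus divide_inverse mult_ac)
  have int: "integrable (tilted t w) (\<lambda>y. y ^ k)" for k
  proof -
    have "integrable (centred t w) (\<lambda>y. exp (- w * y + t * legendre w) *\<^sub>R (y ^ k :: real))"
      unfolding ce by (intro integrable_mult_right centred_moments(1)[OF t w0])
    moreover have "(\<lambda>y::real. y ^ k) \<in> borel_measurable borel" by measurable
    ultimately show ?thesis by (simp only: integral_tilted(2))
  qed
  have mom: "(\<integral>y. y ^ k \<partial>tilted t w) = exp (t * legendre w) * (\<integral>y. y ^ k * exp (- w * y) \<partial>centred t w)" for k
    by (subst integral_tilted(1)) (simp_all only: ce integral_mult_right_zero, measurable)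
  have one: "exp (t * legendre w) * exp (- t * legendre w) = 1" by (simp add: exp_add[symmetric])
  have mean: "(\<integral>y. w * y \<partial>tilted t w) = 0"
    using mom[of 1] centred_moments(2)[OF t w0] by simp
  have var: "(\<integral>y. (w * y)\<^sup>2 \<partial>tilted t w) = m"
    using mom[of 2] centred_moments(3)[OF t w0] one by (simp add: power_mult_distrib m mult_ac)
  have skew: "0 \<le> (\<integral>y. (w * y) ^ 3 \<partial>tilted t w)"
    using mom[of 3] centred_moments(4)[OF t w0] w0 t phi3_nonneg[of w] by (simp add: power_mult_distrib)
  have hb: "has_bochner_integral (centred t w) (\<lambda>y. exp (t * legendre w) * exp (- (w / 2) * y))
     (exp (t * legendre w) * exp (t * phi (w / 2) - w / 2 * (t * phi1 w)))"
    by (rule has_bochner_integral_mult_right[OF centred_real_laplace[OF t]]) (use w0 in simp)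
  have ee: "exp (- w * y + t * legendre w) *\<^sub>R exp (w * y / 2) = exp (t * legendre w) * exp (- (w / 2) * y)" for y
    by (simp add: exp_add[symmetric])
  have intE: "integrable (tilted t w) (\<lambda>y. exp (w * y / 2))"
    by (subst integral_tilted(2)) (use hb in \<open>simp_all only: ee has_bochner_integral_iff, measurable\<close>)
  have "(\<integral>y. exp (w * y / 2) \<partial>tilted t w) = exp (t * legendre w) * exp (t * phi (w / 2) - w / 2 * (t * phi1 w))"
    by (subst integral_tilted(1)) (use hb in \<open>simp_all only: ee has_bochner_integral_iff, measurable\<close>)
  also have "\<dots> = exp (t * (phi (w / 2) - phi w + w / 2 * phi1 w))"
    by (simp add: exp_add[symmetric] legendre_def algebra_simps)
  also have "\<dots> \<le> exp (m / (2 * c))"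
    using mult_left_mono[OF exponent_half[OF w], of t] t by (simp add: m)
  finally have expo: "(\<integral>y. exp (w * y / 2) \<partial>tilted t w) \<le> exp (m / (2 * c))" .
  have intp: "integrable (tilted t w) (\<lambda>y. w * y)" "integrable (tilted t w) (\<lambda>y. (w * y)\<^sup>2)"
    "integrable (tilted t w) (\<lambda>y. (w * y) ^ 3)"
    using int[of 1] int[of 2] int[of 3] by (auto simp: power_mult_distrib)
  have lower: "upper_tail_bound a m (exp (m / (2 * c))) \<le> T.prob {y \<in> space (tilted t w). a < w * y}"
    by (rule upper_tail_lower_bound[OF T.prob_space_axioms _ intp intE mean var skew expo a]) simp
  have b0: "0 < b" using a b by linarith
  have upper: "T.prob {y \<in> space (tilted t w). b < w * y} \<le> m / b\<^sup>2"
  proof -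
    have "T.prob {y \<in> space (tilted t w). b\<^sup>2 \<le> (w * y)\<^sup>2} \<le> (\<integral>y. (w * y)\<^sup>2 \<partial>tilted t w) / b\<^sup>2"
      by (rule integral_Markov_inequality_measure[OF intp(2), of UNIV]) (use b0 in auto)
    moreover have "T.prob {y \<in> space (tilted t w). b < w * y} \<le> T.prob {y \<in> space (tilted t w). b\<^sup>2 \<le> (w * y)\<^sup>2}"
      by (rule T.finite_measure_mono) (use b0 in \<open>auto intro!: power_mono\<close>)
    ultimately show ?thesis using var by simp
  qed
  have "{y \<in> space (tilted t w). a < w * y} \<subseteq> {a / w..b / w} \<union> {y \<in> space (tilted t w). b < w * y}"
    using w0 by (auto simp: field_simps)
  then have "T.prob {y \<in> space (tilted t w). a < w * y} \<le> T.prob ({a / w..b / w} \<union> {y \<in> space (tilted t w). b < w * y})"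
    by (rule T.finite_measure_mono) simp
  also have "\<dots> \<le> T.prob {a / w..b / w} + T.prob {y \<in> space (tilted t w). b < w * y}"
    by (rule measure_Un_le) simp_all
  finally have win: "upper_tail_bound a m (exp (m / (2 * c))) - m / b\<^sup>2 \<le> T.prob {a / w..b / w}"
    using lower upper by linarith
  interpret C: finite_measure "centred t w"
    unfolding centred_def using distribution[OF t]
    by (intro finite_measure.finite_measure_distr) (auto simp: measurable_mu[OF t] real_distribution_def prob_space_def)
  have "emeasure (tilted t w) {a / w..b / w} =
      (\<integral>\<^sup>+y. ennreal (exp (- w * y + t * legendre w)) * indicator {a / w..b / w} y \<partial>centred t w)"
    unfolding tilted_def by (rule emeasure_density) auto
  also have "\<dots> \<le> (\<integral>\<^sup>+y. ennreal (exp (t * legendre w)) * indicator {a / w..b / w} y \<partial>centred t w)"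
  proof (rule nn_integral_mono)
    fix y
    show "ennreal (exp (- w * y + t * legendre w)) * indicator {a / w..b / w} y \<le> ennreal (exp (t * legendre w)) * indicator {a / w..b / w} y"
    proof (cases "y \<in> {a / w..b / w}")
      case True
      have "0 < a / w" using a w0 by simp
      then have "0 \<le> y" using True by simp
      then have "0 \<le> w * y" using w0 by simp
      then show ?thesis using True by (simp add: ennreal_leI)
    qed simp
  qed
  also have "\<dots> = ennreal (exp (t * legendre w) * measure (centred t w) {a / w..b / w})"
    by (simp add: nn_integral_cmult_indicator C.emeasure_eq_measure ennreal_mult)
  finally have "T.prob {a / w..b / w} \<le> exp (t * legendre w) * measure (centred t w) {a / w..b / w}"
    by (simp add: T.emeasure_eq_measure)
  then have "exp (- t * legendre w) * T.prob {a / w..b / w} \<le> exp (- t * legendre w) * (exp (t * legendre w) * measure (centred t w) {a / w..b / w})"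
    by (intro mult_left_mono) auto
  also have "\<dots> = measure (centred t w) {a / w..b / w}" by (simp add: mult.assoc[symmetric] exp_add[symmetric])
  finally have *: "exp (- t * legendre w) * T.prob {a / w..b / w} \<le> measure (centred t w) {a / w..b / w}" .
  show ?thesis
    by (rule order_trans[OF mult_left_mono[OF win] *]) simp
qed

end

section \<open>Lower bounds for the density around the saddle point\<close>

context levy_semigroup begin

lemma finite_mu: "0 < t \<Longrightarrow> finite_measure (\<mu> t)"
  using distribution[of t] by (simp add: real_distribution_def prob_space_def)

lemma emeasure_add:
  assumes s: "0 < s" and r: "0 < r" and A: "A \<in> sets borel"
  shows "emeasure (\<mu> (r + s)) A = (\<integral>\<^sup>+z. \<integral>\<^sup>+y. indicator A (z + y) \<partial>\<mu> s \<partial>\<mu> r)"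
  unfolding convolution[OF r s]
  by (rule convolution_emeasure'[OF A finite_mu[OF r] finite_mu[OF s] sets_mu[OF s] sets_mu[OF r]])

lemma interval_measure_add:
  assumes s: "0 < s" and r: "0 < r"
  shows "measure (\<mu> s) {a..b} * measure (\<mu> r) {a'..b'} \<le> measure (\<mu> (r + s)) {a' + a..b' + b}"
proof -
  interpret S: finite_measure "\<mu> s" by (rule finite_mu[OF s])
  interpret R: finite_measure "\<mu> r" by (rule finite_mu[OF r])
  interpret SR: finite_measure "\<mu> (r + s)" by (rule finite_mu) (use s r in simp)
  have ab[simp]: "{a..b} \<in> sets (\<mu> s)" "{a'..b'} \<in> sets (\<mu> r)" using sets_mu s r by auto
  have "ennreal (measure (\<mu> s) {a..b} * measure (\<mu> r) {a'..b'}) =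
      (\<integral>\<^sup>+z. emeasure (\<mu> s) {a..b} * indicator {a'..b'} z \<partial>\<mu> r)"
    by (simp add: nn_integral_cmult_indicator S.emeasure_eq_measure R.emeasure_eq_measure ennreal_mult)
  also have "\<dots> = (\<integral>\<^sup>+z. \<integral>\<^sup>+y. indicator {a'..b'} z * indicator {a..b} y \<partial>\<mu> s \<partial>\<mu> r)"
    by (rule nn_integral_cong, subst nn_integral_cmult_indicator[OF ab(1)], rule mult.commute)
  also have "\<dots> \<le> (\<integral>\<^sup>+z. \<integral>\<^sup>+y. indicator {a' + a..b' + b} (z + y) \<partial>\<mu> s \<partial>\<mu> r)"
    by (intro nn_integral_mono) (auto simp: indicator_def)
  also have "\<dots> = ennreal (measure (\<mu> (r + s)) {a' + a..b' + b})"
    by (subst emeasure_add[OF s r, symmetric]) (auto simp: SR.emeasure_eq_measure)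
  finally show ?thesis by (subst (asm) ennreal_le_iff) auto
qed

lemma measure_centred:
  assumes t: "0 < t"
  shows "measure (centred t w) {a..b} = measure (\<mu> t) {a - t * phi1 w..b - t * phi1 w}"
proof -
  have "space (\<mu> t) = UNIV" using sets_eq_imp_space_eq[OF sets_mu[OF t]] by simp
  then show ?thesis
    unfolding centred_def
    by (subst measure_distr) (auto simp: measurable_mu[OF t] intro!: arg_cong[where f = "measure (\<mu> t)"])
qed

lemma centred_window_power:
  assumes r: "0 < r"
  shows "measure (centred r w) {a..b} ^ Suc n \<le>
    measure (centred (real (Suc n) * r) w) {real (Suc n) * a..real (Suc n) * b}"
proof (induction n)
  case (Suc n)
  let ?s = "real (Suc n) * r"
  have s: "0 < ?s" using r by simp
  have rs: "r + ?s = real (Suc (Suc n)) * r" by (simp add: algebra_simps)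
  have "measure (centred r w) {a..b} ^ Suc (Suc n) \<le>
     measure (centred ?s w) {real (Suc n) * a..real (Suc n) * b} * measure (centred r w) {a..b}"
    using mult_right_mono[OF Suc.IH, of "measure (centred r w) {a..b}"] by (simp add: mult_ac)
  also have "\<dots> \<le> measure (\<mu> (r + ?s)) {(a - r * phi1 w) + (real (Suc n) * a - ?s * phi1 w)..
      (b - r * phi1 w) + (real (Suc n) * b - ?s * phi1 w)}"
  proof -
    have e: "measure (centred ?s w) {real (Suc n) * a..real (Suc n) * b} =
        measure (\<mu> ?s) {real (Suc n) * a - ?s * phi1 w..real (Suc n) * b - ?s * phi1 w}"
      by (rule measure_centred[OF s])
    show ?thesis unfolding e measure_centred[OF r] by (rule interval_measure_add[OF s r])
  qed
  also have "\<dots> = measure (centred (r + ?s) w) {real (Suc (Suc n)) * a..real (Suc (Suc n)) * b}"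
    using r s by (subst measure_centred) (auto simp: algebra_simps intro!: arg_cong[where f = "measure _"])
  finally show ?case unfolding rs .
qed simp

text \<open>If the increment over time \<open>r\<close> carries \<open>x - y\<close> for some \<open>y\<close> well inside \<open>[l, u]\<close>, the density at time
  \<open>s\<close> around \<open>y\<close> is at least \<open>C\<close>. The margin \<open>h\<^sub>0\<close> leaves room for the intervals around \<open>x\<close> whose measures
  recover the continuous density.\<close>

lemma density_lower_bound_add:
  assumes s: "0 < s" and r: "0 < r" and C: "0 \<le> C" and h0: "0 < h\<^sub>0"
    and lower: "\<And>y. l \<le> y \<Longrightarrow> y \<le> u \<Longrightarrow> C \<le> p s y"
  shows "C * measure (\<mu> r) {x - u + h\<^sub>0..x - l - h\<^sub>0} \<le> p (r + s) x"
proof -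
  let ?W = "{x - u + h\<^sub>0..x - l - h\<^sub>0}"
  have rs: "0 < r + s" using r s by simp
  interpret R: finite_measure "\<mu> r" by (rule finite_mu[OF r])
  interpret RS: finite_measure "\<mu> (r + s)" by (rule finite_mu[OF rs])
  have W[simp]: "?W \<in> sets (\<mu> r)" using sets_mu[OF r] by simp
  have le: "C * measure (\<mu> r) ?W \<le> measure (\<mu> (r + s)) {x - h<..x + h} / (2 * h)" if h: "0 < h" "h < h\<^sub>0" for h
  proof -
    have inner: "ennreal (C * (2 * h)) * indicator ?W z \<le> (\<integral>\<^sup>+y. indicator {x - h<..x + h} (z + y) \<partial>\<mu> s)" for z
    proof (cases "z \<in> ?W")
      case True
      have "ennreal (C * (2 * h)) = (\<integral>\<^sup>+y. ennreal C * indicator {x - h - z<..x + h - z} y \<partial>lborel)"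
        using h C by (simp add: nn_integral_cmult_indicator ennreal_mult)
      also have "\<dots> \<le> (\<integral>\<^sup>+y. ennreal (p s y) * indicator {x - h<..x + h} (z + y) \<partial>lborel)"
      proof (rule nn_integral_mono)
        fix y :: real
        show "ennreal C * indicator {x - h - z<..x + h - z} y \<le> ennreal (p s y) * indicator {x - h<..x + h} (z + y)"
        proof (cases "y \<in> {x - h - z<..x + h - z}")
          case True
          have "C \<le> p s y" by (rule lower) (use True \<open>z \<in> ?W\<close> h in auto)
          moreover have "z + y \<in> {x - h<..x + h}" using True by auto
          ultimately show ?thesis by (auto intro: ennreal_leI simp: indicator_def)
        qed simp
      qed
      also have "\<dots> = (\<integral>\<^sup>+y. indicator {x - h<..x + h} (z + y) \<partial>\<mu> s)"
        unfolding density[OF s] using p_measurable[OF s] by (subst nn_integral_density) auto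
      finally show ?thesis using True by simp
    qed simp
    have "ennreal (C * (2 * h) * measure (\<mu> r) ?W) = (\<integral>\<^sup>+z. ennreal (C * (2 * h)) * indicator ?W z \<partial>\<mu> r)"
      using C h by (simp add: nn_integral_cmult_indicator R.emeasure_eq_measure ennreal_mult)
    also have "\<dots> \<le> (\<integral>\<^sup>+z. \<integral>\<^sup>+y. indicator {x - h<..x + h} (z + y) \<partial>\<mu> s \<partial>\<mu> r)"
      by (rule nn_integral_mono) (rule inner)
    also have "\<dots> = ennreal (measure (\<mu> (r + s)) {x - h<..x + h})"
      by (subst emeasure_add[OF s r, symmetric]) (auto simp: RS.emeasure_eq_measure)
    finally have "C * (2 * h) * measure (\<mu> r) ?W \<le> measure (\<mu> (r + s)) {x - h<..x + h}"
      by (subst (asm) ennreal_le_iff) auto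
    then show ?thesis using h by (simp add: pos_le_divide_eq mult_ac)
  qed
  have cont: "isCont (p (r + s)) x"
    using p_cont[OF rs] by (simp add: continuous_on_eq_continuous_at)
  have lim: "((\<lambda>h. measure (\<mu> (r + s)) {x - h<..x + h} / (2 * h)) \<longlongrightarrow> max 0 (p (r + s) x)) (at_right 0)"
    by (rule interval_measure_tendsto_density[OF RS.finite_measure_axioms density[OF rs] p_measurable[OF rs] cont])
  have "C * measure (\<mu> r) ?W \<le> max 0 (p (r + s) x)"
  proof (rule tendsto_lowerbound[OF lim])
    show "\<forall>\<^sub>F h in at_right 0. C * measure (\<mu> r) ?W \<le> measure (\<mu> (r + s)) {x - h<..x + h} / (2 * h)"
      unfolding eventually_at_right_field using h0 le by blast
  qed simp
  then show ?thesis using p_nonneg[OF rs, of x] by simp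
qed

text \<open>A point to the left of the mean is the mean of a law tilted by a larger parameter \<open>v\<close>, which the
  logarithmic growth of \<open>phi1\<close> keeps below \<open>exp (B / (c * m)) * w\<close>.\<close>

lemma lower_bound_left:
  assumes t: "0 < t" and w: "2 * x\<^sub>0 < w" and m: "t * (w\<^sup>2 * phi2 w) = m" "saddle_level\<^sup>2 \<le> c * m"
    and E: "t * legendre x\<^sub>0 \<le> E" and B: "0 \<le> B"
    and x: "- t * phi1 w - B / w \<le> x" "x \<le> - t * phi1 w"
  shows "exp (- (E + (exp (B / (c * m)))\<^sup>2 * m / c)) / (6 * sqrt m) * w \<le> p t x"
proof -
  have w0: "0 < w" and xw: "x\<^sub>0 < w" using w x0 by linarith+
  have m0: "0 < m" using m(1) t w0 phi2_pos[OF w0] by auto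
  define L where "L = exp (B / (c * m))"
  have L: "1 \<le> L" using B c m0 by (simp add: L_def)
  have wL: "w \<le> L * w" using L w0 by simp
  have "c * (w * phi2 w) * ln (L * w / w) \<le> phi1 (L * w) - phi1 w"
    by (rule phi1_growth[OF xw wL])
  moreover have "c * (w * phi2 w) * ln (L * w / w) = B / (t * w)"
    using w0 c m0 t phi2_pos[OF w0] unfolding m(1)[symmetric] L_def by (simp add: field_simps power2_eq_square)
  ultimately have growth: "phi1 w + B / (t * w) \<le> phi1 (L * w)" by linarith
  have contphi1: "continuous_on {w..L * w} phi1"
    by (intro continuous_at_imp_continuous_on ballI, rule DERIV_isCont[OF phi_derivs(2)]) (use w0 in auto)
  have lo: "phi1 w \<le> - x / t" using x(2) t by (simp add: field_simps)
  have "- x / t \<le> phi1 w + B / (t * w)" using x(1) t w0 by (simp add: field_simps)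
  then have hi: "- x / t \<le> phi1 (L * w)" using growth by linarith
  obtain v where v: "w \<le> v" "v \<le> L * w" "phi1 v = - x / t"
    using IVT'[OF lo hi wL contphi1] by blast
  have v0: "0 < v" and xv: "2 * x\<^sub>0 < v" using v w0 w by linarith+
  have xeq: "- t * phi1 v = x" using v(3) t by simp
  have "c * (w * phi2 w) \<le> v * phi2 v" by (rule scaling[OF xw v(1)])
  then have "w * (c * (w * phi2 w)) \<le> v * (v * phi2 v)"
    by (rule mult_mono[OF v(1)]) (use v w0 c phi2_nonneg[of w] in auto)
  then have "t * (w * (c * (w * phi2 w))) \<le> t * (v * (v * phi2 v))" using t by (intro mult_left_mono) auto
  then have "c * m \<le> t * (v\<^sup>2 * phi2 v)"
    unfolding m(1)[symmetric] by (simp add: power2_eq_square mult_ac)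
  then have large: "saddle_level\<^sup>2 \<le> t * (v\<^sup>2 * phi2 v)" using m(2) by linarith
  have anti: "phi2 v \<le> phi2 w" by (rule phi2_antimono[OF w0 v(1)])
  have Dv: "t * legendre v \<le> E + L\<^sup>2 * m / c"
  proof -
    have "v\<^sup>2 * phi2 v \<le> (L * w)\<^sup>2 * phi2 w"
      using v v0 anti phi2_nonneg[of v] by (intro mult_mono power_mono) auto
    then have "t * (v\<^sup>2 * phi2 v / c) \<le> t * ((L * w)\<^sup>2 * phi2 w / c)"
      using t c by (intro mult_left_mono divide_right_mono) auto
    also have "\<dots> = L\<^sup>2 * m / c" unfolding m(1)[symmetric] by (simp add: power_mult_distrib)
    finally have "t * (v\<^sup>2 * phi2 v / c) \<le> L\<^sup>2 * m / c" .
    moreover have "t * legendre v \<le> t * (legendre x\<^sub>0 + v\<^sup>2 * phi2 v / c)"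
      using t xw v by (intro mult_left_mono legendre_le) auto
    ultimately show ?thesis using E by (simp add: distrib_left)
  qed
  have sq: "sqrt (t * phi2 v) \<le> sqrt m / w"
  proof -
    have "t * phi2 v \<le> t * phi2 w" using anti t by simp
    also have "\<dots> = m / w\<^sup>2" unfolding m(1)[symmetric] using w0 by simp
    finally have "sqrt (t * phi2 v) \<le> sqrt (m / w\<^sup>2)" by simp
    then show ?thesis using w0 by (simp add: real_sqrt_divide)
  qed
  have "exp (- (E + L\<^sup>2 * m / c)) / (6 * sqrt m) * w = exp (- (E + L\<^sup>2 * m / c)) / (6 * (sqrt m / w))"
    using w0 by simp
  also have "\<dots> \<le> exp (- t * legendre v) / (6 * sqrt (t * phi2 v))"
    using Dv sq t phi2_pos[OF v0] by (intro frac_le) auto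
  also have "\<dots> \<le> p t (- t * phi1 v)" by (rule saddle_point_lower_bound[OF t xv large])
  finally show ?thesis unfolding xeq L_def .
qed

text \<open>The constant depends on \<open>m\<close>, \<open>\<rho>\<close> and \<open>E\<close> only, not on \<open>t\<close> and \<open>w\<close>. On the left of the mean this is the
  previous lemma; on the right, the increments over one half of the time supply the displacement.\<close>

lemma lower_bound_near_mean:
  assumes m: "0 < m" "2 * saddle_level\<^sup>2 \<le> c * m" and \<rho>: "0 < \<rho>" and E: "0 \<le> E"
  shows "\<exists>C>0. \<forall>t w x. 0 < t \<longrightarrow> 2 * x\<^sub>0 < w \<longrightarrow> t * (w\<^sup>2 * phi2 w) = m \<longrightarrow> t * legendre x\<^sub>0 \<le> E \<longrightarrow>
    - \<rho> / w \<le> x + t * phi1 w \<longrightarrow> x + t * phi1 w \<le> \<rho> / w \<longrightarrow> C * w \<le> p t x"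
proof -
  \<comment> \<open>The additional \<open>1\<close> here and in \<open>B\<close> is the margin required by the transport of density bounds.\<close>
  define A where "A = \<rho> + 1"
  \<comment> \<open>With \<open>Suc n\<close> pieces, the variance \<open>m / (2 * N)\<close> of a piece exceeds the square of the required move \<open>A / N\<close>.\<close>
  define n where "n = nat \<lceil>2 * A\<^sup>2 / m\<rceil>"
  define N where "N = real (Suc n)"
  have N: "1 \<le> N" "2 * A\<^sup>2 / m < N"
    unfolding N_def n_def using of_nat_ceiling[of "2 * A\<^sup>2 / m"] by linarith+
  define a where "a = A / N"
  define m' where "m' = m / (2 * N)"
  have a0: "0 < a" using N \<rho> by (simp add: a_def A_def)
  have "2 * A\<^sup>2 < N * m" using N(2) m(1) by (simp add: pos_divide_less_eq)
  then have am: "a\<^sup>2 < m'" using N(1) m(1)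
    by (simp add: a_def m'_def power_divide field_simps power2_eq_square)
  have m'0: "0 < m'" using m N by (simp add: m'_def)
  define \<epsilon> where "\<epsilon> = upper_tail_bound a m' (exp (m' / (2 * c)))"
  have \<epsilon>: "0 < \<epsilon>" unfolding \<epsilon>_def by (rule upper_tail_bound_pos[OF a0 am]) simp
  \<comment> \<open>Chebyshev's inequality beyond \<open>b\<close> removes at most half of the mass \<open>\<epsilon>\<close>.\<close>
  define b where "b = a + 1 + 2 * m' / \<epsilon>"
  have q0: "0 < 2 * m' / \<epsilon>" using m'0 \<epsilon> by simp
  have b: "a < b" "1 \<le> b" using a0 q0 by (auto simp: b_def)
  have mb: "m' / b\<^sup>2 \<le> \<epsilon> / 2"
  proof -
    have "2 * m' / \<epsilon> \<le> b" using a0 by (simp add: b_def)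
    also have "b \<le> b\<^sup>2" using b(2) by (simp add: power2_eq_square)
    finally have "2 * m' \<le> b\<^sup>2 * \<epsilon>" using \<epsilon> by (simp add: pos_divide_le_eq)
    then show ?thesis using b by (simp add: field_simps)
  qed
  define B where "B = N * b + 1"
  have B: "0 \<le> B" using N b by (simp add: B_def)
  define q where "q = exp (- (E + m / c)) * (\<epsilon> / 2)"
  have q: "0 < q" using \<epsilon> by (simp add: q_def)
  define C1 where "C1 = exp (- (E + (exp (\<rho> / (c * m)))\<^sup>2 * m / c)) / (6 * sqrt m)"
  define C2 where "C2 = exp (- (E + (exp (B / (c * (m / 2))))\<^sup>2 * (m / 2) / c)) / (6 * sqrt (m / 2))"
  have C12: "0 < C1" "0 < C2" using m by (auto simp: C1_def C2_def)
  define C where "C = min C1 (C2 * q ^ Suc n)"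
  have C: "0 < C" using C12 q by (simp add: C_def)
  show ?thesis
  proof (intro exI[of _ C] conjI allI impI)
    fix t w x
    assume t: "0 < t" and w: "2 * x\<^sub>0 < w" and tm: "t * (w\<^sup>2 * phi2 w) = m" and tE: "t * legendre x\<^sub>0 \<le> E"
      and xl: "- \<rho> / w \<le> x + t * phi1 w" and xu: "x + t * phi1 w \<le> \<rho> / w"
    have w0: "0 < w" and xw: "x\<^sub>0 < w" using w x0 by linarith+
    show "C * w \<le> p t x"
    proof (cases "x \<le> - t * phi1 w")
      case True
      have "C1 * w \<le> p t x" unfolding C1_def
      proof (rule lower_bound_left[OF t w tm _ tE])
        show "saddle_level\<^sup>2 \<le> c * m" using m(2) zero_le_power2[of saddle_level] by linarith
        show "- t * phi1 w - \<rho> / w \<le> x" using xl by simp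
      qed (use \<rho> True in simp_all)
      moreover have "C * w \<le> C1 * w" using w0 by (intro mult_right_mono) (auto simp: C_def)
      ultimately show ?thesis by linarith
    next
      case False
      define s where "s = t / 2"
      have s: "0 < s" "s + s = t" using t by (auto simp: s_def)
      define y where "y = w * (x + t * phi1 w)"
      have y: "0 \<le> y" "y \<le> \<rho>"
      proof -
        show "0 \<le> y" unfolding y_def using False w0 by (intro mult_nonneg_nonneg) auto
        show "y \<le> \<rho>" unfolding y_def using xu w0 by (simp add: field_simps)
      qed
      have xy: "x = - t * phi1 w + y / w" using w0 by (simp add: y_def)
      have sm: "s * (w\<^sup>2 * phi2 w) = m / 2" using tm by (simp add: s_def)
      have sE: "s * legendre x\<^sub>0 \<le> E"
      proof -
        have "s * legendre x\<^sub>0 \<le> t * legendre x\<^sub>0" using legendre_nonneg[OF x0] t by (intro mult_right_mono) (auto simp: s_def)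
        then show ?thesis using tE by linarith
      qed
      have lower: "C2 * w \<le> p s z" if "- s * phi1 w - B / w \<le> z" "z \<le> - s * phi1 w" for z
        unfolding C2_def by (rule lower_bound_left[OF s(1) w sm _ sE B that]) (use m in simp)
      define r where "r = s / N"
      have r: "0 < r" "N * r = s" using s N by (auto simp: r_def)
      have rm: "m' = r * (w\<^sup>2 * phi2 w)"
        using tm N by (simp add: r_def s_def m'_def)
      have Dr: "r * legendre w \<le> E + m / c"
      proof -
        have "r \<le> t" using N t s by (simp add: r_def s_def field_simps)
        then have "r * legendre w \<le> t * legendre w" using legendre_nonneg[of w] w0 by (intro mult_right_mono) auto
        also have "\<dots> \<le> t * (legendre x\<^sub>0 + w\<^sup>2 * phi2 w / c)" using t legendre_le[OF xw] by simp
        also have "\<dots> = t * legendre x\<^sub>0 + m / c" unfolding tm[symmetric] by (simp add: distrib_left)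
        finally show ?thesis using tE by linarith
      qed
      have "q \<le> exp (- r * legendre w) * (\<epsilon> - m' / b\<^sup>2)"
        unfolding q_def using Dr mb \<epsilon> by (intro mult_mono) auto
      also have "\<dots> \<le> measure (centred r w) {a / w..b / w}"
        unfolding \<epsilon>_def by (rule centred_window[OF r(1) w rm a0 am b(1)])
      finally have "q ^ Suc n \<le> measure (centred r w) {a / w..b / w} ^ Suc n"
        using q by (intro power_mono) auto
      also have "\<dots> \<le> measure (centred s w) {N * (a / w)..N * (b / w)}"
        using centred_window_power[OF r(1), of w "a / w" "b / w" n] unfolding N_def[symmetric] r(2) .
      also have "\<dots> = measure (\<mu> s) {A / w - s * phi1 w..N * b / w - s * phi1 w}"
        unfolding measure_centred[OF s(1)] using N by (simp add: a_def)
      also have "\<dots> \<le> measure (\<mu> s) {x - (- s * phi1 w) + 1 / w..x - (- s * phi1 w - B / w) - 1 / w}"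
      proof (rule finite_measure.finite_measure_mono[OF finite_mu[OF s(1)]])
        have "A / w - s * phi1 w \<ge> x - (- s * phi1 w) + 1 / w"
        proof -
          have "(y + 1) / w \<le> A / w" using y w0 by (intro divide_right_mono) (auto simp: A_def)
          then show ?thesis unfolding xy s(2)[symmetric] by (simp add: algebra_simps add_divide_distrib)
        qed
        moreover have "N * b / w - s * phi1 w \<le> x - (- s * phi1 w - B / w) - 1 / w"
        proof -
          have "N * b / w \<le> (y + B - 1) / w" using y w0 by (intro divide_right_mono) (auto simp: B_def)
          then show ?thesis unfolding xy s(2)[symmetric]
            by (simp add: algebra_simps add_divide_distrib diff_divide_distrib)
        qed
        ultimately show "{A / w - s * phi1 w..N * b / w - s * phi1 w} \<subseteq>
           {x - (- s * phi1 w) + 1 / w..x - (- s * phi1 w - B / w) - 1 / w}" by auto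
      qed (simp add: sets_mu[OF s(1)])
      finally have win: "q ^ Suc n \<le> measure (\<mu> s) {x - (- s * phi1 w) + 1 / w..x - (- s * phi1 w - B / w) - 1 / w}" .
      have "C * w \<le> C2 * q ^ Suc n * w" using w0 by (intro mult_right_mono) (auto simp: C_def)
      also have "\<dots> = C2 * w * q ^ Suc n" by simp
      also have "\<dots> \<le> C2 * w * measure (\<mu> s) {x - (- s * phi1 w) + 1 / w..x - (- s * phi1 w - B / w) - 1 / w}"
        using C12 w0 by (intro mult_left_mono win) auto
      also have "\<dots> \<le> p (s + s) x"
        by (rule density_lower_bound_add[OF s(1) s(1)]) (use C12 w0 lower in auto)
      finally show ?thesis unfolding s(2) .
    qed
  qed (rule C)
qed

end

section \<open>The generalised inverse of Phi\<close>

text \<open>The running supremum is continuous and reaches \<open>s\<close>; its last passage \<open>v\<close> through \<open>s\<close> is a point where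
  \<open>Phi \<phi>\<close> itself attains \<open>s\<close>, since the supremum increases immediately after \<open>v\<close>.\<close>

lemma Phi_inv_properties:
  assumes s: "0 < s"
    and cont: "continuous_on {0<..} (Phi \<phi>)"
    and zero: "(Phi \<phi> \<longlongrightarrow> 0) (at_right 0)"
    and bdd: "\<And>r. \<exists>K. \<forall>q\<in>{0<..r}. Phi \<phi> q \<le> K"
    and large: "0 < r\<^sub>1" "s < Phi \<phi> r\<^sub>1"
  shows "0 < Phi_inv \<phi> s" "Phi \<phi> (Phi_inv \<phi> s) = s"
    and "\<And>q. 0 < q \<Longrightarrow> q \<le> Phi_inv \<phi> s \<Longrightarrow> Phi \<phi> q \<le> s"
    and "\<And>r. 0 < r \<Longrightarrow> (\<And>q. 0 < q \<Longrightarrow> q \<le> r \<Longrightarrow> Phi \<phi> q \<le> s) \<Longrightarrow> r \<le> Phi_inv \<phi> s"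
proof -
  define A where "A = {r. 0 < r \<and> (\<forall>q\<in>{0<..r}. Phi \<phi> q \<le> s)}"
  have A_lt: "r < r\<^sub>1" if "r \<in> A" for r
  proof (rule ccontr)
    assume "\<not> r < r\<^sub>1"
    then show False using that large by (force simp: A_def)
  qed
  have bddA: "bdd_above A" using A_lt by (intro bdd_aboveI[of _ r\<^sub>1]) (auto intro: less_imp_le)
  have "eventually (\<lambda>q. Phi \<phi> q < s) (at_right 0)" using zero s by (rule order_tendstoD)
  then obtain d where d: "0 < d" "\<And>q. 0 < q \<Longrightarrow> q < d \<Longrightarrow> Phi \<phi> q < s"
    by (auto simp: eventually_at_right_field)
  have dA: "d / 2 \<in> A" using d by (auto simp: A_def intro!: less_imp_le)
  define v where "v = Sup A"
  have v: "0 < v"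
    using cSup_upper[OF dA bddA] d by (simp add: v_def)
  have below: "Phi \<phi> q < s \<or> Phi \<phi> q = s" if q: "0 < q" "q < v" for q
  proof -
    obtain r where "r \<in> A" "q < r" using q less_cSup_iff[of A q] bddA dA by (auto simp: v_def)
    then show ?thesis using q by (force simp: A_def)
  qed
  have contv: "isCont (Phi \<phi>) v"
    using cont v by (simp add: continuous_on_eq_continuous_at)
  have "Phi \<phi> v \<le> s"
  proof (rule ccontr)
    assume "\<not> Phi \<phi> v \<le> s"
    then have "eventually (\<lambda>q. s < Phi \<phi> q) (at v)"
      using contv by (intro order_tendstoD(1)[of _ "Phi \<phi> v"]) (auto simp: isCont_def)
    then have "eventually (\<lambda>q. s < Phi \<phi> q) (at_left v)" by (simp add: eventually_at_split)
    moreover have "eventually (\<lambda>q. q \<in> {0<..<v}) (at_left v)"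
      using v by (rule eventually_at_left_real)
    ultimately have "eventually (\<lambda>q. False) (at_left v)"
      by eventually_elim (use below in force)
    then show False by simp
  qed
  then have le: "Phi \<phi> q \<le> s" if "0 < q" "q \<le> v" for q
    using below[of q] that by (cases "q = v") auto
  have vA: "v \<in> A" using le v by (auto simp: A_def)
  have upper: "r \<le> v" if "r \<in> A" for r
    using cSup_upper[OF that bddA] by (simp add: v_def)
  have eq: "Phi \<phi> v = s"
  proof (rule ccontr)
    assume "Phi \<phi> v \<noteq> s"
    with le[of v] v have "Phi \<phi> v < s" by auto
    then have "eventually (\<lambda>q. Phi \<phi> q < s) (at v)"
      using contv by (intro order_tendstoD(2)[of _ "Phi \<phi> v"]) (auto simp: isCont_def)
    then have "eventually (\<lambda>q. Phi \<phi> q < s) (at_right v)" by (simp add: eventually_at_split)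
    then obtain e where e: "v < e" "\<And>q. v < q \<Longrightarrow> q < e \<Longrightarrow> Phi \<phi> q < s"
      by (auto simp: eventually_at_right_field)
    have "(v + e) / 2 \<in> A"
      unfolding A_def
    proof (safe)
      show "0 < (v + e) / 2" using e v by simp
      fix q assume "q \<in> {0<..(v + e) / 2}"
      then show "Phi \<phi> q \<le> s" using e(1) e(2)[of q] le[of q] by (cases "q \<le> v") auto
    qed
    then show False using upper e by force
  qed
  have star_v: "Phi_star \<phi> v = s"
    unfolding Phi_star_def
    by (rule cSup_eq_maximum) (use eq v le in \<open>auto intro!: image_eqI[of _ _ v]\<close>)
  have in_A: "r \<in> A" if "0 < r" "Phi_star \<phi> r = s" for r
  proof -
    obtain K where K: "\<forall>q\<in>{0<..r}. Phi \<phi> q \<le> K" using bdd by blast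
    have "Phi \<phi> q \<le> s" if "q \<in> {0<..r}" for q
      unfolding \<open>Phi_star \<phi> r = s\<close>[symmetric] Phi_star_def
      by (rule cSUP_upper[OF that]) (use K in \<open>auto intro!: bdd_aboveI\<close>)
    then show ?thesis using that by (auto simp: A_def)
  qed
  have inv: "Phi_inv \<phi> s = v"
    unfolding Phi_inv_def
    by (rule cSup_eq_maximum) (use star_v v in_A upper in auto)
  show "0 < Phi_inv \<phi> s" "Phi \<phi> (Phi_inv \<phi> s) = s" using inv v eq by auto
  show "\<And>q. 0 < q \<Longrightarrow> q \<le> Phi_inv \<phi> s \<Longrightarrow> Phi \<phi> q \<le> s" using inv le by auto
  show "\<And>r. 0 < r \<Longrightarrow> (\<And>q. 0 < q \<Longrightarrow> q \<le> r \<Longrightarrow> Phi \<phi> q \<le> s) \<Longrightarrow> r \<le> Phi_inv \<phi> s"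
    using upper inv by (auto simp: A_def)
qed

context levy_exponent begin

lemma deriv_exponent:
  assumes \<phi>: "\<And>u. 0 \<le> u \<Longrightarrow> \<phi> u = phi u" and u: "0 < u"
  shows "deriv \<phi> u = phi1 u" and "deriv (deriv \<phi>) u = phi2 u"
proof -
  have 1: "deriv \<phi> v = phi1 v" if v: "0 < v" for v
  proof (rule DERIV_imp_deriv)
    show "(\<phi> has_real_derivative phi1 v) (at v)"
      by (rule has_field_derivative_transform_within_open[OF phi_derivs(1)[OF v], of "{0<..}"])
        (use \<phi> v in auto)
  qed
  show "deriv \<phi> u = phi1 u" by (rule 1[OF u])
  show "deriv (deriv \<phi>) u = phi2 u"
  proof (rule DERIV_imp_deriv)
    show "(deriv \<phi> has_real_derivative phi2 u) (at u)"
      by (rule has_field_derivative_transform_within_open[OF phi_derivs(2)[OF u], of "{0<..}"])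
        (use 1 u in auto)
  qed
qed

lemma Phi_exponent:
  assumes "\<And>u. 0 \<le> u \<Longrightarrow> \<phi> u = phi u" "0 < u"
  shows "Phi \<phi> u = u\<^sup>2 * phi2 u"
  using deriv_exponent(2)[of \<phi> u] assms by (simp add: Phi_def)

lemma phi2_pos_of_unbounded_variation:
  assumes "(\<integral>\<^sup>+x\<in>{0<..<1}. ennreal x \<partial>\<nu>) = \<infinity>" and u: "0 < u"
  shows "0 < phi2 u"
proof (rule ccontr)
  assume "\<not> 0 < phi2 u"
  then have "phi2 u = 0" using phi2_nonneg[of u] by linarith
  then have z: "(\<integral>y. y\<^sup>2 * exp (- u * y) \<partial>\<nu>) = 0" by (simp only: phi2_def)
  have "AE y in \<nu>. y\<^sup>2 * exp (- u * y) = 0"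
    using z integrable_power_exp[OF u, of 2] by (subst (asm) integral_nonneg_eq_0_iff_AE) auto
  with AE_pos have "AE y in \<nu>. False" by eventually_elim auto
  then have "(\<integral>\<^sup>+x\<in>{0<..<1}. ennreal x \<partial>\<nu>) = (\<integral>\<^sup>+x. 0 \<partial>\<nu>)"
    by (intro nn_integral_cong_AE) (auto elim: eventually_mono)
  then show False using assms by simp
qed

end

context scaled_levy_exponent begin

lemma Phi_growth:
  assumes "x\<^sub>0 < v" "v \<le> w"
  shows "c * (w / v) * (v\<^sup>2 * phi2 v) \<le> w\<^sup>2 * phi2 w"
proof -
  have v: "0 < v" using assms x0 by linarith
  have "w * (c * (v * phi2 v)) \<le> w * (w * phi2 w)"
    using scaling[OF assms] assms v by (intro mult_left_mono) auto
  then show ?thesis using v by (simp add: power2_eq_square mult_ac)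
qed

lemma Phi_inv_exponent:
  assumes \<phi>: "\<And>u. 0 \<le> u \<Longrightarrow> \<phi> u = phi u" and s: "0 < s"
  shows "0 < Phi_inv \<phi> s" "Phi \<phi> (Phi_inv \<phi> s) = s"
    and "\<And>q. 0 < q \<Longrightarrow> q \<le> Phi_inv \<phi> s \<Longrightarrow> Phi \<phi> q \<le> s"
    and "\<And>r. 0 < r \<Longrightarrow> (\<And>q. 0 < q \<Longrightarrow> q \<le> r \<Longrightarrow> Phi \<phi> q \<le> s) \<Longrightarrow> r \<le> Phi_inv \<phi> s"
proof -
  note eq = Phi_exponent[OF \<phi>]
  let ?N = "\<integral>y. min 1 (y\<^sup>2) \<partial>\<nu>"
  have N: "0 \<le> ?N" by (intro integral_nonneg_AE) auto
  have cont: "continuous_on {0<..} (Phi \<phi>)"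
  proof -
    have "continuous_on {0<..} (\<lambda>u. u\<^sup>2 * phi2 u)" by (intro continuous_intros continuous_phi2)
    then show ?thesis by (rule continuous_on_cong[THEN iffD1, rotated 2]) (auto simp: eq)
  qed
  have zero: "(Phi \<phi> \<longlongrightarrow> 0) (at_right 0)"
  proof (rule Lim_transform_eventually[OF square_phi2_tendsto_0])
    show "\<forall>\<^sub>F u in at_right 0. u\<^sup>2 * phi2 u = Phi \<phi> u"
      unfolding eventually_at_right_field using eq by (intro exI[of _ 1]) auto
  qed
  have bdd: "\<exists>K. \<forall>q\<in>{0<..r}. Phi \<phi> q \<le> K" for r
  proof (intro exI ballI)
    fix q assume q: "q \<in> {0<..r}"
    then have "q\<^sup>2 \<le> r\<^sup>2" by (intro power_mono) auto
    then have "(2 + q\<^sup>2) * ?N \<le> (2 + r\<^sup>2) * ?N" using N by (intro mult_right_mono) auto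
    then show "Phi \<phi> q \<le> (2 + r\<^sup>2) * ?N" using square_phi2_le[of q] q by (simp add: eq)
  qed
  define w where "w = x\<^sub>0 + 1"
  have w: "0 < w" "x\<^sub>0 < w" using x0 by (auto simp: w_def)
  define Q where "Q = w\<^sup>2 * phi2 w"
  have Q: "0 < Q" using w phi2_pos[of w] by (simp add: Q_def)
  define l where "l = 1 + s / (c * Q)"
  have l: "1 \<le> l" using s c Q by (simp add: l_def)
  have large: "s < Phi \<phi> (l * w)"
  proof -
    have "s < c * l * Q" using c Q s by (simp add: l_def field_simps)
    also have "\<dots> = c * (l * w / w) * (w\<^sup>2 * phi2 w)" using w by (simp add: Q_def)
    also have "\<dots> \<le> (l * w)\<^sup>2 * phi2 (l * w)" by (rule Phi_growth) (use w l in auto)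
    also have "\<dots> = Phi \<phi> (l * w)" using w l by (simp add: eq)
    finally show ?thesis .
  qed
  have lw: "0 < l * w" using l w by simp
  note props = Phi_inv_properties[OF s cont zero bdd lw large]
  show "0 < Phi_inv \<phi> s" "Phi \<phi> (Phi_inv \<phi> s) = s"
    and "\<And>q. 0 < q \<Longrightarrow> q \<le> Phi_inv \<phi> s \<Longrightarrow> Phi \<phi> q \<le> s"
    and "\<And>r. 0 < r \<Longrightarrow> (\<And>q. 0 < q \<Longrightarrow> q \<le> r \<Longrightarrow> Phi \<phi> q \<le> s) \<Longrightarrow> r \<le> Phi_inv \<phi> s"
    by (fact props)+
qed

text \<open>Above \<open>x\<^sub>0\<close> the scaling condition gives the linear growth of \<open>Phi\<close>. The value at \<open>1 / t\<close> can also fall below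
  \<open>x\<^sub>0\<close>, as \<open>Phi\<close> need not be monotone there; but then \<open>1 / t\<close> lies between \<open>Phi \<phi> x\<^sub>0 > 0\<close> and the bounded
  supremum of \<open>Phi\<close> on \<open>{0<..x\<^sub>0}\<close>, so that both inverses stay away from \<open>0\<close> and \<open>\<infinity>\<close>.\<close>

lemma Phi_inv_comparable:
  assumes \<phi>: "\<And>u. 0 \<le> u \<Longrightarrow> \<phi> u = phi u" and M: "1 \<le> M"
  shows "\<exists>\<kappa>>0. \<forall>t>0. t * Phi \<phi> x\<^sub>0 < 1 \<longrightarrow>
    Phi_inv \<phi> (1 / t) \<le> Phi_inv \<phi> (M / t) \<and> Phi_inv \<phi> (M / t) \<le> \<kappa> * Phi_inv \<phi> (1 / t)"
proof -
  note eq = Phi_exponent[OF \<phi>]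
  note inv = Phi_inv_exponent[OF \<phi>]
  let ?N = "\<integral>y. min 1 (y\<^sup>2) \<partial>\<nu>"
  have N: "0 \<le> ?N" by (intro integral_nonneg_AE) auto
  obtain r where r: "0 < r" "0 < x\<^sub>0 \<Longrightarrow> \<forall>q. 0 < q \<and> q \<le> r \<longrightarrow> q\<^sup>2 * phi2 q \<le> x\<^sub>0\<^sup>2 * phi2 x\<^sub>0"
  proof (cases "0 < x\<^sub>0")
    case True
    then have "0 < x\<^sub>0\<^sup>2 * phi2 x\<^sub>0" using phi2_pos by simp
    then have "\<forall>\<^sub>F q in at_right 0. q\<^sup>2 * phi2 q < x\<^sub>0\<^sup>2 * phi2 x\<^sub>0"
      by (rule order_tendstoD(2)[OF square_phi2_tendsto_0])
    then obtain d where d: "0 < d" "\<And>q. 0 < q \<Longrightarrow> q < d \<Longrightarrow> q\<^sup>2 * phi2 q < x\<^sub>0\<^sup>2 * phi2 x\<^sub>0"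
      unfolding eventually_at_right_field by auto
    have "q\<^sup>2 * phi2 q \<le> x\<^sub>0\<^sup>2 * phi2 x\<^sub>0" if "0 < q" "q \<le> d / 2" for q
      using d(2)[of q] that d(1) by (simp add: less_imp_le)
    then show ?thesis using that[of "d / 2"] d(1) by auto
  qed (use that[of 1] in auto)
  define w\<^sub>1 where "w\<^sub>1 = x\<^sub>0 + 1"
  have w1: "0 < w\<^sub>1" "x\<^sub>0 < w\<^sub>1" using x0 by (auto simp: w\<^sub>1_def)
  define Q where "Q = c * (w\<^sub>1\<^sup>2 * phi2 w\<^sub>1)"
  have Q: "0 < Q" using w1 c phi2_pos[of w\<^sub>1] by (simp add: Q_def)
  define W where "W = w\<^sub>1 + M * ((2 + x\<^sub>0\<^sup>2) * ?N) * w\<^sub>1 / Q"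
  have W: "0 < W" using w1 M N Q by (auto simp: W_def intro!: add_pos_nonneg)
  define \<kappa> where "\<kappa> = M / c + W / r"
  have parts: "0 < M / c" "0 < W / r" using M c W r by auto
  show ?thesis
  proof (intro exI[of _ \<kappa>] conjI allI impI)
    show "0 < \<kappa>" using parts by (simp add: \<kappa>_def)
    fix t assume t: "0 < t" and tx: "t * Phi \<phi> x\<^sub>0 < 1"
    define v where "v = Phi_inv \<phi> (1 / t)"
    define w where "w = Phi_inv \<phi> (M / t)"
    have pos: "0 < 1 / t" "0 < M / t" using t M by auto
    have v: "0 < v" "v\<^sup>2 * phi2 v = 1 / t" and w: "0 < w" "w\<^sup>2 * phi2 w = M / t"
      using inv(1,2)[OF _ pos(1)] inv(1,2)[OF _ pos(2)] eq by (auto simp: v_def w_def)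
    have "1 / t \<le> M / t" using M t by (simp add: divide_right_mono)
    then show vw: "Phi_inv \<phi> (1 / t) \<le> Phi_inv \<phi> (M / t)"
      using inv(3)[OF _ pos(1)] inv(1)[OF _ pos(1)] by (intro inv(4)[OF _ pos(2)]) (auto intro: order_trans)
    show "Phi_inv \<phi> (M / t) \<le> \<kappa> * Phi_inv \<phi> (1 / t)"
    proof (cases "x\<^sub>0 < v")
      case True
      have "c * (w / v) * (1 / t) \<le> M / t"
      proof -
        have "v \<le> w" using vw by (simp only: v_def w_def)
        from Phi_growth[OF True this] show ?thesis unfolding v(2) w(2) .
      qed
      then have "c * (w / v) \<le> M" using t by (simp add: field_simps)
      then have "w \<le> M / c * v" using v c by (simp add: field_simps)
      also have "\<dots> \<le> \<kappa> * v" using parts v by (intro mult_right_mono) (auto simp: \<kappa>_def)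
      finally show ?thesis by (simp add: v_def w_def)
    next
      case False
      then have x0p: "0 < x\<^sub>0" using v by linarith
      have "x\<^sub>0\<^sup>2 * phi2 x\<^sub>0 \<le> 1 / t" using tx t x0p by (simp add: eq field_simps)
      then have rv: "r \<le> v"
        unfolding v_def using r x0p eq by (intro inv(4)[OF _ pos(1)]) (auto intro: order_trans)
      have "1 / t \<le> (2 + v\<^sup>2) * ?N" using square_phi2_le[OF v(1)] v by simp
      also have "\<dots> \<le> (2 + x\<^sub>0\<^sup>2) * ?N" using False v N by (intro mult_right_mono) (auto intro!: power_mono)
      finally have "M * (1 / t) \<le> M * ((2 + x\<^sub>0\<^sup>2) * ?N)" using M by (intro mult_left_mono) auto
      then have Mt: "M / t \<le> M * ((2 + x\<^sub>0\<^sup>2) * ?N)" by simp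
      have "w \<le> W"
      proof (cases "w\<^sub>1 \<le> w")
        case True
        have "Q * w / w\<^sub>1 \<le> M / t"
          using Phi_growth[OF w1(2) True] unfolding w(2) Q_def by (simp add: mult_ac)
        then have "Q * w \<le> M / t * w\<^sub>1" by (simp only: pos_divide_le_eq[OF w1(1)])
        then have "w * Q \<le> M / t * w\<^sub>1" by (simp only: mult.commute[of w Q])
        then have "w \<le> M / t * w\<^sub>1 / Q" by (simp only: pos_le_divide_eq[OF Q])
        also have "\<dots> \<le> M * ((2 + x\<^sub>0\<^sup>2) * ?N) * w\<^sub>1 / Q"
          using Mt Q w1 by (intro divide_right_mono mult_right_mono) auto
        also have "\<dots> \<le> W" using w1 by (simp add: W_def)
        finally show ?thesis .
      next
        case False
        moreover have "0 \<le> M * ((2 + x\<^sub>0\<^sup>2) * ?N) * w\<^sub>1 / Q" using M N w1 Q by simp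
        ultimately show ?thesis unfolding W_def by linarith
      qed
      also have "W = W / r * r" using r by simp
      also have "\<dots> \<le> W / r * v" using rv parts by (intro mult_left_mono) auto
      also have "\<dots> \<le> \<kappa> * v" using parts v by (intro mult_right_mono) (auto simp: \<kappa>_def)
      finally show ?thesis by (simp add: v_def w_def)
    qed
  qed
qed

end

text \<open>With \<open>w = Phi_inv \<phi> (M / t)\<close> the variance \<open>t * (w\<^sup>2 * phi2 w)\<close> equals \<open>M\<close>. The last summand of \<open>M\<^sub>0\<close> makes
  \<open>M / t\<close> exceed \<open>Phi\<close> on \<open>{0<..3 * x\<^sub>0}\<close>, which places \<open>w\<close> in the range \<open>w > 2 * x\<^sub>0\<close> of the local bounds; for
  \<open>x\<^sub>0 = 0\<close> it is \<open>0\<close> by the convention for division by zero.\<close>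

lemma (in levy_semigroup) lower_bound_near_Phi_inv:
  assumes \<phi>: "\<And>u. 0 \<le> u \<Longrightarrow> \<phi> u = phi u"
  shows "\<exists>M\<^sub>0>1. \<forall>M\<ge>M\<^sub>0. \<forall>\<rho>\<^sub>1>0. \<forall>\<rho>\<^sub>2>0. \<exists>C>0. \<forall>t x.
    0 < t \<longrightarrow> ereal t < 1 / ereal (Phi \<phi> x\<^sub>0) \<longrightarrow>
    - \<rho>\<^sub>1 / Phi_inv \<phi> (1 / t) \<le> x + t * deriv \<phi> (Phi_inv \<phi> (M / t)) \<longrightarrow>
    x + t * deriv \<phi> (Phi_inv \<phi> (M / t)) \<le> \<rho>\<^sub>2 / Phi_inv \<phi> (1 / t) \<longrightarrow>
    p t x \<ge> C * Phi_inv \<phi> (1 / t)"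
proof -
  note eq = Phi_exponent[OF \<phi>]
  note inv = Phi_inv_exponent[OF \<phi>]
  let ?N = "\<integral>y. min 1 (y\<^sup>2) \<partial>\<nu>"
  define P0 where "P0 = Phi \<phi> x\<^sub>0"
  have P0: "P0 = x\<^sub>0\<^sup>2 * phi2 x\<^sub>0" using eq[of x\<^sub>0] x0 by (cases "x\<^sub>0 = 0") (auto simp: P0_def Phi_def)
  have P0_nonneg: "0 \<le> P0" unfolding P0 using phi2_nonneg by simp
  have P0_pos: "0 < P0" if "0 < x\<^sub>0" unfolding P0 using that phi2_pos by simp
  define M\<^sub>0 where "M\<^sub>0 = 2 + 2 * saddle_level\<^sup>2 / c + (2 + (3 * x\<^sub>0)\<^sup>2) * ?N / P0"
  have N: "0 \<le> ?N" by (intro integral_nonneg_AE) auto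
  have parts: "0 \<le> 2 * saddle_level\<^sup>2 / c" "0 \<le> (2 + (3 * x\<^sub>0)\<^sup>2) * ?N / P0" using c N P0_nonneg by auto
  show ?thesis
  proof (rule exI[of _ M\<^sub>0], intro conjI allI impI)
    show "1 < M\<^sub>0" using parts by (simp add: M\<^sub>0_def)
    fix M \<rho>\<^sub>1 \<rho>\<^sub>2 :: real assume M: "M\<^sub>0 \<le> M" and \<rho>: "0 < \<rho>\<^sub>1" "0 < \<rho>\<^sub>2"
    have M1: "1 \<le> M" "0 < M" using M parts by (auto simp: M\<^sub>0_def)
    have MK: "2 * saddle_level\<^sup>2 \<le> c * M"
    proof -
      have "2 * saddle_level\<^sup>2 / c \<le> M" using M parts unfolding M\<^sub>0_def by linarith
      then show ?thesis using c by (simp add: field_simps)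
    qed
    obtain \<kappa> where \<kappa>: "0 < \<kappa>" "\<And>t. 0 < t \<Longrightarrow> t * Phi \<phi> x\<^sub>0 < 1 \<Longrightarrow>
      Phi_inv \<phi> (1 / t) \<le> Phi_inv \<phi> (M / t) \<and> Phi_inv \<phi> (M / t) \<le> \<kappa> * Phi_inv \<phi> (1 / t)"
      using Phi_inv_comparable[OF \<phi> M1(1)] by blast
    define \<rho> where "\<rho> = \<kappa> * max \<rho>\<^sub>1 \<rho>\<^sub>2"
    have \<rho>0: "0 < \<rho>" using \<kappa> \<rho> by (simp add: \<rho>_def)
    define E where "E = legendre x\<^sub>0 / P0"
    have E: "0 \<le> E" using legendre_nonneg[OF x0] P0_nonneg by (simp add: E_def)
    obtain C where C: "0 < C" "\<And>t w x. 0 < t \<Longrightarrow> 2 * x\<^sub>0 < w \<Longrightarrow> t * (w\<^sup>2 * phi2 w) = M \<Longrightarrow> t * legendre x\<^sub>0 \<le> E \<Longrightarrow>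
        - \<rho> / w \<le> x + t * phi1 w \<Longrightarrow> x + t * phi1 w \<le> \<rho> / w \<Longrightarrow> C * w \<le> p t x"
      using lower_bound_near_mean[OF M1(2) MK \<rho>0 E] by blast
    show "\<exists>C>0. \<forall>t x. 0 < t \<longrightarrow> ereal t < 1 / ereal (Phi \<phi> x\<^sub>0) \<longrightarrow>
        - \<rho>\<^sub>1 / Phi_inv \<phi> (1 / t) \<le> x + t * deriv \<phi> (Phi_inv \<phi> (M / t)) \<longrightarrow>
        x + t * deriv \<phi> (Phi_inv \<phi> (M / t)) \<le> \<rho>\<^sub>2 / Phi_inv \<phi> (1 / t) \<longrightarrow>
        p t x \<ge> C * Phi_inv \<phi> (1 / t)"
    proof (intro exI[of _ C] conjI allI impI)
      fix t x :: real
      assume t: "0 < t" and tx: "ereal t < 1 / ereal (Phi \<phi> x\<^sub>0)"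
        and xl: "- \<rho>\<^sub>1 / Phi_inv \<phi> (1 / t) \<le> x + t * deriv \<phi> (Phi_inv \<phi> (M / t))"
        and xu: "x + t * deriv \<phi> (Phi_inv \<phi> (M / t)) \<le> \<rho>\<^sub>2 / Phi_inv \<phi> (1 / t)"
      have tP: "t * P0 < 1"
      proof (cases "P0 = 0")
        case False
        then have "0 < P0" using P0_nonneg by simp
        moreover have "t < 1 / P0" using tx False unfolding P0_def[symmetric] by (simp add: one_ereal_def)
        ultimately show ?thesis by (simp add: field_simps)
      qed simp
      define v where "v = Phi_inv \<phi> (1 / t)"
      define w where "w = Phi_inv \<phi> (M / t)"
      have pos: "0 < 1 / t" "0 < M / t" using t M1 by auto
      have v0: "0 < v" and w0: "0 < w" using inv(1)[OF _ pos(1)] inv(1)[OF _ pos(2)] by (auto simp: v_def w_def)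
      have vw: "v \<le> w" "w \<le> \<kappa> * v" using \<kappa>(2)[OF t] tP by (auto simp: v_def w_def P0_def)
      have wM: "t * (w\<^sup>2 * phi2 w) = M" using inv(2)[OF _ pos(2)] eq[OF _ w0] t by (simp add: w_def)
      have w2: "2 * x\<^sub>0 < w"
      proof (cases "x\<^sub>0 = 0")
        case False
        then have x0p: "0 < x\<^sub>0" using x0 by simp
        have "3 * x\<^sub>0 \<le> w"
          unfolding w_def
        proof (rule inv(4)[OF _ pos(2)])
          fix q assume q: "0 < q" "q \<le> 3 * x\<^sub>0"
          have "Phi \<phi> q \<le> (2 + q\<^sup>2) * ?N" using square_phi2_le[OF q(1)] eq[OF _ q(1)] by simp
          also have "\<dots> \<le> (2 + (3 * x\<^sub>0)\<^sup>2) * ?N" using q N by (intro mult_right_mono add_left_mono power_mono) auto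
          also have "\<dots> = (2 + (3 * x\<^sub>0)\<^sup>2) * ?N / P0 * P0" using P0_pos[OF x0p] by simp
          also have "\<dots> \<le> M * P0" using M parts P0_nonneg unfolding M\<^sub>0_def by (intro mult_right_mono) auto
          also have "\<dots> \<le> M / t"
          proof -
            have "P0 \<le> 1 / t" using tP t by (simp add: field_simps)
            from mult_left_mono[OF this, of M] show ?thesis using M1 by simp
          qed
          finally show "Phi \<phi> q \<le> M / t" .
        qed (use x0p in auto)
        then show ?thesis using x0p by linarith
      qed (use w0 in simp)
      have tE: "t * legendre x\<^sub>0 \<le> E"
      proof (cases "x\<^sub>0 = 0")
        case True
        then show ?thesis using E by (simp add: legendre_zero)
      next
        case False
        then have p0: "0 < P0" using P0_pos x0 by simp
        then have "t \<le> 1 / P0" using tP by (simp add: field_simps)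
        from mult_right_mono[OF this legendre_nonneg[OF x0]] show ?thesis by (simp add: E_def)
      qed
      have d: "deriv \<phi> w = phi1 w" by (rule deriv_exponent(1)[OF \<phi> w0])
      have scale: "\<rho>' / v \<le> \<rho> / w" if "\<rho>' \<le> max \<rho>\<^sub>1 \<rho>\<^sub>2" "0 < \<rho>'" for \<rho>'
      proof -
        have "\<rho>' * w \<le> max \<rho>\<^sub>1 \<rho>\<^sub>2 * (\<kappa> * v)"
          using that vw w0 \<kappa>(1) v0 by (intro mult_mono) auto
        then show ?thesis using v0 w0 by (simp add: \<rho>_def field_simps)
      qed
      have "C * w \<le> p t x"
      proof (rule C(2)[OF t w2 wM tE])
        show "- \<rho> / w \<le> x + t * phi1 w"
          using xl scale[of \<rho>\<^sub>1] \<rho> unfolding v_def[symmetric] w_def[symmetric] d by simp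
        show "x + t * phi1 w \<le> \<rho> / w"
          using xu scale[of \<rho>\<^sub>2] \<rho> unfolding v_def[symmetric] w_def[symmetric] d by simp
      qed
      moreover have "C * v \<le> C * w" using vw C(1) by simp
      ultimately show "p t x \<ge> C * Phi_inv \<phi> (1 / t)" unfolding v_def[symmetric] by linarith
    qed (rule C(1))
  qed
qed

section \<open>The marginals of the process\<close>

lemma (in prob_space) indep_var_of_indep_vars:
  assumes "indep_vars (\<lambda>_. N) Y {..<2::nat}"
  shows "indep_var N (Y 0) N (Y 1)"
proof -
  have "indep_var (PiM {0} (\<lambda>_. N)) (\<lambda>\<omega>. restrict (\<lambda>i. Y i \<omega>) {0})
      (PiM {1} (\<lambda>_. N)) (\<lambda>\<omega>. restrict (\<lambda>i. Y i \<omega>) {1})"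
    using assms by (rule indep_var_restrict) auto
  then have "indep_var N ((\<lambda>f. f 0) \<circ> (\<lambda>\<omega>. restrict (\<lambda>i. Y i \<omega>) {0}))
      N ((\<lambda>f. f 1) \<circ> (\<lambda>\<omega>. restrict (\<lambda>i. Y i \<omega>) {1}))"
    by (rule indep_var_compose) (auto intro: measurable_component_singleton)
  then show ?thesis by (simp add: comp_def)
qed

lemma (in levy_process) law_convolution:
  assumes s: "0 < s" and r: "0 < r"
  shows "distr M borel (X (s + r)) = (distr M borel (X s) \<star> distr M borel (X r))"
proof -
  define \<tau> :: "nat \<Rightarrow> real" where "\<tau> k = (if k = 0 then 0 else if k = 1 then s else s + r)" for k
  have "indep_vars (\<lambda>_. borel) (\<lambda>k \<omega>. X (\<tau> (Suc k)) \<omega> - X (\<tau> k) \<omega>) {..<2::nat}"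
    by (rule indep_increments) (use s r in \<open>auto simp: \<tau>_def\<close>)
  from indep_var_of_indep_vars[OF this]
  have ind: "indep_var borel (\<lambda>\<omega>. X s \<omega> - X 0 \<omega>) borel (\<lambda>\<omega>. X (s + r) \<omega> - X s \<omega>)"
    by (simp add: \<tau>_def)
  have rv[measurable]: "random_variable borel (X s)" "random_variable borel (X 0)" "random_variable borel (X (s + r))"
    using random_variable_X s r by auto
  have inc: "distr M borel (\<lambda>\<omega>. X h \<omega> - X 0 \<omega>) = distr M borel (X h)" if "0 \<le> h" for h
    using stationary_increments[of 0 h] that by simp
  have "distr M borel (X (s + r)) = distr M borel (\<lambda>\<omega>. X (s + r) \<omega> - X 0 \<omega>)"
    using inc[of "s + r"] s r by simp
  also have "\<dots> = distr M borel (\<lambda>\<omega>. (X s \<omega> - X 0 \<omega>) + (X (s + r) \<omega> - X s \<omega>))"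
    by (simp add: algebra_simps)
  also have "\<dots> = (distr M borel (\<lambda>\<omega>. X s \<omega> - X 0 \<omega>) \<star> distr M borel (\<lambda>\<omega>. X (s + r) \<omega> - X s \<omega>))"
    by (rule sum_indep_random_variable[OF ind]) measurable
  also have "\<dots> = (distr M borel (X s) \<star> distr M borel (X r))"
    using inc[of s] stationary_increments[of s r] s r by simp
  finally show ?thesis .
qed

theorem lemma4p10:
  fixes P :: "'a measure" and X :: "real \<Rightarrow> 'a \<Rightarrow> real"
    and \<sigma> b :: real and \<nu> :: "real measure"
    and \<phi> :: "real \<Rightarrow> real" and p :: "real \<Rightarrow> real \<Rightarrow> real"
    and \<alpha> c x\<^sub>0 :: real
  assumes "spectrally_positive_levy_process P X"
    and "is_laplace_exponent P X \<phi>"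
    and "\<sigma> \<ge> 0" and "levy_measure \<nu>"
    and "\<And>u. u \<ge> 0 \<Longrightarrow> \<phi> u = levy_khintchine \<sigma> b \<nu> u"
    and "unbounded_variation \<sigma> \<nu>"
    and "\<And>t. t > 0 \<Longrightarrow> is_continuous_density P (X t) (p t)"
    and "\<sigma> = 0"
    and "0 < c" and "c \<le> 1" and "x\<^sub>0 \<ge> 0" and "\<alpha> \<ge> 1"
    and "deriv (deriv \<phi>) \<in> WLSC (\<alpha> - 2) c x\<^sub>0"
  shows "\<exists>M\<^sub>0>1. \<forall>M\<ge>M\<^sub>0. \<forall>\<rho>\<^sub>1>0. \<forall>\<rho>\<^sub>2>0. \<exists>C>0. \<forall>t x.
    0 < t \<longrightarrow> ereal t < 1 / ereal (Phi \<phi> x\<^sub>0) \<longrightarrow>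
    - \<rho>\<^sub>1 / Phi_inv \<phi> (1 / t) \<le> x + t * deriv \<phi> (Phi_inv \<phi> (M / t)) \<longrightarrow>
    x + t * deriv \<phi> (Phi_inv \<phi> (M / t)) \<le> \<rho>\<^sub>2 / Phi_inv \<phi> (1 / t) \<longrightarrow>
    p t x \<ge> C * Phi_inv \<phi> (1 / t)"
proof -
  interpret X: spectrally_positive_levy_process P X by (rule assms)
  interpret E: levy_exponent \<nu> b by unfold_locales (rule assms)
  have \<phi>: "\<phi> u = E.phi u" if "0 \<le> u" for u
    using assms(5)[OF that] assms(8) by (simp add: E.phi_def)
  have d2: "deriv (deriv \<phi>) u = E.phi2 u" if "0 < u" for u
    by (rule E.deriv_exponent(2)[OF \<phi> that])
  have uv: "(\<integral>\<^sup>+x\<in>{0<..<1}. ennreal x \<partial>\<nu>) = \<infinity>"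
    using assms(6,8) by (simp add: unbounded_variation_def)
  have scaling: "c * (x * E.phi2 x) \<le> s * E.phi2 s" if xs: "x\<^sub>0 < x" "x \<le> s" for x s
  proof -
    have x: "0 < x" and s: "0 < s" using xs assms(11) by linarith+
    have u: "1 \<le> s / x" using xs x by simp
    have "c * (s / x) powr (\<alpha> - 2) * deriv (deriv \<phi>) x \<le> deriv (deriv \<phi>) (s / x * x)"
      using assms(13) u xs(1) unfolding WLSC_def by blast
    then have le: "c * (s / x) powr (\<alpha> - 2) * E.phi2 x \<le> E.phi2 s" using x s by (simp add: d2)
    have "x / s = (s / x) powr (- 1)" using x s by (simp add: powr_minus_divide)
    also have "\<dots> \<le> (s / x) powr (\<alpha> - 2)" using u assms(12) by (intro powr_mono) auto
    finally have "c * (x / s) * E.phi2 x \<le> c * (s / x) powr (\<alpha> - 2) * E.phi2 x"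
      using assms(9) E.phi2_nonneg[of x] by (intro mult_right_mono mult_left_mono) auto
    then have "c * (x / s) * E.phi2 x \<le> E.phi2 s" using le by linarith
    then show ?thesis using s by (simp add: field_simps)
  qed
  interpret S: levy_semigroup \<nu> b c x\<^sub>0 "\<lambda>t. distr P borel (X t)" p
  proof (intro levy_semigroup.intro scaled_levy_exponent.intro scaled_levy_exponent_axioms.intro
      levy_semigroup_axioms.intro)
    show "levy_exponent \<nu>" by (rule E.levy_exponent_axioms)
    show "0 < c" "c \<le> 1" "0 \<le> x\<^sub>0" by (fact assms)+
    show "c * (x * E.phi2 x) \<le> s * E.phi2 s" if "x\<^sub>0 < x" "x \<le> s" for x s by (rule scaling[OF that])
    show "0 < E.phi2 u" if "0 < u" for u by (rule E.phi2_pos_of_unbounded_variation[OF uv that])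
    fix t :: real assume t: "0 < t"
    have rv[measurable]: "X t \<in> borel_measurable P" using X.random_variable_X t by simp
    show "real_distribution (distr P borel (X t))" by (rule X.real_distribution_distr[OF rv])
    show "has_bochner_integral (distr P borel (X t)) (\<lambda>x. exp (- u * x)) (exp (t * E.phi u))" if u: "0 < u" for u
    proof -
      have "has_bochner_integral P (\<lambda>\<omega>. exp (- u * X t \<omega>)) (exp (t * E.phi u))"
        using assms(2) t u \<phi>[of u] unfolding is_laplace_exponent_def by (metis less_imp_le)
      then show ?thesis by (simp add: has_bochner_integral_iff integrable_distr_eq integral_distr)
    qed
    have dens: "is_continuous_density P (X t) (p t)" by (rule assms(7)[OF t])
    show "continuous_on UNIV (p t)" and "0 \<le> p t x" for x
      using dens by (auto simp: is_continuous_density_def)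
    have "distr P lborel (X t) = density lborel (\<lambda>x. ennreal (p t x))"
      using dens by (simp add: is_continuous_density_def distributed_def)
    moreover have "distr P lborel (X t) = distr P borel (X t)" by (rule distr_cong) auto
    ultimately show "distr P borel (X t) = density lborel (\<lambda>x. ennreal (p t x))" by simp
    fix r :: real assume r: "0 < r"
    show "distr P borel (X (t + r)) = (distr P borel (X t) \<star> distr P borel (X r))"
      by (rule X.law_convolution[OF t r])
  qed
  show ?thesis by (rule S.lower_bound_near_Phi_inv[OF \<phi>])
qed

end
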